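(* Let $d\ge 1$ and $p\ge 2$ be integers and let $K$ be a global field (if $\operatorname{char}K>0$, we require that $\operatorname{char}K$ be coprime to $p$). For each $j\in\{1,\dots,d\}$ and $k\in\{0,\dots,p-1\}$ let $a_{j,k}$ and $b_{j,k}$ be indeterminates, and let $R_d(K)$ (written $R$) be the ring of polynomials in the $a_{j,k}$ and $b_{j,k}$ with coefficients in $\mathcal{O}_K$, a free $\mathcal O_K$-algebra in $2dp$ indeterminates. Let $$\mathcal{R}=\mathcal{R}_d(K)=\frac{R[x_1,\dots,x_d]}{\langle (1-a_{1,0})x_1-1,\dots,(1-a_{d,0})x_d-1\rangle}$$ be the localization of $R$ away from the prime ideal $\langle 1-a_{1,0},\dots,1-a_{d,0}\rangle$. Let $\mathcal{F}$ be a digital $\mathcal{R}$-frame on $\mathbb{Z}_p$ such that $$|a_{j,0}|_{\mathcal{F}(\mathfrak{z})}\limsup_{n\to\infty}\prod_{k=1}^{p-1}\left|\frac{a_{j,k}}{a_{j,0}}\right|_{\mathcal{F}(\mathfrak{z})}^{\#_{p:k}([\mathfrak{z}]_{p^n})/n}<1,\qquad \forall \mathfrak{z}\in D(\mathcal{F}),\ \forall j\in\{1,\dots,d\}.$$ Let $I$ be any ideal of $R$ such that $\langle 1-a_{j,0}\rangle\nsubseteq I$ for all $j\in\{1,\dots,d\}$. Write $\mathcal{F}/I$ for the quotient frame $\mathcal{F}/I\mathcal{R}$ induced by $\mathcal F$ and the ideal $I\mathcal R\subseteq\mathcal R$, and $\mathbb{K}=\mathrm{Frac}(\mathcal{R}/I\mathcal{R})$.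 Then: (I) For each $j\in\{1,\dots,d\}$ there exists a unique rising-continuous function $X_j\in C(\mathcal{F}/I)$ such that $$X_j(\mathfrak{z})=a_{j,[\mathfrak{z}]_p}X_j(\theta_p(\mathfrak{z}))+b_{j,[\mathfrak{z}]_p}\quad\text{in }(\mathcal{F}/I)(\mathfrak{z}),\qquad\forall\mathfrak{z}\in D(\mathcal{F}/I),$$ where $(\mathcal F/I)(\mathfrak z)$ is the completion of $\mathcal R/I\mathcal R$ with respect to the absolute value that $\mathcal F/I$ associates to $\mathfrak z$. (II) For any $\mathbf{n}=(n_1,\dots,n_d)\in\mathbb{N}_0^d$ the function $X_{\mathbf{n}}=\prod_{j=1}^d X_j^{n_j}\in C(\mathcal{F}/I)$ is $\mathcal{F}/I$-quasi-integrable. A Fourier transform of it is denoted $\hat X_{\mathbf{n}}=\bigstar_{j=1}^d\hat X_j^{*n_j}:\hat{\mathbb{Z}}_p\to\mathbb{K}(\zeta_{p^\infty})$, where $\bigstar$ denotes formal convolution and $\hat X_j^{*n_j}$ is the convolution identity $\mathbf{1}_0$ whenever $n_j=0$. It is given as follows. The starting values are $\hat X_{\mathbf{0}}=\mathbf{1}_0$ and the Fourier transforms $\hat X_j$ of the individual $X_j$: with $\alpha_j(t)=\frac1p\sum_{k=0}^{p-1}a_{j,k}e^{-2\pi i kt}$, $\beta_j(t)=\frac1p\sum_{k=0}^{p-1} b_{j,k}e^{-2\pi i kt}$, $\gamma_j=\beta_j/\alpha_j$, $\hat A_j(t)=\prod_{n=0}^{-v_p(t)-1}\alpha_j(p^nt)$: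 if $\alpha_j(0)=1$ in $\mathcal R/I\mathcal R$, then $\hat X_j(0)=0$ and $\hat X_j(t)=\bigl(\beta_j(0)v_p(t)+\gamma_j(t|t|_p/p)\bigr)\hat A_j(t)$ for $t\ne0$; if $\alpha_j(0)\neq1$, then $\hat X_j(0)=\frac{\beta_j(0)}{1-\alpha_j(0)}$ and $\hat X_j(t)=\bigl(\frac{\beta_j(0)}{1-\alpha_j(0)}+\gamma_j(t|t|_p/p)\bigr)\hat A_j(t)$ for $t\neq0$. Using these, one has the formula $\hat X_{\mathbf{n}}(t)=\hat f_{\mathbf{n}}(t)-\hat g_{\mathbf{n}}(t)$, where $$\hat f_{\mathbf{n}}(t)=\sum_{\mathbf{m}<\mathbf{n}}\ \sum_{n=0}^{-v_p(t)-2}\Bigl(\prod_{m=0}^{n-1}\alpha_{\mathbf{n}}(p^mt)\Bigr)\alpha_{\mathbf{m},\mathbf{n}}(p^nt)\,\hat X_{\mathbf{m}}(p^{n+1}t),$$ and: if $\alpha_{\mathbf{n}}(0)=1$, then $\hat g_{\mathbf{n}}(0)=0$ and $\hat g_{\mathbf{n}}(t)=\bigl(\beta_{\mathbf{n}}(0)v_p(t)+\gamma_{\mathbf{n}}(t|t|_p/p)\bigr)\hat A_{\mathbf{n}}(t)$ for $t\ne 0$; if $\alpha_{\mathbf{n}}(0)\neq 1$, then $\hat g_{\mathbf{n}}(0)=\frac{\beta_{\mathbf{n}}(0)}{1-\alpha_{\mathbf{n}}(0)}$ and $\hat g_{\mathbf{n}}(t)=\bigl(\frac{\beta_{\mathbf{n}}(0)}{1-\alpha_{\mathbf{n}}(0)}+\gamma_{\mathbf{n}}(t|t|_p/p)\bigr)\hat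 A_{\mathbf{n}}(t)$ for $t\neq0$. Here, for all $\mathbf{m}\le\mathbf{n}$, the functions $\alpha_{\mathbf m,\mathbf n},\beta_{\mathbf n},\gamma_{\mathbf n},\hat A_{\mathbf n}:\hat{\mathbb Z}_p\to\mathbb K(\zeta_{p^\infty})$ are given by $$r_{\mathbf{m},\mathbf{n},k}=\prod_{j=1}^d\binom{n_j}{m_j}a_{j,k}^{m_j}b_{j,k}^{n_j-m_j},\quad \alpha_{\mathbf{m},\mathbf{n}}(t)=\frac1p\sum_{k=0}^{p-1}r_{\mathbf{m},\mathbf{n},k}e^{-2\pi i kt},\quad \alpha_{\mathbf{n}}=\alpha_{\mathbf{n},\mathbf{n}},$$ $$c_{\mathbf{n},k}=-\sum_{\mathbf{m}<\mathbf{n}}r_{\mathbf{m},\mathbf{n},k}\hat X_{\mathbf{m}}(0),\quad \beta_{\mathbf{n}}(t)=\frac1p\sum_{k=0}^{p-1}c_{\mathbf{n},k}e^{-2\pi ikt},\quad \gamma_{\mathbf{n}}=\frac{\beta_{\mathbf{n}}}{\alpha_{\mathbf{n}}},\quad \hat A_{\mathbf{n}}(t)=\prod_{n=0}^{-v_p(t)-1}\alpha_{\mathbf{n}}(p^nt).$$ (III) For all $j\in\{1,\dots,d\}$, $\hat X_j$ is the Fourier–Stieltjes transform of a distribution in $\mathcal{S}(\mathbb{Z}_p,\mathbb{K})'$, denoted $X_j(\mathfrak{z})d\mathfrak{z}$. For any $\mathbf{n}\in\mathbb{N}_0^d$ define a pointwise product $$X_{\mathbf{n}}(\mathfrak{z})d\mathfrak{z}=\prod_{j=1}^d(X_j(\mathfrak{z})d\mathfrak{z})^{n_j}=\Bigl(\prod_{j=1}^dX_j^{n_j}(\mathfrak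 z)\Bigr)d\mathfrak z,$$ the last expression being the distribution whose Fourier–Stieltjes transform is $\bigstar_{j=1}^d\hat X_j^{*n_j}$ as given in (II). Consequently one gets a polynomial algebra $K[X_1(\mathfrak{z})d\mathfrak{z},\dots,X_d(\mathfrak{z})d\mathfrak{z}]$. Moreover, the Fourier transform induces an isomorphism from this algebra to the $K$-algebra generated by $\hat X_1,\dots,\hat X_d$ under convolution. (Warning: in this convolution algebra $\bigstar_{j=1}^d\hat X_j^{*n_j}$ is in general not given by iterating $(\hat f*\hat g)(t)=\sum_{s\in\hat{\mathbb Z}_p}\hat f(s)\hat g(t-s)$, since that sum will be divergent or non-convergent; rather it is defined to be the function given by the formula in (II).)
   Context: Basic notation. $\mathbb{N}_0=\{0,1,2,\dots\}$. $\mathcal O_K$ is the ring of integers of $K$; $\mathrm{Frac}$ denotes the field of fractions. $\mathbb{Z}_p$ is the ring of $p$-adic integers, for composite $p$ defined as $\prod_{\ell\mid p}\mathbb{Z}_\ell^{v_\ell(p)}$ over the prime divisors $\ell$ of $p$; its elements are treated as having digit expansions $\sum_{n\ge0}d_np^n$, $d_n\in\{0,\dots,p-1\}$. $[\mathfrak{z}]_{p^n}\in\{0,\dots,p^n-1\}$ is the integer congruent to $\mathfrak{z}$ mod $p^n$; $\theta_p(\mathfrak{z})=(\mathfrak{z}-[\mathfrak{z}]_p)/p$. For $1\le k\le p-1$, $\#_{p:k}(n)$ is the number of base-$p$ digits of $n\in\mathbb{N}_0$ equal to $k$. $\hat{\mathbb{Z}}_p=\mathbb{Z}[1/p]/\mathbb{Z}$,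 identified with the rationals in $[0,1)$ with $p$-power denominator; for $t\neq0$ in irreducible form $t=k/p^n$, $|t|_p=p^n$ and $v_p(t)=-n$; $|0|_p=0$, $v_p(0)=+\infty$. $\mathbf{1}_0(t)=1$ if $t=0$ in $\hat{\mathbb{Z}}_p$, else $0$. A compatible choice of $p$-power roots of unity $e^{2\pi i/p^n}$ is fixed; $A(\zeta_{p^\infty})$ is $A$ with all of them adjoined; $e^{2\pi i\{t\mathfrak{z}\}_p}=1$ if $t=0$ and $e^{2\pi i t[\mathfrak{z}]_{|t|_p}}$ otherwise. Sums (resp. products) whose upper limit is less than the lower limit are $0$ (resp. $1$). For $\mathbf m,\mathbf n\in\mathbb{N}_0^d$: $\mathbf m\le\mathbf n$ is entrywise, and $\mathbf m<\mathbf n$ means $\mathbf m\le\mathbf n$ with $m_j<n_j$ for at least one $j$. If $\alpha$ vanishes at $t|t|_p/p$, the product $\gamma(t|t|_p/p)\hat A(t)$ is read by cancelling the denominator of $\gamma$ against the corresponding factor of $\hat A(t)$. Frames. All frames are taken to be evaluative, multiplicative and reffinite. Thus, for a commutative unital ring $A$, an $A$-frame $\mathcal{F}$ on $\mathbb{Z}_p$ consists of a set $D(\mathcal{F})$ with $\mathbb{N}_0\subseteq D(\mathcal{F})\subseteq\mathbb{Z}_p$ and $\theta_p(D(\mathcal{F}))\subseteq D(\mathcal{F})$, and for each $\mathfrak{z}\in D(\mathcal{F})$ an absolute value $|\cdot|_{\mathcal{F}(\mathfrak{z})}$ on $A$ (a multiplicative ring norm) with $|\cdot|_{\mathcal{F}(\mathfrak{z})}=|\cdot|_{\mathcal{F}(\theta_p(\mathfrak{z}))}$;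 one puts $\mathcal{F}_{\mathfrak z}(f)=|f(\mathfrak z)|_{\mathcal F(\mathfrak z)}$. $\mathcal{F}(\mathfrak{z})$ also denotes the completion of $A$ with respect to $|\cdot|_{\mathcal{F}(\mathfrak{z})}$, and $C(\mathcal{F})=\prod_{\mathfrak{z}\in D(\mathcal{F})}\mathcal{F}(\mathfrak{z})$, viewed as functions on $D(\mathcal{F})$. A sequence $f_n$ $\mathcal F$-converges to $f$ if $\mathcal F_{\mathfrak z}(f_n-f)\to0$ in $\mathbb R$ for all $\mathfrak{z}\in D(\mathcal{F})$. $f\in C(\mathcal{F})$ is rising-continuous if $f(\mathfrak{z})=\lim_n f([\mathfrak{z}]_{p^n})$ with respect to $\mathcal{F}$. For an ideal $J\subseteq A$, the quotient frame $\mathcal{F}/J$ is the $A/J$-frame with the same domain and $(\mathcal F/J)_{\mathfrak z}(f)=\inf_{g}\mathcal F_{\mathfrak z}(f+g)$, the infimum being over $J$-valued functions $g$ on $D(\mathcal F)$. $\mathcal{F}$ is digital if there are absolute values $v_0,\dots,v_{p-1}$ on $A$ with $|\cdot|_{\mathcal{F}(\mathfrak{z})}=v_k$ for $\mathfrak{z}\in D_k\cap D(\mathcal{F})$, where $D_0=\mathbb{N}_0$, $D_1$ is the set of $\mathfrak{z}$ with infinitely many digits equal to $1$, and, for $2\le k\le p-1$, $D_k$ is the set of $\mathfrak{z}\notin D_1\cup\dots\cup D_{k-1}$ with infinitely many digits equal to $k$. Quasi-integrability. For an $A$-frame $\mathcal F$ (this notion being defined for integral domains $A$ with characteristic $0$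 or coprime to $p$), $X\in C(\mathcal{F})$ is $\mathcal{F}$-quasi-integrable if there is $\hat X:\hat{\mathbb{Z}}_p\to\mathrm{Frac}(A)(\zeta_{p^\infty})$ with $\lim_{N\to\infty}\sum_{|t|_p\le p^N}\hat X(t)e^{2\pi i\{t\mathfrak{z}\}_p}=X(\mathfrak{z})$ with respect to $\mathcal{F}$; such an $\hat X$ is called a Fourier transform of $X$. Distributions. $\mathcal{S}(\mathbb{Z}_p,\mathbb{K})$ is the space of locally constant functions $\mathbb{Z}_p\to\mathbb{K}$; $\mathcal{S}(\mathbb{Z}_p,\mathbb{K})'$ is its dual (distributions). For $\phi$ locally constant mod $p^N$, $\hat\phi(t)=\mathbf{1}_0(p^Nt)p^{-N}\sum_{n=0}^{p^N-1}\phi(n)e^{-2\pi int}$. A distribution $d\mu$ has Fourier–Stieltjes transform $\hat\mu(t)=\int_{\mathbb Z_p} e^{-2\pi i\{t\mathfrak{z}\}_p}d\mu(\mathfrak z)$, and $\int_{\mathbb Z_p}\phi\,d\mu=\sum_{t\in\hat{\mathbb Z}_p}\hat\phi(t)\hat\mu(-t)$.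
   Formalization: F/I is assumed to be a frame (its infima are absolute values), as the conventions presuppose; in (III) the product can be ill-defined on the span, so both algebras are polynomial rings modulo polynomials all of whose multiples vanish, over any subfield of Frac(R/IR) in place of K. *)

theory Defs
  imports
    "HOL-Algebra.Algebraic_Closure_Type"
    "HOL-Algebra.Generated_Fields"
    "HOL-Library.Poly_Mapping"
    "HOL-Library.Extended_Real"
begin

section \<open>The p-adic integers and the dual group\<close>

text \<open>A p-adic integer is its sequence of base-p digits (p need not be prime);
  \<open>z 0\<close> is its residue mod p, and a natural number is identified with \<open>digits p m\<close>.\<close>

definition Zp :: "nat \<Rightarrow> (nat \<Rightarrow> nat) set" where
  "Zp p = {z. \<forall>i. z i < p}"

definition digits :: "nat \<Rightarrow> nat \<Rightarrow> (nat \<Rightarrow> nat)" where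
  "digits p m = (\<lambda>i. m div p ^ i mod p)"

definition trunc :: "nat \<Rightarrow> nat \<Rightarrow> (nat \<Rightarrow> nat) \<Rightarrow> nat" where
  "trunc p n z = (\<Sum>i<n. z i * p ^ i)"

definition theta :: "(nat \<Rightarrow> nat) \<Rightarrow> (nat \<Rightarrow> nat)" where
  "theta z = (\<lambda>i. z (Suc i))"

text \<open>Only meaningful for \<open>k \<ge> 1\<close>: every natural number has infinitely many digits 0 here.\<close>

definition digit_count :: "nat \<Rightarrow> nat \<Rightarrow> nat \<Rightarrow> nat" where
  "digit_count p k m = card {i. digits p m i = k}"

text \<open>The group \<open>\<int>[1/p]/\<int>\<close>, with representatives in \<open>[0,1)\<close>. The exponent \<open>lvl p t\<close> is
  \<open>- v\<^sub>p(t)\<close> when \<open>t \<noteq> 0\<close>, and \<open>lvl p 0 = 0\<close>, so that a range \<open>n < lvl p t\<close> is empty at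
  \<open>t = 0\<close>, as is the range \<open>0 \<le> n \<le> - v\<^sub>p(0) - 1\<close>.\<close>

definition hatZ :: "nat \<Rightarrow> rat set" where
  "hatZ p = {t. 0 \<le> t \<and> t < 1 \<and> (\<exists>n. t * of_nat p ^ n \<in> \<int>)}"

definition lvl :: "nat \<Rightarrow> rat \<Rightarrow> nat" where
  "lvl p t = (LEAST n. t * of_nat p ^ n \<in> \<int>)"

definition tabs :: "nat \<Rightarrow> rat \<Rightarrow> nat" where
  "tabs p t = (if t = 0 then 0 else p ^ lvl p t)"

text \<open>The product \<open>m t\<close> in \<open>\<int>[1/p]/\<int>\<close>.\<close>

definition hmul :: "nat \<Rightarrow> rat \<Rightarrow> rat" where
  "hmul m t = frac (of_nat m * t)"

text \<open>\<open>cexp p \<zeta> x\<close> stands for \<open>e\<^bsup>2\<pi>ix\<^esup>\<close>, where \<open>\<zeta> n\<close> stands for \<open>e\<^bsup>2\<pi>i/p^n\<^esup>\<close>; it is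
  1-periodic in \<open>x\<close>. \<open>pairing p \<zeta> t z\<close> stands for \<open>e\<^bsup>2\<pi>i{tz}\<^esup>\<close>.\<close>

definition cexp :: "nat \<Rightarrow> (nat \<Rightarrow> 'l::field) \<Rightarrow> rat \<Rightarrow> 'l" where
  "cexp p \<zeta> x = \<zeta> (lvl p x) ^ nat \<lfloor>frac x * of_nat p ^ lvl p x\<rfloor>"

definition pairing :: "nat \<Rightarrow> (nat \<Rightarrow> 'l::field) \<Rightarrow> rat \<Rightarrow> (nat \<Rightarrow> nat) \<Rightarrow> 'l" where
  "pairing p \<zeta> t z = (if t = 0 then 1 else cexp p \<zeta> (t * of_nat (trunc p (lvl p t) z)))"

section \<open>Completions\<close>

definition absolute_value :: "('a, 'm) ring_scheme \<Rightarrow> ('a \<Rightarrow> real) \<Rightarrow> bool" where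
  "absolute_value A \<nu> \<longleftrightarrow>
     (\<forall>x\<in>carrier A. 0 \<le> \<nu> x \<and> (\<nu> x = 0 \<longleftrightarrow> x = \<zero>\<^bsub>A\<^esub>)) \<and>
     \<nu> \<one>\<^bsub>A\<^esub> = 1 \<and>
     (\<forall>x\<in>carrier A. \<forall>y\<in>carrier A. \<nu> (x \<otimes>\<^bsub>A\<^esub> y) = \<nu> x * \<nu> y) \<and>
     (\<forall>x\<in>carrier A. \<forall>y\<in>carrier A. \<nu> (x \<oplus>\<^bsub>A\<^esub> y) \<le> \<nu> x + \<nu> y)"

definition cauchy_ring :: "('a, 'm) ring_scheme \<Rightarrow> ('a \<Rightarrow> real) \<Rightarrow> (nat \<Rightarrow> 'a) ring" where
  "cauchy_ring A \<nu> = \<lparr>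
     carrier = {s. (\<forall>n. s n \<in> carrier A) \<and>
       (\<forall>e>0. \<exists>N. \<forall>m\<ge>N. \<forall>n\<ge>N. \<nu> (s m \<ominus>\<^bsub>A\<^esub> s n) < e)},
     monoid.mult = (\<lambda>s t n. s n \<otimes>\<^bsub>A\<^esub> t n),
     one = (\<lambda>n. \<one>\<^bsub>A\<^esub>),
     ring.zero = (\<lambda>n. \<zero>\<^bsub>A\<^esub>),
     add = (\<lambda>s t n. s n \<oplus>\<^bsub>A\<^esub> t n)\<rparr>"

definition null_seqs :: "('a, 'm) ring_scheme \<Rightarrow> ('a \<Rightarrow> real) \<Rightarrow> (nat \<Rightarrow> 'a) set" where
  "null_seqs A \<nu> = {s \<in> carrier (cauchy_ring A \<nu>). (\<lambda>n. \<nu> (s n)) \<longlonglongrightarrow> 0}"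

definition completion :: "('a, 'm) ring_scheme \<Rightarrow> ('a \<Rightarrow> real) \<Rightarrow> (nat \<Rightarrow> 'a) set ring" where
  "completion A \<nu> = cauchy_ring A \<nu> Quot null_seqs A \<nu>"

definition compl_emb :: "('a, 'm) ring_scheme \<Rightarrow> ('a \<Rightarrow> real) \<Rightarrow> 'a \<Rightarrow> (nat \<Rightarrow> 'a) set" where
  "compl_emb A \<nu> x = null_seqs A \<nu> +>\<^bsub>cauchy_ring A \<nu>\<^esub> (\<lambda>n. x)"

definition compl_norm :: "('a \<Rightarrow> real) \<Rightarrow> (nat \<Rightarrow> 'a) set \<Rightarrow> real" where
  "compl_norm \<nu> c = lim (\<lambda>n. \<nu> ((SOME s. s \<in> c) n))"

section \<open>Frames\<close>

record 'a frame =
  frame_dom :: "(nat \<Rightarrow> nat) set"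
  frame_abs :: "(nat \<Rightarrow> nat) \<Rightarrow> 'a \<Rightarrow> real"

definition is_frame :: "nat \<Rightarrow> ('a, 'm) ring_scheme \<Rightarrow> 'a frame \<Rightarrow> bool" where
  "is_frame p A F \<longleftrightarrow>
     range (digits p) \<subseteq> frame_dom F \<and> frame_dom F \<subseteq> Zp p \<and> theta ` frame_dom F \<subseteq> frame_dom F \<and>
     (\<forall>z\<in>frame_dom F. absolute_value A (frame_abs F z) \<and>
        (\<forall>x\<in>carrier A. frame_abs F z x = frame_abs F (theta z) x))"

definition digit_class :: "nat \<Rightarrow> nat \<Rightarrow> (nat \<Rightarrow> nat) set" where
  "digit_class p k =
     (if k = 0 then range (digits p)
      else {z \<in> Zp p. infinite {i. z i = k} \<and> (\<forall>l\<in>{1..<k}. finite {i. z i = l})})"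

definition digital :: "nat \<Rightarrow> ('a, 'm) ring_scheme \<Rightarrow> 'a frame \<Rightarrow> bool" where
  "digital p A F \<longleftrightarrow> (\<exists>v. \<forall>k<p. absolute_value A (v k) \<and>
     (\<forall>z \<in> digit_class p k \<inter> frame_dom F. \<forall>x\<in>carrier A. frame_abs F z x = v k x))"

text \<open>The elements of a quotient ring are cosets \<open>J + f\<close>, so the infimum of \<open>\<bar>f + g\<bar>\<close> over
  \<open>g \<in> J\<close> is the infimum over the coset. Such an infimum need not be an absolute value; where
  the quotient is assumed to be a frame, the quotient ring is in particular an integral domain.\<close>

definition quot_frame :: "'a frame \<Rightarrow> 'a set frame" where
  "quot_frame F = \<lparr>frame_dom = frame_dom F, frame_abs = (\<lambda>z c. INF x\<in>c. frame_abs F z x)\<rparr>"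

abbreviation compl_at :: "('a, 'm) ring_scheme \<Rightarrow> 'a frame \<Rightarrow> (nat \<Rightarrow> nat) \<Rightarrow> (nat \<Rightarrow> 'a) set ring" where
  "compl_at A F z \<equiv> completion A (frame_abs F z)"

definition CF :: "('a, 'm) ring_scheme \<Rightarrow> 'a frame \<Rightarrow> ((nat \<Rightarrow> nat) \<Rightarrow> (nat \<Rightarrow> 'a) set) set" where
  "CF A F = (\<Pi>\<^sub>E z\<in>frame_dom F. carrier (compl_at A F z))"

text \<open>In the definition of rising-continuity the value \<open>f([z]\<^bsub>p^n\<^esub>)\<close> lies in the completion
  at a natural number, whereas the limit is taken in the completion at \<open>z\<close>. An element of the first
  is viewed as an element of the second if both absolute values agree, or if it comes from \<open>A\<close>.\<close>

definition same_elem ::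
  "('a, 'm) ring_scheme \<Rightarrow> ('a \<Rightarrow> real) \<Rightarrow> ('a \<Rightarrow> real) \<Rightarrow> (nat \<Rightarrow> 'a) set \<Rightarrow> (nat \<Rightarrow> 'a) set \<Rightarrow> bool" where
  "same_elem A \<nu> \<nu>' c c' \<longleftrightarrow>
     ((\<forall>x\<in>carrier A. \<nu> x = \<nu>' x) \<and> c = c') \<or>
     (\<exists>x\<in>carrier A. c = compl_emb A \<nu> x \<and> c' = compl_emb A \<nu>' x)"

definition rising_continuous ::
  "nat \<Rightarrow> ('a, 'm) ring_scheme \<Rightarrow> 'a frame \<Rightarrow> ((nat \<Rightarrow> nat) \<Rightarrow> (nat \<Rightarrow> 'a) set) \<Rightarrow> bool" where
  "rising_continuous p A F f \<longleftrightarrow> f \<in> CF A F \<and>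
     (\<forall>z\<in>frame_dom F. \<exists>g.
        (\<forall>n. same_elem A (frame_abs F (digits p (trunc p n z))) (frame_abs F z)
               (f (digits p (trunc p n z))) (g n)) \<and>
        (\<lambda>n. compl_norm (frame_abs F z) (g n \<ominus>\<^bsub>compl_at A F z\<^esub> f z)) \<longlonglongrightarrow> 0)"

definition prod_fun_CF ::
  "('a, 'm) ring_scheme \<Rightarrow> 'a frame \<Rightarrow> nat \<Rightarrow> (nat \<Rightarrow> (nat \<Rightarrow> nat) \<Rightarrow> (nat \<Rightarrow> 'a) set) \<Rightarrow>
     (nat \<Rightarrow> nat) \<Rightarrow> (nat \<Rightarrow> nat) \<Rightarrow> (nat \<Rightarrow> 'a) set" where
  "prod_fun_CF A F d Xf n = (\<lambda>z\<in>frame_dom F.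
     finprod (compl_at A F z) (\<lambda>j. Xf j z [^]\<^bsub>compl_at A F z\<^esub> n j) {1..d})"

section \<open>Fraction field, roots of unity and quasi-integrability\<close>

text \<open>The field \<open>Frac(A)(\<zeta>\<^bsub>p^\<infinity>\<^esub>)\<close> is represented by an arbitrary field type generated by
  the fractions of the image of an embedding \<open>\<iota>\<close> of \<open>A\<close> and by a compatible system \<open>\<zeta> n\<close> of
  primitive \<open>p^n\<close>-th roots of unity.\<close>

definition frac_field :: "('a, 'm) ring_scheme \<Rightarrow> ('a \<Rightarrow> 'l::field) \<Rightarrow> 'l set" where
  "frac_field A \<iota> = {\<iota> x / \<iota> y | x y. x \<in> carrier A \<and> y \<in> carrier A \<and> \<iota> y \<noteq> 0}"

definition cyclotomic_frac ::
  "nat \<Rightarrow> ('a, 'm) ring_scheme \<Rightarrow> ('a \<Rightarrow> 'l::field) \<Rightarrow> (nat \<Rightarrow> 'l) \<Rightarrow> bool" where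
  "cyclotomic_frac p A \<iota> \<zeta> \<longleftrightarrow>
     (CHAR('l) = 0 \<or> coprime CHAR('l) p) \<and>
     \<iota> \<in> ring_hom A ring_of_type_algebra \<and> inj_on \<iota> (carrier A) \<and>
     (\<forall>n m. \<zeta> n ^ m = 1 \<longleftrightarrow> p ^ n dvd m) \<and> (\<forall>n. \<zeta> (Suc n) ^ p = \<zeta> n) \<and>
     generate_field ring_of_type_algebra (frac_field A \<iota> \<union> range \<zeta>) = UNIV"

text \<open>The partial sums lie in \<open>Frac(A)(\<zeta>\<^bsub>p^\<infinity>\<^esub>)\<close> and the limit in the completion of \<open>A\<close>. They
  are compared by any absolute value \<open>w\<close> of \<open>Frac(A)(\<zeta>\<^bsub>p^\<infinity>\<^esub>)\<close> extending that of \<open>A\<close>: the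
  distance of \<open>y\<close> from the point of the completion represented by a Cauchy sequence \<open>s\<close> is
  \<open>lim w(y - s\<^sub>m)\<close>.\<close>

definition is_fourier_transform ::
  "nat \<Rightarrow> ('a, 'm) ring_scheme \<Rightarrow> 'a frame \<Rightarrow> ('a \<Rightarrow> 'l::field) \<Rightarrow> (nat \<Rightarrow> 'l) \<Rightarrow>
     ((nat \<Rightarrow> nat) \<Rightarrow> (nat \<Rightarrow> 'a) set) \<Rightarrow> (rat \<Rightarrow> 'l) \<Rightarrow> bool" where
  "is_fourier_transform p A F \<iota> \<zeta> Xf Xh \<longleftrightarrow>
     (\<forall>z\<in>frame_dom F. \<forall>w. absolute_value ring_of_type_algebra w \<and>
          (\<forall>x\<in>carrier A. w (\<iota> x) = frame_abs F z x) \<longrightarrow>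
        (\<forall>s\<in>Xf z. (\<lambda>N. lim (\<lambda>m.
           w ((\<Sum>t | t \<in> hatZ p \<and> tabs p t \<le> p ^ N. Xh t * pairing p \<zeta> t z) - \<iota> (s m))))
             \<longlonglongrightarrow> 0))"

definition quasi_integrable ::
  "nat \<Rightarrow> ('a, 'm) ring_scheme \<Rightarrow> 'a frame \<Rightarrow> ('a \<Rightarrow> 'l::field) \<Rightarrow> (nat \<Rightarrow> 'l) \<Rightarrow>
     ((nat \<Rightarrow> nat) \<Rightarrow> (nat \<Rightarrow> 'a) set) \<Rightarrow> bool" where
  "quasi_integrable p A F \<iota> \<zeta> Xf \<longleftrightarrow>
     Xf \<in> CF A F \<and> (\<exists>Xh. is_fourier_transform p A F \<iota> \<zeta> Xf Xh)"

section \<open>Global fields and the rings R and calR\<close>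

text \<open>In characteristic 0 a global field is finite over \<open>\<rat>\<close>; in positive characteristic it is
  finite over \<open>F\<^sub>l(T)\<close> with \<open>T\<close> transcendental. Its ring of integers is the integral closure of
  \<open>\<int>\<close> resp. \<open>F\<^sub>l[T]\<close>, which in the second case depends on the choice of \<open>T\<close>.\<close>

definition global_base :: "'k::field set \<Rightarrow> bool" where
  "global_base G \<longleftrightarrow>
     (if CHAR('k) = 0 then G = {}
      else \<exists>T. G = {T} \<and>
        ring.transcendental ring_of_type_algebra (generate_field ring_of_type_algebra {}) T) \<and>
     ring.finite_dimension ring_of_type_algebra (generate_field ring_of_type_algebra G) UNIV"

definition global_field :: "'k::field itself \<Rightarrow> bool" where
  "global_field _ \<longleftrightarrow> (\<exists>G :: 'k set. global_base G)"

definition integral_closure :: "'k::field set \<Rightarrow> 'k set" where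
  "integral_closure S =
     {x. \<exists>f. lead_coeff f = 1 \<and> (\<forall>i. poly.coeff f i \<in> S) \<and> poly f x = 0}"

definition ring_of_integers :: "'k::field set \<Rightarrow> bool" where
  "ring_of_integers OK \<longleftrightarrow>
     (\<exists>G. global_base G \<and> OK = integral_closure (generate_ring ring_of_type_algebra G))"

definition mpolys :: "'c::comm_ring_1 set \<Rightarrow> 'v set \<Rightarrow> (('v \<Rightarrow>\<^sub>0 nat) \<Rightarrow>\<^sub>0 'c) set" where
  "mpolys S V = {f. (\<forall>m. Poly_Mapping.lookup f m \<in> S) \<and>
     (\<forall>m\<in>Poly_Mapping.keys f. Poly_Mapping.keys m \<subseteq> V)}"

definition mpoly_ring :: "'c::comm_ring_1 set \<Rightarrow> 'v set \<Rightarrow> (('v \<Rightarrow>\<^sub>0 nat) \<Rightarrow>\<^sub>0 'c) ring" where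
  "mpoly_ring S V = ring_of_type_algebra\<lparr>carrier := mpolys S V\<rparr>"

datatype indet = Ind_a nat nat | Ind_b nat nat | Ind_x nat

type_synonym 'k ipoly = "(indet \<Rightarrow>\<^sub>0 nat) \<Rightarrow>\<^sub>0 'k"

definition ivar :: "indet \<Rightarrow> 'k::comm_ring_1 ipoly" where
  "ivar i = Poly_Mapping.single (Poly_Mapping.single i 1) 1"

definition ab_indets :: "nat \<Rightarrow> nat \<Rightarrow> indet set" where
  "ab_indets d p = {Ind_a j k | j k. j \<in> {1..d} \<and> k < p} \<union> {Ind_b j k | j k. j \<in> {1..d} \<and> k < p}"

definition R_ring :: "'k::comm_ring_1 set \<Rightarrow> nat \<Rightarrow> nat \<Rightarrow> 'k ipoly ring" where
  "R_ring OK d p = mpoly_ring OK (ab_indets d p)"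

definition Rx_ring :: "'k::comm_ring_1 set \<Rightarrow> nat \<Rightarrow> nat \<Rightarrow> 'k ipoly ring" where
  "Rx_ring OK d p = mpoly_ring OK (ab_indets d p \<union> Ind_x ` {1..d})"

definition loc_ideal :: "'k::comm_ring_1 set \<Rightarrow> nat \<Rightarrow> nat \<Rightarrow> 'k ipoly set" where
  "loc_ideal OK d p =
     Idl\<^bsub>Rx_ring OK d p\<^esub> ((\<lambda>j. (1 - ivar (Ind_a j 0)) * ivar (Ind_x j) - 1) ` {1..d})"

definition calR :: "'k::comm_ring_1 set \<Rightarrow> nat \<Rightarrow> nat \<Rightarrow> 'k ipoly set ring" where
  "calR OK d p = Rx_ring OK d p Quot loc_ideal OK d p"

definition to_calR :: "'k::comm_ring_1 set \<Rightarrow> nat \<Rightarrow> nat \<Rightarrow> 'k ipoly \<Rightarrow> 'k ipoly set" where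
  "to_calR OK d p f = loc_ideal OK d p +>\<^bsub>Rx_ring OK d p\<^esub> f"

definition ext_ideal :: "'k::comm_ring_1 set \<Rightarrow> nat \<Rightarrow> nat \<Rightarrow> 'k ipoly set \<Rightarrow> 'k ipoly set set" where
  "ext_ideal OK d p I = Idl\<^bsub>calR OK d p\<^esub> (to_calR OK d p ` I)"

definition calQ :: "'k::comm_ring_1 set \<Rightarrow> nat \<Rightarrow> nat \<Rightarrow> 'k ipoly set \<Rightarrow> 'k ipoly set set ring" where
  "calQ OK d p I = calR OK d p Quot ext_ideal OK d p I"

definition to_calQ ::
  "'k::comm_ring_1 set \<Rightarrow> nat \<Rightarrow> nat \<Rightarrow> 'k ipoly set \<Rightarrow> 'k ipoly \<Rightarrow> 'k ipoly set set" where
  "to_calQ OK d p I f = ext_ideal OK d p I +>\<^bsub>calR OK d p\<^esub> to_calR OK d p f"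

text \<open>Absolute values being multiplicative, \<open>\<bar>a/b\<bar>\<close> is \<open>\<bar>a\<bar> / \<bar>b\<bar>\<close>.\<close>

definition decay_condition :: "'k::comm_ring_1 set \<Rightarrow> nat \<Rightarrow> nat \<Rightarrow> 'k ipoly set frame \<Rightarrow> bool" where
  "decay_condition OK d p F \<longleftrightarrow>
     (\<forall>z\<in>frame_dom F. \<forall>j\<in>{1..d}.
        let a = (\<lambda>k. frame_abs F z (to_calR OK d p (ivar (Ind_a j k)))) in
        ereal (a 0) * limsup (\<lambda>n. ereal (\<Prod>k=1..<p.
          (a k / a 0) powr (real (digit_count p k (trunc p n z)) / real n))) < 1)"

definition solves_equation ::
  "'k::comm_ring_1 set \<Rightarrow> nat \<Rightarrow> nat \<Rightarrow> 'k ipoly set \<Rightarrow> 'k ipoly set set frame \<Rightarrow> nat \<Rightarrow>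
     ((nat \<Rightarrow> nat) \<Rightarrow> (nat \<Rightarrow> 'k ipoly set set) set) \<Rightarrow> bool" where
  "solves_equation OK d p I F j Xf \<longleftrightarrow>
     (\<forall>z\<in>frame_dom F.
        let A = calQ OK d p I; C = compl_at A F z;
            e = (\<lambda>f. compl_emb A (frame_abs F z) (to_calQ OK d p I f)) in
        Xf z = e (ivar (Ind_a j (z 0))) \<otimes>\<^bsub>C\<^esub> Xf (theta z) \<oplus>\<^bsub>C\<^esub> e (ivar (Ind_b j (z 0))))"

section \<open>The formulas for the Fourier transforms\<close>

definition one_zero :: "rat \<Rightarrow> 'l::field" where
  "one_zero t = (if t = 0 then 1 else 0)"

definition digit_ft :: "nat \<Rightarrow> (nat \<Rightarrow> 'l::field) \<Rightarrow> (nat \<Rightarrow> 'l) \<Rightarrow> rat \<Rightarrow> 'l" where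
  "digit_ft p \<zeta> c t = 1 / of_nat p * (\<Sum>k<p. c k * cexp p \<zeta> (- of_nat k * t))"

definition hat_A :: "nat \<Rightarrow> (rat \<Rightarrow> 'l::field) \<Rightarrow> rat \<Rightarrow> 'l" where
  "hat_A p \<alpha> t = (\<Prod>n<lvl p t. \<alpha> (hmul (p ^ n) t))"

text \<open>\<open>\<gamma>(t\<bar>t\<bar>\<^sub>p/p) \<cdot> hat_A(t)\<close> for \<open>t \<noteq> 0\<close>, where \<open>\<gamma> = \<beta>/\<alpha>\<close>. The last factor of \<open>hat_A(t)\<close> is
  \<open>\<alpha>(t\<bar>t\<bar>\<^sub>p/p)\<close>; if it vanishes, it is cancelled against the denominator of \<open>\<gamma>\<close>.\<close>

definition gamma_hat_A :: "nat \<Rightarrow> (rat \<Rightarrow> 'l::field) \<Rightarrow> (rat \<Rightarrow> 'l) \<Rightarrow> rat \<Rightarrow> 'l" where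
  "gamma_hat_A p \<alpha> \<beta> t =
     (let s = frac (t * of_nat (tabs p t) / of_nat p) in
      if \<alpha> s = 0 then \<beta> s * (\<Prod>n<lvl p t - 1. \<alpha> (hmul (p ^ n) t))
      else \<beta> s / \<alpha> s * hat_A p \<alpha> t)"

text \<open>The common shape of the transforms of the \<open>X\<^sub>j\<close> and of the functions \<open>g\<^sub>n\<close>; recall
  \<open>v\<^sub>p(t) = - lvl p t\<close>.\<close>

definition affine_ft :: "nat \<Rightarrow> (rat \<Rightarrow> 'l::field) \<Rightarrow> (rat \<Rightarrow> 'l) \<Rightarrow> rat \<Rightarrow> 'l" where
  "affine_ft p \<alpha> \<beta> t =
     (if \<alpha> 0 = 1 then
        (if t = 0 then 0
         else \<beta> 0 * (- of_nat (lvl p t)) * hat_A p \<alpha> t + gamma_hat_A p \<alpha> \<beta> t)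
      else
        (if t = 0 then \<beta> 0 / (1 - \<alpha> 0)
         else \<beta> 0 / (1 - \<alpha> 0) * hat_A p \<alpha> t + gamma_hat_A p \<alpha> \<beta> t))"

text \<open>Multi-indices in \<open>\<nat>\<^sup>d\<close> are functions vanishing outside \<open>{1..d}\<close>; the pointwise order on
  functions gives \<open>\<le>\<close> and \<open><\<close>.\<close>

definition multi_indices :: "nat \<Rightarrow> (nat \<Rightarrow> nat) set" where
  "multi_indices d = {n. \<forall>j. j \<notin> {1..d} \<longrightarrow> n j = 0}"

definition unit_index :: "nat \<Rightarrow> nat \<Rightarrow> nat" where
  "unit_index j = (\<lambda>i. if i = j then 1 else 0)"

definition rcoef ::
  "nat \<Rightarrow> (nat \<Rightarrow> nat \<Rightarrow> 'l::field) \<Rightarrow> (nat \<Rightarrow> nat \<Rightarrow> 'l) \<Rightarrow> (nat \<Rightarrow> nat) \<Rightarrow> (nat \<Rightarrow> nat) \<Rightarrow> nat \<Rightarrow> 'l" where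
  "rcoef d a b m n k =
     (\<Prod>j=1..d. of_nat (n j choose m j) * a j k ^ m j * b j k ^ (n j - m j))"

definition ccoef ::
  "nat \<Rightarrow> (nat \<Rightarrow> nat \<Rightarrow> 'l::field) \<Rightarrow> (nat \<Rightarrow> nat \<Rightarrow> 'l) \<Rightarrow> ((nat \<Rightarrow> nat) \<Rightarrow> rat \<Rightarrow> 'l) \<Rightarrow>
     (nat \<Rightarrow> nat) \<Rightarrow> nat \<Rightarrow> 'l" where
  "ccoef d a b Xh n k = - (\<Sum>m | m < n. rcoef d a b m n k * Xh m 0)"

definition alpha_mn ::
  "nat \<Rightarrow> nat \<Rightarrow> (nat \<Rightarrow> 'l::field) \<Rightarrow> (nat \<Rightarrow> nat \<Rightarrow> 'l) \<Rightarrow> (nat \<Rightarrow> nat \<Rightarrow> 'l) \<Rightarrow>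
     (nat \<Rightarrow> nat) \<Rightarrow> (nat \<Rightarrow> nat) \<Rightarrow> rat \<Rightarrow> 'l" where
  "alpha_mn p d \<zeta> a b m n = digit_ft p \<zeta> (rcoef d a b m n)"

definition beta_n ::
  "nat \<Rightarrow> nat \<Rightarrow> (nat \<Rightarrow> 'l::field) \<Rightarrow> (nat \<Rightarrow> nat \<Rightarrow> 'l) \<Rightarrow> (nat \<Rightarrow> nat \<Rightarrow> 'l) \<Rightarrow>
     ((nat \<Rightarrow> nat) \<Rightarrow> rat \<Rightarrow> 'l) \<Rightarrow> (nat \<Rightarrow> nat) \<Rightarrow> rat \<Rightarrow> 'l" where
  "beta_n p d \<zeta> a b Xh n = digit_ft p \<zeta> (ccoef d a b Xh n)"

definition fhat ::
  "nat \<Rightarrow> nat \<Rightarrow> (nat \<Rightarrow> 'l::field) \<Rightarrow> (nat \<Rightarrow> nat \<Rightarrow> 'l) \<Rightarrow> (nat \<Rightarrow> nat \<Rightarrow> 'l) \<Rightarrow>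
     ((nat \<Rightarrow> nat) \<Rightarrow> rat \<Rightarrow> 'l) \<Rightarrow> (nat \<Rightarrow> nat) \<Rightarrow> rat \<Rightarrow> 'l" where
  "fhat p d \<zeta> a b Xh n t =
     (\<Sum>m | m < n. \<Sum>i<lvl p t - 1.
        (\<Prod>l<i. alpha_mn p d \<zeta> a b n n (hmul (p ^ l) t)) *
        alpha_mn p d \<zeta> a b m n (hmul (p ^ i) t) * Xh m (hmul (p ^ (i + 1)) t))"

definition ghat ::
  "nat \<Rightarrow> nat \<Rightarrow> (nat \<Rightarrow> 'l::field) \<Rightarrow> (nat \<Rightarrow> nat \<Rightarrow> 'l) \<Rightarrow> (nat \<Rightarrow> nat \<Rightarrow> 'l) \<Rightarrow>
     ((nat \<Rightarrow> nat) \<Rightarrow> rat \<Rightarrow> 'l) \<Rightarrow> (nat \<Rightarrow> nat) \<Rightarrow> rat \<Rightarrow> 'l" where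
  "ghat p d \<zeta> a b Xh n = affine_ft p (alpha_mn p d \<zeta> a b n n) (beta_n p d \<zeta> a b Xh n)"

section \<open>Distributions\<close>

definition loc_const :: "nat \<Rightarrow> ((nat \<Rightarrow> nat) \<Rightarrow> 'l) \<Rightarrow> bool" where
  "loc_const p \<phi> \<longleftrightarrow>
     (\<forall>z\<in>Zp p. \<exists>N. \<forall>w\<in>Zp p. trunc p N w = trunc p N z \<longrightarrow> \<phi> w = \<phi> z)"

definition schwartz :: "nat \<Rightarrow> 'l set \<Rightarrow> ((nat \<Rightarrow> nat) \<Rightarrow> 'l) set" where
  "schwartz p KK = {\<phi> \<in> Zp p \<rightarrow>\<^sub>E KK. loc_const p \<phi>}"

definition distributions :: "nat \<Rightarrow> 'l::field set \<Rightarrow> (((nat \<Rightarrow> nat) \<Rightarrow> 'l) \<Rightarrow> 'l) set" where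
  "distributions p KK = {\<mu> \<in> schwartz p KK \<rightarrow>\<^sub>E KK.
     (\<forall>\<phi>\<in>schwartz p KK. \<forall>\<psi>\<in>schwartz p KK. \<mu> (\<lambda>z\<in>Zp p. \<phi> z + \<psi> z) = \<mu> \<phi> + \<mu> \<psi>) \<and>
     (\<forall>c\<in>KK. \<forall>\<phi>\<in>schwartz p KK. \<mu> (\<lambda>z\<in>Zp p. c * \<phi> z) = c * \<mu> \<phi>)}"

text \<open>The characters take values in \<open>\<bbbK>(\<zeta>\<^bsub>p^\<infinity>\<^esub>)\<close> rather than in \<open>\<bbbK>\<close>, so a distribution is
  integrated against them by extension of scalars: a function that is constant mod \<open>p^N\<close> is a
  combination of indicator functions of residue classes mod \<open>p^N\<close>.\<close>

definition integral_dist ::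
  "nat \<Rightarrow> (((nat \<Rightarrow> nat) \<Rightarrow> 'l::field) \<Rightarrow> 'l) \<Rightarrow> ((nat \<Rightarrow> nat) \<Rightarrow> 'l) \<Rightarrow> 'l" where
  "integral_dist p \<mu> \<phi> =
     (let N = (LEAST N. \<forall>z\<in>Zp p. \<forall>w\<in>Zp p. trunc p N w = trunc p N z \<longrightarrow> \<phi> w = \<phi> z) in
      \<Sum>k<p ^ N. \<phi> (digits p k) * \<mu> (\<lambda>z\<in>Zp p. if trunc p N z = k then 1 else 0))"

definition fourier_stieltjes ::
  "nat \<Rightarrow> (nat \<Rightarrow> 'l::field) \<Rightarrow> (((nat \<Rightarrow> nat) \<Rightarrow> 'l) \<Rightarrow> 'l) \<Rightarrow> rat \<Rightarrow> 'l" where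
  "fourier_stieltjes p \<zeta> \<mu> =
     (\<lambda>t\<in>hatZ p. integral_dist p \<mu> (\<lambda>z. inverse (pairing p \<zeta> t z)))"

definition dist_of ::
  "nat \<Rightarrow> 'l::field set \<Rightarrow> (nat \<Rightarrow> 'l) \<Rightarrow> (rat \<Rightarrow> 'l) \<Rightarrow> (((nat \<Rightarrow> nat) \<Rightarrow> 'l) \<Rightarrow> 'l)" where
  "dist_of p KK \<zeta> h =
     (THE \<mu>. \<mu> \<in> distributions p KK \<and> (\<forall>t\<in>hatZ p. fourier_stieltjes p \<zeta> \<mu> t = h t))"

section \<open>The pointwise product algebra and the convolution algebra\<close>

text \<open>Polynomials in \<open>d\<close> indeterminates are read as polynomials in the distributions
  \<open>X\<^sub>j dz\<close>, resp. in the functions \<open>X\<^sub>j\<close>-hat under convolution, the monomial with exponent \<open>n\<close>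
  standing for the distribution \<open>X\<^sub>n dz\<close>, resp. for the function \<open>X\<^sub>n\<close>-hat.\<close>

definition eval_dist ::
  "nat \<Rightarrow> 'l::field set \<Rightarrow> ((nat \<Rightarrow> nat) \<Rightarrow> (((nat \<Rightarrow> nat) \<Rightarrow> 'l) \<Rightarrow> 'l)) \<Rightarrow>
     ((nat \<Rightarrow>\<^sub>0 nat) \<Rightarrow>\<^sub>0 'l) \<Rightarrow> (((nat \<Rightarrow> nat) \<Rightarrow> 'l) \<Rightarrow> 'l)" where
  "eval_dist p KK \<mu> f = (\<lambda>\<phi>\<in>schwartz p KK.
     \<Sum>m\<in>Poly_Mapping.keys f. Poly_Mapping.lookup f m * \<mu> (Poly_Mapping.lookup m) \<phi>)"

definition eval_conv ::
  "nat \<Rightarrow> ((nat \<Rightarrow> nat) \<Rightarrow> rat \<Rightarrow> 'l::field) \<Rightarrow> ((nat \<Rightarrow>\<^sub>0 nat) \<Rightarrow>\<^sub>0 'l) \<Rightarrow> (rat \<Rightarrow> 'l)" where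
  "eval_conv p Xh f = (\<lambda>t\<in>hatZ p.
     \<Sum>m\<in>Poly_Mapping.keys f. Poly_Mapping.lookup f m * Xh (Poly_Mapping.lookup m) t)"

text \<open>The algebra of values of \<open>ev\<close>, with the product in which monomials multiply by adding
  exponents. On the range of \<open>ev\<close> this product is well defined exactly if the kernel of \<open>ev\<close> is an
  ideal, and then \<open>value_algebra P ev\<close> is isomorphic to that range. In general (the kernel
  need not be an ideal for the transforms considered here when some \<open>\<alpha>\<^sub>n(0) = 1\<close>) only the polynomials all of whose multiples
  have value 0 can be divided out.\<close>

definition vanishing_ideal :: "('r, 'm) ring_scheme \<Rightarrow> ('r \<Rightarrow> 'v) \<Rightarrow> 'r set" where
  "vanishing_ideal P ev = {f \<in> carrier P. \<forall>g\<in>carrier P. ev (g \<otimes>\<^bsub>P\<^esub> f) = ev \<zero>\<^bsub>P\<^esub>}"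

definition value_algebra :: "('r, 'm) ring_scheme \<Rightarrow> ('r \<Rightarrow> 'v) \<Rightarrow> 'r set ring" where
  "value_algebra P ev = P Quot vanishing_ideal P ev"

text \<open>The map on value algebras induced by a map \<open>\<Phi>\<close> on values.\<close>

definition induced_map ::
  "('r, 'm) ring_scheme \<Rightarrow> ('r \<Rightarrow> 'v) \<Rightarrow> ('r \<Rightarrow> 'u) \<Rightarrow> ('v \<Rightarrow> 'u) \<Rightarrow> 'r set \<Rightarrow> 'r set" where
  "induced_map P ev ev' \<Phi> c =
     {g \<in> carrier P. \<exists>f\<in>c. \<forall>h\<in>carrier P. ev' (h \<otimes>\<^bsub>P\<^esub> g) = \<Phi> (ev (h \<otimes>\<^bsub>P\<^esub> f))}"

end

(*
  Write A_N(z) for the product of the a_{z_i} and B_N(z) for the sum of the A_i(z) b_{z_i}, over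
  i < N. Iterating the functional equation gives X(z) = A_N(z) X(theta^N z) + B_N(z), so X(z) is the
  limit of the B_N(z); at natural numbers the equation itself determines X(z), because 1 - a_0 is
  invertible. The formula for the transform of X_n says that it satisfies
    h_n(t) = sum over m <= n of alpha_{m,n}(t) h_m(pt),
  the Fourier side of X_n(z) = sum of r_{m,n,z_0} X_m(theta z), up to a multiple e_n of A^_n(t)
  that is forced at t = 0 when alpha_n(0) = 1. Hence the N-th partial sum S_N of the Fourier series
  equals the sum over m <= n of the coefficients of (A_N X + B_N)^n at X^m times h_m(0), plus the
  sum over i < N of the coefficients of (A_N X + B_i)^n times e_m. All terms with m > 0 contain a
  power of A_N, which decays exponentially, and the term with m = 0 is B_N^n. The same closed
  formula shows that the values of S_N lie in the fraction field, and p^-N S_N(k) is the mass that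
  the distribution with transform h_n gives to k + p^N Z_p.
*)

theory Submission
  imports Defs
begin

section \<open>Digits and truncations\<close>

text \<open>The closed formula for S_N rests on one fact: the coefficient matrices of (a X + b)^n
  multiply when affine maps are composed, so N digits collapse to a single affine map in each
  variable. Rising-continuity makes two absolute values meet, that of z and that of its truncations,
  which are natural numbers. Only elements of the ring itself can be carried from one completion to
  the other, and the values at natural numbers are such elements since the localization contains
  1/(1 - a_0). The decay condition is stated before I is divided out, where the a_{j,k} are nonzero
  and quotients of their absolute values make sense. It descends because the absolute value of a
  coset is at most that of each representative. For the algebras, a distribution is determined by
  its transform. Hence evaluating polynomials in distributions and in transforms has the same
  fibres, and both value algebras are one and the same quotient.\<close>

lemma sum_lessThan_mult:
  fixes f :: "nat \<Rightarrow> 'a::comm_monoid_add"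
  shows "(\<Sum>k<m * n. f k) = (\<Sum>k<m. \<Sum>j<n. f (k + m * j))"
proof (cases "m = 0")
  case False
  have "(\<Sum>k<m. \<Sum>j<n. f (k + m * j)) = (\<Sum>(k, j)\<in>{..<m} \<times> {..<n}. f (k + m * j))"
    by (simp add: sum.cartesian_product)
  also have "\<dots> = (\<Sum>k<m * n. f k)"
  proof (rule sum.reindex_bij_witness[where i = "\<lambda>k. (k mod m, k div m)" and j = "\<lambda>(k, j). k + m * j"])
    fix x assume "x \<in> {..<m} \<times> {..<n}"
    then obtain k j where x: "x = (k, j)" "k < m" "j < n" by auto
    have "k + m * j < m + m * j" using x by simp
    also have "\<dots> = m * Suc j" by simp
    also have "\<dots> \<le> m * n" using x by (intro mult_le_mono) auto
    finally show "(case x of (k, j) \<Rightarrow> k + m * j) \<in> {..<m * n}" using x by simp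
  qed (use False in \<open>auto simp: less_mult_imp_div_less mult.commute\<close>)
  finally show ?thesis by simp
qed simp

lemma theta_Zp: "z \<in> Zp p \<Longrightarrow> theta z \<in> Zp p"
  by (simp add: Zp_def theta_def)

lemma digits_Zp: "0 < p \<Longrightarrow> digits p m \<in> Zp p"
  by (simp add: Zp_def digits_def)

lemma theta_digits: "theta (digits p m) = digits p (m div p)"
  by (simp add: theta_def digits_def fun_eq_iff div_mult2_eq)

lemma digits_0: "digits p 0 = (\<lambda>_. 0)"
  by (simp add: digits_def)

lemma trunc_0 [simp]: "trunc p 0 z = 0"
  by (simp add: trunc_def)

lemma trunc_Suc: "trunc p (Suc n) z = trunc p n z + z n * p ^ n"
  by (simp add: trunc_def)

lemma trunc_Suc': "trunc p (Suc n) z = z 0 + p * trunc p n (theta z)"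
  unfolding trunc_def theta_def sum.lessThan_Suc_shift by (simp add: sum_distrib_left mult_ac)

lemma trunc_less: "z \<in> Zp p \<Longrightarrow> trunc p n z < p ^ n"
proof (induction n)
  case (Suc n)
  then have "z n \<le> p - 1" "0 < p" by (auto simp: Zp_def dest: spec[of _ n])
  then have "trunc p n z + z n * p ^ n < p ^ n + (p - 1) * p ^ n"
    using Suc by (intro add_less_le_mono mult_le_mono1) auto
  also have "\<dots> = p * p ^ n"
    using \<open>0 < p\<close> by (simp add: algebra_simps)
  finally show ?case by (simp add: trunc_Suc)
qed simp

lemma trunc_mod:
  assumes "z \<in> Zp p" "l \<le> n"
  shows "trunc p n z mod p ^ l = trunc p l z"
  using assms(2)
proof (induction n rule: dec_induct)
  case base
  then show ?case using trunc_less[OF assms(1)] by simp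
next
  case (step n)
  then obtain c where "p ^ n = p ^ l * c" by (metis le_imp_power_dvd dvdE)
  then have "z n * p ^ n = p ^ l * (z n * c)" by simp
  then have "(trunc p n z + z n * p ^ n) mod p ^ l = trunc p n z mod p ^ l"
    by (metis mod_mult_self2)
  then show ?case using step by (simp add: trunc_Suc)
qed

lemma trunc_digits: "trunc p n (digits p m) = m mod p ^ n"
proof (induction n arbitrary: m)
  case (Suc n)
  have "trunc p (Suc n) (digits p m) = m mod p + p * (m div p mod p ^ n)"
    using Suc by (simp add: trunc_Suc' theta_digits) (simp add: digits_def)
  also have "\<dots> = m mod p ^ Suc n"
    by (simp add: mod_mult2_eq add.commute)
  finally show ?case .
qed simp

lemma digits_trunc:
  assumes "z \<in> Zp p"
  shows "digits p (trunc p n z) i = (if i < n then z i else 0)"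
  using assms
proof (induction n arbitrary: z i)
  case (Suc n)
  have p: "z 0 < p" using Suc.prems by (simp add: Zp_def)
  show ?case
  proof (cases i)
    case 0
    then show ?thesis using p by (simp add: digits_def trunc_Suc')
  next
    case (Suc i')
    have "digits p (trunc p (Suc n) z) i = digits p (trunc p n (theta z)) i'"
      using p Suc by (simp add: digits_def trunc_Suc' div_mult2_eq)
    then show ?thesis using Suc.IH[OF theta_Zp[OF Suc.prems]] Suc by (simp add: theta_def)
  qed
qed (simp add: digits_def)

lemma trunc_eq_iff:
  assumes "z \<in> Zp p" "w \<in> Zp p"
  shows "trunc p n z = trunc p n w \<longleftrightarrow> (\<forall>i<n. z i = w i)"
proof
  assume "trunc p n z = trunc p n w"
  then show "\<forall>i<n. z i = w i" using digits_trunc[OF assms(1)] digits_trunc[OF assms(2)] by metis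
qed (simp add: trunc_def)

section \<open>Fourier analysis on finite levels\<close>

lemma lvl_least: "t * of_nat p ^ n \<in> \<int> \<Longrightarrow> lvl p t \<le> n"
  unfolding lvl_def by (rule Least_le)

lemma lvl_Ints: "t * of_nat p ^ n \<in> \<int> \<Longrightarrow> t * of_nat p ^ lvl p t \<in> \<int>"
  unfolding lvl_def by (rule LeastI)

lemma lvl_0 [simp]: "lvl p 0 = 0"
  using lvl_least[of 0 p 0] by simp

definition ball_hatZ :: "nat \<Rightarrow> nat \<Rightarrow> rat set" where
  "ball_hatZ p N = {t. t \<in> hatZ p \<and> tabs p t \<le> p ^ N}"

text \<open>The partial sum whose convergence \<open>is_fourier_transform\<close> demands.\<close>

definition psum :: "nat \<Rightarrow> (nat \<Rightarrow> 'l::field) \<Rightarrow> (rat \<Rightarrow> 'l) \<Rightarrow> nat \<Rightarrow> (nat \<Rightarrow> nat) \<Rightarrow> 'l" where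
  "psum p \<zeta> h N z = (\<Sum>t\<in>ball_hatZ p N. h t * pairing p \<zeta> t z)"

lemma ball_hatZ_eq:
  assumes "2 \<le> p"
  shows "ball_hatZ p N = (\<lambda>k. of_nat k / of_nat p ^ N) ` {..<p ^ N}"
proof (intro equalityI subsetI)
  fix t assume "t \<in> ball_hatZ p N"
  then have t: "0 \<le> t" "t < 1" and n: "\<exists>n. t * of_nat p ^ n \<in> \<int>" and b: "tabs p t \<le> p ^ N"
    by (auto simp: ball_hatZ_def hatZ_def)
  have "lvl p t \<le> N"
    using b assms by (cases "t = 0") (auto simp: tabs_def)
  then have "t * of_nat p ^ N = t * of_nat p ^ lvl p t * of_nat p ^ (N - lvl p t)"
    by (simp flip: power_add)
  also have "\<dots> \<in> \<int>"
    using n lvl_Ints[of t p] Ints_of_nat[of p] by (blast intro: Ints_mult Ints_power)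
  finally obtain i where i: "t * of_nat p ^ N = of_int i" by (auto elim: Ints_cases)
  have pos: "(0::rat) < of_nat p ^ N" using assms by simp
  have "0 \<le> (of_int i :: rat)" using i t pos by (metis mult_nonneg_nonneg less_imp_le)
  then have "0 \<le> i" by simp
  moreover have "(of_int i :: rat) < of_nat p ^ N"
    using i t pos by (metis mult.commute mult.right_neutral mult_less_cancel_left_pos)
  then have "i < int (p ^ N)" by (metis of_int_less_iff of_int_of_nat_eq of_nat_power)
  ultimately have "nat i < p ^ N" "t = of_nat (nat i) / of_nat p ^ N"
    using i pos by (auto simp: field_simps nat_less_iff)
  then show "t \<in> (\<lambda>k. of_nat k / of_nat p ^ N) ` {..<p ^ N}" by blast
next
  fix t :: rat assume "t \<in> (\<lambda>k. of_nat k / of_nat p ^ N) ` {..<p ^ N}"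
  then obtain k where k: "k < p ^ N" "t = of_nat k / of_nat p ^ N" by auto
  have "(of_nat k :: rat) < of_nat (p ^ N)" using k(1) by (simp only: of_nat_less_iff)
  then have t: "0 \<le> t" "t < 1" unfolding k(2) by (simp_all add: divide_less_eq)
  have I: "t * of_nat p ^ N \<in> \<int>" using k assms by simp
  have "tabs p t \<le> p ^ N" using lvl_least[OF I] assms by (simp add: tabs_def power_increasing)
  then show "t \<in> ball_hatZ p N" using t I by (auto simp: ball_hatZ_def hatZ_def)
qed

lemma hatZ_in_ball:
  assumes "2 \<le> p" "t \<in> hatZ p" "lvl p t \<le> N"
  shows "t \<in> ball_hatZ p N"
  using assms by (auto simp: ball_hatZ_def tabs_def power_increasing)

lemma inj_on_ball:
  assumes "2 \<le> p"
  shows "inj_on (\<lambda>k. of_nat k / of_nat p ^ N :: rat) A"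
  using assms by (intro inj_onI) (simp add: field_simps)

lemma hmul_frac_power:
  assumes "2 \<le> p"
  shows "hmul p (of_nat k / of_nat p ^ Suc N) = of_nat (k mod p ^ N) / of_nat p ^ N"
proof -
  have "of_nat p * (of_nat k / of_nat p ^ Suc N) = (of_nat k / of_nat (p ^ N) :: rat)"
    using assms by simp
  also have "of_nat k / of_nat (p ^ N) = (of_nat (k div p ^ N) + of_nat (k mod p ^ N) / of_nat (p ^ N) :: rat)"
    using assms by (simp add: field_simps flip: of_nat_mult of_nat_add of_nat_power)
  finally have e: "hmul p (of_nat k / of_nat p ^ Suc N)
      = frac (of_nat (k mod p ^ N) / of_nat (p ^ N) + of_int (int (k div p ^ N)) :: rat)"
    by (simp add: hmul_def add.commute)
  have "(of_nat (k mod p ^ N) :: rat) < of_nat (p ^ N)"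
    using assms by (simp only: of_nat_less_iff) simp
  then have "frac (of_nat (k mod p ^ N) / of_nat (p ^ N) :: rat) = of_nat (k mod p ^ N) / of_nat (p ^ N)"
    using assms by (subst frac_eq) (auto simp: field_simps)
  then show ?thesis unfolding e by (simp add: frac_def)
qed

text \<open>The roots of unity stay abstract; \<open>p_nonzero\<close> is the form in which the
  coprimality of \<open>p\<close> and the characteristic enters.\<close>

locale unity_roots =
  fixes p :: nat and \<zeta> :: "nat \<Rightarrow> 'l::field"
  assumes p_ge_2: "2 \<le> p"
    and zeta_eq_1_iff: "\<And>n m. \<zeta> n ^ m = 1 \<longleftrightarrow> p ^ n dvd m"
    and zeta_Suc: "\<And>n. \<zeta> (Suc n) ^ p = \<zeta> n"
    and p_nonzero: "of_nat p \<noteq> (0::'l)"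
begin

lemma p_pos: "0 < p"
  using p_ge_2 by simp

lemma zeta_nonzero: "\<zeta> n \<noteq> 0"
proof
  assume "\<zeta> n = 0"
  moreover have "\<zeta> n ^ (p ^ n) = 1" by (simp add: zeta_eq_1_iff)
  ultimately show False using p_pos by (simp add: power_0_left)
qed

lemma zeta_add: "\<zeta> (n + k) ^ (p ^ k) = \<zeta> n"
proof (induction k)
  case (Suc k)
  have "\<zeta> (n + Suc k) ^ (p ^ Suc k) = (\<zeta> (Suc (n + k)) ^ p) ^ (p ^ k)"
    by (simp add: power_mult)
  then show ?case using Suc by (simp add: zeta_Suc)
qed simp

text \<open>Integer exponents are needed because orthogonality multiplies one character by the
  inverse of another.\<close>

lemma zeta_powi_eq_1_iff: "\<zeta> n powi e = 1 \<longleftrightarrow> int (p ^ n) dvd e"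
proof (cases "0 \<le> e")
  case True
  then obtain m where "e = int m" using nonneg_int_cases by blast
  then show ?thesis using zeta_eq_1_iff[of n m] by (metis int_dvd_int_iff power_int_of_nat)
next
  case False
  then obtain m where m: "e = - int m" by (metis linear nonpos_int_cases)
  have "\<zeta> n powi e = inverse (\<zeta> n ^ m)" by (simp add: m power_int_minus)
  then have "\<zeta> n powi e = 1 \<longleftrightarrow> \<zeta> n ^ m = 1" by (metis inverse_1 inverse_inverse_eq)
  then show ?thesis using zeta_eq_1_iff[of n m] m by (metis int_dvd_int_iff dvd_minus_iff)
qed

lemma zeta_powi_cong: "int (p ^ n) dvd e - e' \<Longrightarrow> \<zeta> n powi e = \<zeta> n powi e'"
  using zeta_powi_eq_1_iff[of n "e - e'"] zeta_nonzero[of n]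
  by (simp add: power_int_diff zeta_nonzero)

lemma zeta_powi_scale: "\<zeta> (n + k) powi (int (p ^ k) * e) = \<zeta> n powi e"
  by (simp only: power_int_mult power_int_of_nat zeta_add)

text \<open>\<open>cexp\<close> works at the least possible level. Compatibility of the roots allows
  any larger level, so that a whole ball can be treated at one level \<open>N\<close>.\<close>

lemma cexp_eq:
  assumes "x * of_nat p ^ N = of_int k"
  shows "cexp p \<zeta> x = \<zeta> N powi k"
proof -
  define l where "l = lvl p x"
  have "x * of_nat p ^ N \<in> \<int>" using assms by simp
  then have l: "l \<le> N" "x * of_nat p ^ l \<in> \<int>" using lvl_least lvl_Ints by (auto simp: l_def)
  then obtain k' where k': "x * of_nat p ^ l = of_int k'" by (auto elim: Ints_cases)
  define n where "n = N - l"
  have N: "N = l + n" using l by (simp add: n_def)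
  have "(of_int k :: rat) = of_int k' * of_nat p ^ n"
    using assms by (simp add: N power_add mult.assoc flip: k')
  then have "(of_int k :: rat) = of_int (int (p ^ n) * k')" by simp
  then have k: "k = int (p ^ n) * k'" using of_int_eq_iff by blast
  have pos: "(0::rat) < of_nat p ^ l" using p_pos by simp
  have x: "x = of_int k' / of_nat p ^ l" using k' pos by (simp add: field_simps)
  have "frac x * of_nat p ^ l = of_int (k' - int (p ^ l) * \<lfloor>x\<rfloor>)"
    using k' by (simp add: frac_def algebra_simps)
  then have e: "\<lfloor>frac x * of_nat p ^ l\<rfloor> = k' - int (p ^ l) * \<lfloor>x\<rfloor>"
    by (simp only: floor_of_int)
  have "0 \<le> frac x * of_nat p ^ l" using pos by (intro mult_nonneg_nonneg) (auto simp: frac_ge_0)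
  then have "int (nat \<lfloor>frac x * of_nat p ^ l\<rfloor>) = k' - int (p ^ l) * \<lfloor>x\<rfloor>"
    using e by (metis nat_0_le zero_le_floor)
  then have "cexp p \<zeta> x = \<zeta> l powi (k' - int (p ^ l) * \<lfloor>x\<rfloor>)"
    unfolding cexp_def l_def[symmetric] by (metis power_int_of_nat)
  also have "\<dots> = \<zeta> l powi k'" by (rule zeta_powi_cong) simp
  also have "\<dots> = \<zeta> N powi k" by (simp only: N k zeta_powi_scale)
  finally show ?thesis .
qed

text \<open>Reading more digits of \<open>z\<close> than the level of \<open>t\<close> requires
  changes the exponent only by a multiple of the order of the root.\<close>

lemma pairing_eq:
  assumes "z \<in> Zp p" "t * of_nat p ^ N = of_nat k"
  shows "pairing p \<zeta> t z = \<zeta> N ^ (k * trunc p N z)"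
proof (cases "t = 0")
  case True
  then show ?thesis using assms p_pos by (simp add: pairing_def)
next
  case False
  define l where "l = lvl p t"
  have I: "t * of_nat p ^ N \<in> \<int>" using assms by simp
  then have l: "l \<le> N" "t * of_nat p ^ l \<in> \<int>" using lvl_least lvl_Ints by (auto simp: l_def)
  then obtain k' where k': "t * of_nat p ^ l = of_int k'" by (auto elim: Ints_cases)
  define n where "n = N - l"
  have N: "N = l + n" using l by (simp add: n_def)
  have "(of_int (int k) :: rat) = of_int k' * of_nat p ^ n"
    using assms by (simp add: N power_add mult.assoc flip: k')
  then have "(of_int (int k) :: rat) = of_int (int (p ^ n) * k')" by simp
  then have k: "int k = int (p ^ n) * k'" using of_int_eq_iff by blast
  have "t * of_nat (trunc p l z) * of_nat p ^ l = t * of_nat p ^ l * of_nat (trunc p l z)"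
    by simp
  also have "\<dots> = of_int (k' * int (trunc p l z))" by (simp add: k')
  finally have "pairing p \<zeta> t z = \<zeta> l powi (k' * int (trunc p l z))"
    using False by (simp add: pairing_def l_def cexp_eq)
  also have "\<dots> = \<zeta> l powi (k' * int (trunc p N z))"
  proof (rule zeta_powi_cong)
    have "int (trunc p N z) mod int (p ^ l) = int (trunc p l z) mod int (p ^ l)"
      using trunc_mod[OF assms(1) l(1)] trunc_less[OF assms(1)] by (metis mod_less of_nat_mod)
    then have "int (p ^ l) dvd int (trunc p l z) - int (trunc p N z)" by (metis mod_eq_dvd_iff)
    then show "int (p ^ l) dvd k' * int (trunc p l z) - k' * int (trunc p N z)"
      by (metis dvd_mult right_diff_distrib)
  qed
  also have "\<dots> = \<zeta> N powi (int (k * trunc p N z))"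
    by (simp only: N zeta_powi_scale of_nat_mult k mult.assoc)
  finally show ?thesis by (simp only: power_int_of_nat)
qed

lemma psum_eq:
  assumes "z \<in> Zp p"
  shows "psum p \<zeta> h N z = (\<Sum>k<p ^ N. h (of_nat k / of_nat p ^ N) * \<zeta> N ^ (k * trunc p N z))"
  unfolding psum_def ball_hatZ_eq[OF p_ge_2]
  using p_pos by (subst sum.reindex[OF inj_on_ball[OF p_ge_2]])
    (auto intro!: sum.cong simp: pairing_eq[OF assms])

lemma psum_0: "z \<in> Zp p \<Longrightarrow> psum p \<zeta> h 0 z = h 0"
  by (simp add: psum_eq)

lemma psum_cong: "(\<And>t. t \<in> hatZ p \<Longrightarrow> h t = h' t) \<Longrightarrow> psum p \<zeta> h N z = psum p \<zeta> h' N z"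
  by (auto simp: psum_def ball_hatZ_def intro!: sum.cong)

lemma psum_add: "psum p \<zeta> (\<lambda>t. h t + h' t) N z = psum p \<zeta> h N z + psum p \<zeta> h' N z"
  by (simp add: psum_def algebra_simps sum.distrib)

lemma psum_cmult: "psum p \<zeta> (\<lambda>t. c * h t) N z = c * psum p \<zeta> h N z"
  by (simp add: psum_def sum_distrib_left mult_ac)

lemma psum_sum: "psum p \<zeta> (\<lambda>t. \<Sum>i\<in>I. h i t) N z = (\<Sum>i\<in>I. psum p \<zeta> (h i) N z)"
  by (simp add: psum_def sum_distrib_right sum.swap[of _ I])

text \<open>A geometric sum whose ratio is a \<open>p ^ N\<close>-th root of unity: its numerator
  vanishes unless the ratio is 1.\<close>

lemma sum_zeta_powi:
  "(\<Sum>j<p ^ N. \<zeta> N powi (int j * e)) = (if int (p ^ N) dvd e then of_nat p ^ N else 0)"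
proof -
  define q where "q = \<zeta> N powi e"
  have *: "(\<Sum>j<p ^ N. \<zeta> N powi (int j * e)) = (\<Sum>j<p ^ N. q ^ j)"
    by (simp add: q_def mult.commute[of _ e] power_int_mult)
  show ?thesis
  proof (cases "int (p ^ N) dvd e")
    case True
    then have "q = 1" using zeta_powi_eq_1_iff by (simp add: q_def)
    then show ?thesis using * True by simp
  next
    case False
    then have "q \<noteq> 1" using zeta_powi_eq_1_iff by (simp add: q_def)
    have "q ^ (p ^ N) = \<zeta> N powi (e * int (p ^ N))" by (simp only: q_def power_int_mult power_int_of_nat)
    also have "\<dots> = 1" using zeta_powi_eq_1_iff[of N "e * int (p ^ N)"] by simp
    finally have "(\<Sum>j<p ^ N. q ^ j) = 0" using \<open>q \<noteq> 1\<close> by (simp add: geometric_sum)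
    then show ?thesis using * False by simp
  qed
qed

lemma digit_ft_eq:
  "digit_ft p \<zeta> c (of_nat k / of_nat p ^ N)
     = 1 / of_nat p * (\<Sum>i<p. c i * \<zeta> N powi (- (int i * int k)))"
  unfolding digit_ft_def using p_pos
  by (intro arg_cong[where f = "\<lambda>x. _ * x"] sum.cong refl arg_cong2[where f = "(*)"] cexp_eq) simp

lemma pairing_digits:
  assumes "k < p ^ N" "i < p ^ N"
  shows "pairing p \<zeta> (of_nat i / of_nat p ^ N) (digits p k) = \<zeta> N ^ (i * k)"
  using assms p_pos by (subst pairing_eq[where N = N and k = i]) (auto simp: digits_Zp trunc_digits)

lemma Zp_digits: "digits p k \<in> Zp p"
  using p_pos by (rule digits_Zp)

lemma dvd_diff_less:
  assumes "int m dvd int i - int j" "i < m" "j < m"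
  shows "i = j"
  using assms by (metis mod_eq_dvd_iff mod_less of_nat_eq_iff of_nat_mod)

text \<open>Orthogonality of the characters of the cyclic group of order
  \<open>p ^ N\<close>.\<close>

lemma sum_zeta_powi_diff:
  assumes "i < p ^ N" "j < p ^ N"
  shows "(\<Sum>k<p ^ N. \<zeta> N powi (int k * (int i - int j))) = (if i = j then of_nat p ^ N else 0)"
proof -
  have "int (p ^ N) dvd int i - int j \<longleftrightarrow> i = j"
    using assms dvd_diff_less by (metis cancel_comm_monoid_add_class.diff_cancel dvd_0_right)
  then show ?thesis by (simp only: sum_zeta_powi)
qed

lemma zeta_powi_diff: "inverse (\<zeta> N ^ m) * \<zeta> N ^ n = \<zeta> N powi (int n - int m)"
  by (simp add: power_int_diff zeta_nonzero field_simps)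

text \<open>Fourier inversion on the group of order \<open>p ^ N\<close>, from values back to
  coefficients, by orthogonality.\<close>

lemma psum_inversion:
  assumes t: "t \<in> ball_hatZ p N"
  shows "(\<Sum>k<p ^ N. inverse (pairing p \<zeta> t (digits p k)) * psum p \<zeta> h N (digits p k))
    = of_nat p ^ N * h t"
proof -
  obtain i where i: "i < p ^ N" "t = of_nat i / of_nat p ^ N"
    using t unfolding ball_hatZ_eq[OF p_ge_2] by auto
  have c: "inverse (\<zeta> N ^ (i * k)) * \<zeta> N ^ (l * k) = \<zeta> N powi (int k * (int l - int i))" for k l
    unfolding zeta_powi_diff by (simp add: algebra_simps)
  have "(\<Sum>k<p ^ N. inverse (pairing p \<zeta> t (digits p k)) * psum p \<zeta> h N (digits p k))
    = (\<Sum>k<p ^ N. \<Sum>l<p ^ N. h (of_nat l / of_nat p ^ N) * (inverse (\<zeta> N ^ (i * k)) * \<zeta> N ^ (l * k)))"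
    using i by (intro sum.cong refl)
      (simp add: psum_eq[OF Zp_digits] pairing_digits trunc_digits sum_distrib_left mult_ac)
  also have "\<dots> = (\<Sum>l<p ^ N. h (of_nat l / of_nat p ^ N) *
      (\<Sum>k<p ^ N. \<zeta> N powi (int k * (int l - int i))))"
    unfolding c by (subst sum.swap) (simp add: sum_distrib_left)
  also have "\<dots> = (\<Sum>l<p ^ N. if l = i then h t * of_nat p ^ N else 0)"
    using i by (intro sum.cong refl) (simp add: sum_zeta_powi_diff)
  also have "\<dots> = of_nat p ^ N * h t" using i(1) by simp
  finally show ?thesis .
qed

text \<open>The converse inversion. It is how partial sums get evaluated below: a candidate
  \<open>f\<close> for the values is guessed and only the coefficients on the ball have to be
  compared.\<close>

lemma psum_inversion':
  assumes k: "k < p ^ N"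
    and h: "\<And>t. t \<in> ball_hatZ p N \<Longrightarrow> h t = (\<Sum>l<p ^ N. inverse (pairing p \<zeta> t (digits p l)) * f l)"
  shows "psum p \<zeta> h N (digits p k) = of_nat p ^ N * f k"
proof -
  have c: "inverse (\<zeta> N ^ (i * l)) * \<zeta> N ^ (i * k) = \<zeta> N powi (int i * (int k - int l))" for i l
    unfolding zeta_powi_diff by (simp add: algebra_simps)
  have "psum p \<zeta> h N (digits p k)
     = (\<Sum>i<p ^ N. \<Sum>l<p ^ N. f l * (inverse (\<zeta> N ^ (i * l)) * \<zeta> N ^ (i * k)))"
    unfolding psum_eq[OF Zp_digits]
  proof (rule sum.cong[OF refl])
    fix i assume i: "i \<in> {..<p ^ N}"
    then have t: "of_nat i / of_nat p ^ N \<in> ball_hatZ p N" unfolding ball_hatZ_eq[OF p_ge_2] by auto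
    show "h (of_nat i / of_nat p ^ N) * \<zeta> N ^ (i * trunc p N (digits p k))
      = (\<Sum>l<p ^ N. f l * (inverse (\<zeta> N ^ (i * l)) * \<zeta> N ^ (i * k)))"
      unfolding h[OF t] sum_distrib_right
      using i k by (intro sum.cong refl) (simp add: trunc_digits pairing_digits mult_ac)
  qed
  also have "\<dots> = (\<Sum>l<p ^ N. f l * (\<Sum>i<p ^ N. \<zeta> N powi (int i * (int k - int l))))"
    unfolding c by (subst sum.swap) (simp add: sum_distrib_left)
  also have "\<dots> = (\<Sum>l<p ^ N. if l = k then f k * of_nat p ^ N else 0)"
    using k by (intro sum.cong refl) (simp add: sum_zeta_powi_diff)
  also have "\<dots> = of_nat p ^ N * f k" using k by simp
  finally show ?thesis .
qed

text \<open>Averaging over the \<open>p\<close> lifts of a residue class kills the frequencies of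
  exact level \<open>Suc N\<close>. After division by \<open>p ^ Suc N\<close> this is the
  additivity of the masses of residue classes.\<close>

lemma psum_refine:
  assumes k: "k < p ^ N"
  shows "(\<Sum>j<p. psum p \<zeta> h (Suc N) (digits p (k + p ^ N * j))) = of_nat p * psum p \<zeta> h N (digits p k)"
proof -
  define f where "f k = (\<Sum>j<p. psum p \<zeta> h (Suc N) (digits p (k + p ^ N * j))) / of_nat p ^ Suc N" for k
  have pf: "of_nat p ^ Suc N * f k = (\<Sum>j<p. psum p \<zeta> h (Suc N) (digits p (k + p ^ N * j)))" for k
    using p_nonzero by (simp add: f_def)
  have "psum p \<zeta> h N (digits p k) = of_nat p ^ N * f k"
    using k
  proof (rule psum_inversion')
    fix t assume t: "t \<in> ball_hatZ p N"
    then obtain i where i: "i < p ^ N" "t = of_nat i / of_nat p ^ N"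
      unfolding ball_hatZ_eq[OF p_ge_2] by auto
    have "p ^ N \<le> p ^ Suc N" using p_pos by simp
    then have t': "t \<in> ball_hatZ p (Suc N)" using t unfolding ball_hatZ_def by (blast intro: order_trans)
    have "t * of_nat p ^ N = of_nat i" using i p_pos by simp
    \<comment> \<open>A frequency of level at most \<open>N\<close> does not see the digit
      \<open>j\<close> in position \<open>N\<close>.\<close>
    then have pr: "pairing p \<zeta> t (digits p (l + p ^ N * j)) = pairing p \<zeta> t (digits p l)" for l j
      by (simp add: pairing_eq[OF Zp_digits] trunc_digits)
    have "of_nat p ^ Suc N * h t = (\<Sum>l<p ^ N. \<Sum>j<p. inverse (pairing p \<zeta> t (digits p l))
        * psum p \<zeta> h (Suc N) (digits p (l + p ^ N * j)))"
      using psum_inversion[OF t', of h] by (simp only: power_Suc2 sum_lessThan_mult pr)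
    also have "\<dots> = of_nat p ^ Suc N * (\<Sum>l<p ^ N. inverse (pairing p \<zeta> t (digits p l)) * f l)"
      by (simp only: pf mult.left_commute[of "of_nat p ^ Suc N"] flip: sum_distrib_left)
        (simp only: pf mult.left_commute[of "of_nat p ^ Suc N"] sum_distrib_left[of "of_nat p ^ Suc N"])
    finally show "h t = (\<Sum>l<p ^ N. inverse (pairing p \<zeta> t (digits p l)) * f l)"
      using p_nonzero by simp
  qed
  then show ?thesis using p_nonzero by (simp add: f_def)
qed

text \<open>Multiplication of a function on \<open>\<int>\<^sub>p\<close> that depends on \<open>\<theta>(z)\<close> by one that depends on the
  first digit, on the Fourier side.\<close>

lemma psum_Suc_digit_ft:
  assumes z: "z \<in> Zp p"
  shows "psum p \<zeta> (\<lambda>t. digit_ft p \<zeta> c t * g (hmul p t)) (Suc N) z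
    = c (z 0) * psum p \<zeta> g N (theta z)" (is "psum p \<zeta> ?h (Suc N) z = _")
proof -
  \<comment> \<open>The claimed value at the natural number \<open>l\<close>, whose lowest digit is
    \<open>l mod p\<close> and whose shift is \<open>l div p\<close>, divided by the group order as
    \<open>psum_inversion'\<close> expects.\<close>
  define f where "f l = c (l mod p) * psum p \<zeta> g N (digits p (l div p)) / of_nat p ^ Suc N" for l
  define l where "l = trunc p (Suc N) z"
  have l: "l < p ^ Suc N" unfolding l_def by (rule trunc_less[OF z])
  have z0: "z 0 < p" using z by (simp add: Zp_def)
  have "psum p \<zeta> ?h (Suc N) (digits p l) = of_nat p ^ Suc N * f l"
    using l
  proof (rule psum_inversion')
    fix t assume "t \<in> ball_hatZ p (Suc N)"
    then obtain k where k: "k < p ^ Suc N" "t = of_nat k / of_nat p ^ Suc N"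
      unfolding ball_hatZ_eq[OF p_ge_2] by auto
    let ?m = "k mod p ^ N"
    have m: "?m < p ^ N" using p_pos by simp
    have pt: "hmul p t = of_nat ?m / of_nat p ^ N" unfolding k(2) by (rule hmul_frac_power[OF p_ge_2])
    have ptb: "hmul p t \<in> ball_hatZ p N" unfolding pt ball_hatZ_eq[OF p_ge_2] using m by auto
    \<comment> \<open>The character splits into a factor for the lowest digit and the character of
      \<open>p t\<close> on the remaining digits.\<close>
    have pr: "pairing p \<zeta> t (digits p (i + p * j)) = \<zeta> (Suc N) ^ (i * k) * pairing p \<zeta> (hmul p t) (digits p j)"
      if "i < p" "j < p ^ N" for i j
    proof -
      have "i + p * j < p * Suc j" using that by simp
      also have "\<dots> \<le> p ^ Suc N" using that by (simp del: mult_Suc_right)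
      finally have "pairing p \<zeta> t (digits p (i + p * j)) = \<zeta> (Suc N) ^ (k * (i + p * j))"
        unfolding k(2) by (rule pairing_digits[OF _ k(1)])
      also have "\<dots> = \<zeta> (Suc N) ^ (i * k) * (\<zeta> (Suc N) ^ p) ^ (k * j)"
        by (simp add: distrib_left power_add mult_ac flip: power_mult)
      also have "(\<zeta> (Suc N) ^ p) ^ (k * j) = \<zeta> N powi int (k * j)"
        by (simp only: zeta_Suc power_int_of_nat)
      also have "\<dots> = \<zeta> N powi int (?m * j)"
      proof (rule zeta_powi_cong)
        have "int (p ^ N) dvd int k - int ?m" by (simp add: zmod_int)
        then show "int (p ^ N) dvd int (k * j) - int (?m * j)"
          by (simp only: of_nat_mult dvd_mult2 flip: left_diff_distrib)
      qed
      also have "\<dots> = pairing p \<zeta> (hmul p t) (digits p j)"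
        unfolding pt pairing_digits[OF that(2) m] power_int_of_nat ..
      finally show ?thesis .
    qed
    have "(\<Sum>l<p * p ^ N. inverse (pairing p \<zeta> t (digits p l)) * f l)
      = (\<Sum>i<p. \<Sum>j<p ^ N. (c i * inverse (\<zeta> (Suc N) ^ (i * k))) *
          (inverse (pairing p \<zeta> (hmul p t) (digits p j)) * psum p \<zeta> g N (digits p j))) / of_nat p ^ Suc N"
      unfolding sum_lessThan_mult sum_divide_distrib
      by (intro sum.cong refl) (simp only: pr lessThan_iff, simp add: f_def mult_ac)
    also have "\<dots> = (\<Sum>i<p. c i * inverse (\<zeta> (Suc N) ^ (i * k))) * g (hmul p t) / of_nat p"
      unfolding sum_product[symmetric] psum_inversion[OF ptb] using p_nonzero by simp
    also have "\<dots> = ?h t"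
      unfolding k(2) digit_ft_eq
      by (simp add: power_int_minus flip: of_nat_mult power_int_of_nat)
    finally show "?h t = (\<Sum>l<p ^ Suc N. inverse (pairing p \<zeta> t (digits p l)) * f l)" by simp
  qed
  \<comment> \<open>Only the first \<open>Suc N\<close> digits of \<open>z\<close> matter, so
    \<open>z\<close> may be replaced by a natural number.\<close>
  moreover have "psum p \<zeta> ?h (Suc N) z = psum p \<zeta> ?h (Suc N) (digits p l)"
    using l by (simp add: psum_eq z Zp_digits trunc_digits l_def del: power_Suc)
  moreover have "psum p \<zeta> g N (digits p (l div p)) = psum p \<zeta> g N (theta z)"
    using z0 trunc_less[OF theta_Zp[OF z]]
    by (simp add: psum_eq theta_Zp[OF z] Zp_digits trunc_digits l_def trunc_Suc')
  moreover have "l mod p = z 0" using z0 by (simp add: l_def trunc_Suc')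
  ultimately show ?thesis using p_nonzero by (simp add: f_def)
qed

end

section \<open>The recursion satisfied by the Fourier transforms\<close>

text \<open>The inner reduction subtracts an integer, and \<open>m\<close> times an integer is
  removed by the outer one.\<close>

lemma hmul_hmul: "hmul m (hmul n t) = hmul (m * n) t"
proof -
  have "hmul m (hmul n t) = frac (of_nat m * (of_nat n * t) - of_int (int m * \<lfloor>of_nat n * t\<rfloor>))"
    by (simp add: hmul_def frac_def[of "of_nat n * t"] right_diff_distrib)
  also have "\<dots> = frac (of_nat m * (of_nat n * t))"
    using frac_add_of_int_right[of _ "- (int m * \<lfloor>of_nat n * t\<rfloor>)"] by simp
  finally show ?thesis by (simp add: hmul_def mult.assoc)
qed

lemma hmul_1: "t \<in> hatZ p \<Longrightarrow> hmul (Suc 0) t = t"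
  by (simp add: hmul_def hatZ_def frac_eq)

lemma hmul_0 [simp]: "hmul m 0 = 0"
  by (simp add: hmul_def)

lemma zero_hatZ [simp]: "0 \<in> hatZ p"
  by (simp add: hatZ_def)

lemma lvl_eq_0_iff: "t \<in> hatZ p \<Longrightarrow> lvl p t = 0 \<longleftrightarrow> t = 0"
proof
  assume t: "t \<in> hatZ p" "lvl p t = 0"
  then obtain n where "t * of_nat p ^ n \<in> \<int>" by (auto simp: hatZ_def)
  from lvl_Ints[OF this] t have "t \<in> \<int>" "0 \<le> t" "t < 1" by (auto simp: hatZ_def)
  then show "t = 0" using frac_eq frac_eq_0_iff by metis
qed simp

lemma hmul_Ints_iff: "hmul p t * of_nat p ^ n \<in> \<int> \<longleftrightarrow> t * of_nat p ^ Suc n \<in> \<int>"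
proof -
  have "t * of_nat p ^ Suc n = hmul p t * of_nat p ^ n + of_int (\<lfloor>of_nat p * t\<rfloor> * int p ^ n)"
    by (simp add: hmul_def frac_def algebra_simps)
  moreover have "x + of_int i \<in> \<int> \<longleftrightarrow> x \<in> \<int>" for x :: rat and i
    using Ints_diff[of "x + of_int i" "of_int i"] by auto
  ultimately show ?thesis by simp
qed

lemma hmul_hatZ:
  assumes "t \<in> hatZ p"
  shows "hmul p t \<in> hatZ p"
proof -
  obtain n where "t * of_nat p ^ n \<in> \<int>" using assms by (auto simp: hatZ_def)
  then have "t * of_nat p ^ Suc n \<in> \<int>" using Ints_mult[OF Ints_of_nat[of p]] by (metis mult.left_commute power_Suc)
  then show ?thesis unfolding hatZ_def using hmul_Ints_iff[of p t]
    by (auto simp: hmul_def frac_lt_1)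
qed

lemma lvl_hmul:
  assumes "t \<in> hatZ p"
  shows "lvl p (hmul p t) = lvl p t - 1"
proof (cases "lvl p t")
  case 0
  then show ?thesis using lvl_eq_0_iff[OF assms] by simp
next
  case (Suc l)
  have "t * of_nat p ^ lvl p t \<in> \<int>" using assms lvl_Ints by (auto simp: hatZ_def)
  then have 1: "hmul p t * of_nat p ^ l \<in> \<int>" using Suc hmul_Ints_iff by simp
  have "t * of_nat p ^ Suc (lvl p (hmul p t)) \<in> \<int>"
    using lvl_Ints[OF 1] hmul_Ints_iff by blast
  then have "Suc l \<le> Suc (lvl p (hmul p t))" using lvl_least Suc by metis
  then show ?thesis using lvl_least[OF 1] Suc by simp
qed

lemma hat_A_0 [simp]: "hat_A p \<alpha> 0 = 1"
  by (simp add: hat_A_def)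

lemma prod_hmul_Suc:
  assumes "t \<in> hatZ p"
  shows "(\<Prod>n<Suc l. \<alpha> (hmul (p ^ n) t)) = \<alpha> t * (\<Prod>n<l. \<alpha> (hmul (p ^ n) (hmul p t)))"
  using assms by (subst prod.lessThan_Suc_shift) (simp add: hmul_1 hmul_hmul mult.commute)

lemma hat_A_rec:
  assumes "t \<in> hatZ p" "t \<noteq> 0"
  shows "hat_A p \<alpha> t = \<alpha> t * hat_A p \<alpha> (hmul p t)"
proof -
  have "lvl p t \<noteq> 0" using assms lvl_eq_0_iff by blast
  then obtain l where l: "lvl p t = Suc l" using not0_implies_Suc by blast
  then show ?thesis using assms
    by (simp only: hat_A_def lvl_hmul l prod_hmul_Suc) simp
qed

text \<open>The last factor of \<open>hat_A\<close> is the denominator of \<gamma>. Cancelling it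
  merges both branches of the definition into one formula without division.\<close>

lemma gamma_hat_A_eq:
  assumes "2 \<le> p" "t \<in> hatZ p" "t \<noteq> 0"
  shows "gamma_hat_A p \<alpha> \<beta> t
    = \<beta> (hmul (p ^ (lvl p t - 1)) t) * (\<Prod>n<lvl p t - 1. \<alpha> (hmul (p ^ n) t))"
proof -
  have "lvl p t \<noteq> 0" using assms lvl_eq_0_iff by blast
  then obtain l where l: "lvl p t = Suc l" using not0_implies_Suc by blast
  have s: "frac (t * of_nat (tabs p t) / of_nat p) = hmul (p ^ l) t"
    using assms l by (simp add: tabs_def hmul_def mult.commute)
  show ?thesis
    unfolding gamma_hat_A_def s Let_def hat_A_def l by (simp add: field_simps)
qed

text \<open>\<beta> is evaluated at the last nonzero point of the chain \<open>t\<close>,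
  \<open>p t\<close>, \<open>p^2 t\<close>, and so on. Passing to \<open>p t\<close> leaves that
  point unchanged unless \<open>p t = 0\<close>.\<close>

lemma gamma_hat_A_rec:
  assumes "2 \<le> p" "t \<in> hatZ p" "t \<noteq> 0"
  shows "gamma_hat_A p \<alpha> \<beta> t
    = (if hmul p t = 0 then \<beta> t else \<alpha> t * gamma_hat_A p \<alpha> \<beta> (hmul p t))"
proof (cases "hmul p t = 0")
  case True
  then have "lvl p t = 1" using assms lvl_hmul[OF assms(2)] lvl_eq_0_iff[OF assms(2)] by simp
  then show ?thesis using True assms by (simp add: gamma_hat_A_eq hmul_1)
next
  case False
  then have "lvl p (hmul p t) \<noteq> 0" using lvl_eq_0_iff hmul_hatZ assms by blast
  then obtain l where l': "lvl p (hmul p t) = Suc l" using not0_implies_Suc by blast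
  then have l: "lvl p t = Suc (Suc l)" using lvl_hmul[OF assms(2)] by simp
  show ?thesis
    using assms False hmul_hatZ[OF assms(2)]
    by (simp only: gamma_hat_A_eq l l' diff_Suc_1 prod_hmul_Suc if_False not_False_eq_True)
      (simp add: hmul_hmul mult_ac)
qed

text \<open>The formula for \<open>affine_ft\<close> solves \<open>h(t) = \<alpha>(t) h(pt)\<close> up to the term \<open>\<beta>(t)\<close> for \<open>pt = 0\<close>.
  At \<open>t = 0\<close> this is impossible if \<open>\<alpha>(0) = 1\<close> and \<open>\<beta>(0) \<noteq> 0\<close>, which forces a correction.\<close>

lemma affine_ft_rec:
  assumes "2 \<le> p" "t \<in> hatZ p"
  shows "affine_ft p \<alpha> \<beta> t = \<alpha> t * affine_ft p \<alpha> \<beta> (hmul p t)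
    + (if hmul p t = 0 then \<beta> t else 0) - (if \<alpha> 0 = 1 then \<beta> 0 else 0) * hat_A p \<alpha> t"
proof (cases "t = 0")
  case True
  then show ?thesis by (simp add: affine_ft_def field_simps)
next
  case False
  have l: "lvl p t = Suc (lvl p (hmul p t))"
    using False lvl_eq_0_iff[OF assms(2)] lvl_hmul[OF assms(2)] by simp
  show ?thesis
    using assms False unfolding affine_ft_def
    by (simp add: hat_A_rec[OF assms(2) False] gamma_hat_A_rec[OF assms False] l) (simp add: algebra_simps)
qed

text \<open>Cancels the two signs, in \<open>ccoef\<close> and in front of \<open>ghat\<close>, when
  \<open>n\<close> is a unit index.\<close>

lemma affine_ft_uminus: "affine_ft p \<alpha> (\<lambda>t. - \<beta> t) t = - affine_ft p \<alpha> \<beta> t"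
  by (simp add: affine_ft_def gamma_hat_A_def Let_def)

text \<open>This and the next definition are A_N(z) and B_N(z): slope and intercept of the affine
  map obtained by composing the maps of the first \<open>N\<close> digits.\<close>

definition digit_prod :: "(nat \<Rightarrow> 'l::comm_ring_1) \<Rightarrow> nat \<Rightarrow> (nat \<Rightarrow> nat) \<Rightarrow> 'l" where
  "digit_prod a N z = (\<Prod>i<N. a (z i))"

definition digit_series :: "(nat \<Rightarrow> 'l::comm_ring_1) \<Rightarrow> (nat \<Rightarrow> 'l) \<Rightarrow> nat \<Rightarrow> (nat \<Rightarrow> nat) \<Rightarrow> 'l" where
  "digit_series a b N z = (\<Sum>i<N. digit_prod a i z * b (z i))"

lemma digit_prod_0 [simp]: "digit_prod a 0 z = 1"
  by (simp add: digit_prod_def)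

lemma digit_series_0 [simp]: "digit_series a b 0 z = 0"
  by (simp add: digit_series_def)

lemma digit_prod_Suc: "digit_prod a (Suc N) z = a (z 0) * digit_prod a N (theta z)"
  unfolding digit_prod_def prod.lessThan_Suc_shift by (simp add: theta_def)

lemma digit_series_Suc:
  "digit_series a b (Suc N) z = a (z 0) * digit_series a b N (theta z) + b (z 0)"
  unfolding digit_series_def sum.lessThan_Suc_shift
  by (simp add: digit_prod_Suc sum_distrib_left mult.assoc theta_def)

context unity_roots
begin

text \<open>The normalization at 0 makes the product recursion for \<open>hat_A\<close> hold at
  \<open>t = 0\<close> too, so the partial sums pick up one digit at a time.\<close>

lemma psum_hat_A:
  assumes "digit_ft p \<zeta> c 0 = 1" "z \<in> Zp p"
  shows "psum p \<zeta> (hat_A p (digit_ft p \<zeta> c)) N z = digit_prod c N z"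
  using assms(2)
proof (induction N arbitrary: z)
  case (Suc N)
  have "psum p \<zeta> (hat_A p (digit_ft p \<zeta> c)) (Suc N) z
      = psum p \<zeta> (\<lambda>t. digit_ft p \<zeta> c t * hat_A p (digit_ft p \<zeta> c) (hmul p t)) (Suc N) z"
  proof (rule psum_cong)
    fix t assume "t \<in> hatZ p"
    then show "hat_A p (digit_ft p \<zeta> c) t = digit_ft p \<zeta> c t * hat_A p (digit_ft p \<zeta> c) (hmul p t)"
      using assms(1) by (cases "t = 0") (simp_all add: hat_A_rec)
  qed
  also have "\<dots> = digit_prod c (Suc N) z"
    using Suc by (simp add: psum_Suc_digit_ft digit_prod_Suc theta_Zp)
  finally show ?case .
qed (simp add: psum_0)

end

section \<open>Multi-indices\<close>

lemma multi_indices_le: "n \<in> multi_indices d \<Longrightarrow> m \<le> n \<Longrightarrow> m \<in> multi_indices d"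
  by (auto simp: multi_indices_def le_fun_def) (metis le_zero_eq)+

lemma unit_index_multi: "j \<in> {1..d} \<Longrightarrow> unit_index j \<in> multi_indices d"
  by (auto simp: multi_indices_def unit_index_def)

text \<open>Multi-indices are total functions, while the exchange of product and sum is about
  extensional functions on \<open>{1..d}\<close>.\<close>

lemma bij_betw_multi_le:
  assumes "n \<in> multi_indices d"
  shows "bij_betw (\<lambda>g j. if j \<in> {1..d} then g j else 0) (\<Pi>\<^sub>E j\<in>{1..d}. {..n j}) {m. m \<le> n}"
proof (rule bij_betwI[where g = "\<lambda>m. restrict m {1..d}"])
  show "(\<lambda>g j. if j \<in> {1..d} then g j else 0) \<in> (\<Pi>\<^sub>E j\<in>{1..d}. {..n j}) \<rightarrow> {m. m \<le> n}"
    by (auto simp: le_fun_def PiE_iff)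
  show "(\<lambda>m. restrict m {1..d}) \<in> {m. m \<le> n} \<rightarrow> (\<Pi>\<^sub>E j\<in>{1..d}. {..n j})"
    by (auto simp: le_fun_def)
  fix g assume "g \<in> (\<Pi>\<^sub>E j\<in>{1..d}. {..n j})"
  then show "restrict (\<lambda>j. if j \<in> {1..d} then g j else 0) {1..d} = g"
    by (intro ext) (auto simp: PiE_iff extensional_def)
next
  fix m assume "m \<in> {m. m \<le> n}"
  then have "m \<in> multi_indices d" using assms multi_indices_le by blast
  then show "(\<lambda>j. if j \<in> {1..d} then restrict m {1..d} j else 0) = m"
    by (intro ext) (auto simp: multi_indices_def)
qed

lemma finite_multi_le: "n \<in> multi_indices d \<Longrightarrow> finite {m. m \<le> n}"
  using bij_betw_finite[OF bij_betw_multi_le] by (metis finite_PiE finite_atLeastAtMost finite_atMost)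

lemma finite_multi_less: "n \<in> multi_indices d \<Longrightarrow> finite {m. m < n}"
  by (rule finite_subset[OF _ finite_multi_le]) (auto simp: less_le)

lemma sum_multi_le:
  assumes "n \<in> multi_indices d"
  shows "(\<Sum>m | m \<le> n. g m) = (\<Sum>m | m < n. g m) + g n"
proof -
  have "{m. m \<le> n} = insert n {m. m < n}" by auto
  then show ?thesis using finite_multi_less[OF assms] by (simp add: add.commute)
qed

lemma sum_prod_multi:
  fixes f :: "nat \<Rightarrow> nat \<Rightarrow> 'l::comm_ring_1"
  assumes "n \<in> multi_indices d"
  shows "(\<Sum>m | m \<le> n. \<Prod>j=1..d. f j (m j)) = (\<Prod>j=1..d. \<Sum>i\<le>n j. f j i)"
proof -
  have "(\<Prod>j=1..d. \<Sum>i\<le>n j. f j i) = (\<Sum>g\<in>(\<Pi>\<^sub>E j\<in>{1..d}. {..n j}). \<Prod>j=1..d. f j (g j))"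
    by (rule prod_sum_PiE) auto
  also have "\<dots> = (\<Sum>g\<in>(\<Pi>\<^sub>E j\<in>{1..d}. {..n j}). \<Prod>j=1..d. f j (if j \<in> {1..d} then g j else 0))"
    by (intro sum.cong prod.cong) auto
  also have "\<dots> = (\<Sum>m | m \<le> n. \<Prod>j=1..d. f j (m j))"
    by (rule sum.reindex_bij_betw[OF bij_betw_multi_le[OF assms]])
  finally show ?thesis by simp
qed

text \<open>The coefficient of \<open>X\<^sup>m\<close> in \<open>(a X + b)\<^sup>n\<close>.\<close>

definition affine_coeff ::
  "nat \<Rightarrow> (nat \<Rightarrow> 'l::comm_ring_1) \<Rightarrow> (nat \<Rightarrow> 'l) \<Rightarrow> (nat \<Rightarrow> nat) \<Rightarrow> (nat \<Rightarrow> nat) \<Rightarrow> 'l" where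
  "affine_coeff d a b m n = (\<Prod>j=1..d. of_nat (n j choose m j) * a j ^ m j * b j ^ (n j - m j))"

lemma rcoef_eq: "rcoef d a b m n k = affine_coeff d (\<lambda>j. a j k) (\<lambda>j. b j k) m n"
  by (simp add: rcoef_def affine_coeff_def)

lemma affine_coeff_diag: "affine_coeff d a b n n = (\<Prod>j=1..d. a j ^ n j)"
  by (simp add: affine_coeff_def)

lemma affine_coeff_0: "affine_coeff d a b (\<lambda>_. 0) n = (\<Prod>j=1..d. b j ^ n j)"
  by (simp add: affine_coeff_def)

lemma affine_coeff_eq_0:
  assumes "n \<in> multi_indices d" "m \<in> multi_indices d" "\<not> m \<le> n"
  shows "affine_coeff d a b m n = 0"
proof -
  obtain j where "n j < m j" using assms(3) by (auto simp: le_fun_def not_le)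
  moreover from this have "j \<in> {1..d}" using assms by (auto simp: multi_indices_def)
  ultimately show ?thesis unfolding affine_coeff_def by (intro prod_zero) (auto intro!: bexI[of _ j] simp: binomial_eq_0)
qed

text \<open>Without intercept, (a X)^n is a single monomial.\<close>

lemma affine_coeff_zero_right:
  assumes "n \<in> multi_indices d" "m \<le> n"
  shows "affine_coeff d a (\<lambda>_. 0) m n = (if m = n then \<Prod>j=1..d. a j ^ n j else 0)"
proof (cases "m = n")
  case False
  then obtain j where j: "m j < n j" using assms(2) by (metis le_fun_def le_neq_implies_less ext)
  moreover from this have "j \<in> {1..d}" using assms by (auto simp: multi_indices_def)
  ultimately show ?thesis using False unfolding affine_coeff_def
    by (simp, intro prod_zero) (auto intro!: bexI[of _ j] simp: zero_power)
qed (simp add: affine_coeff_diag)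

text \<open>Both sides are the coefficient of X^m in (a (A X + B) + b)^n, the left one after
  expanding the outer power first.\<close>

lemma binomial_comp:
  fixes a b A B :: "'l::comm_ring_1"
  shows "(\<Sum>i\<le>n. (of_nat (n choose i) * a ^ i * b ^ (n - i)) * (of_nat (i choose m) * A ^ m * B ^ (i - m)))
    = of_nat (n choose m) * (a * A) ^ m * (a * B + b) ^ (n - m)"
proof (cases "m \<le> n")
  case True
  have "(\<Sum>i\<le>n. (of_nat (n choose i) * a ^ i * b ^ (n - i)) * (of_nat (i choose m) * A ^ m * B ^ (i - m)))
     = (\<Sum>i=m..n. (of_nat (n choose i) * a ^ i * b ^ (n - i)) * (of_nat (i choose m) * A ^ m * B ^ (i - m)))"
    by (rule sum.mono_neutral_right) (auto simp: binomial_eq_0)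
  also have "\<dots> = (\<Sum>i\<le>n - m. of_nat (n choose m) * (a * A) ^ m *
      (of_nat ((n - m) choose i) * (a * B) ^ i * b ^ (n - m - i)))"
  proof (rule sum.reindex_bij_witness[where j = "\<lambda>i. i - m" and i = "\<lambda>i. i + m"])
    fix i assume i: "i \<in> {m..n}"
    then have c: "(n choose i) * (i choose m) = (n choose m) * ((n - m) choose (i - m))"
      by (intro choose_mult) auto
    have "of_nat (n choose m) * (a * A) ^ m *
      (of_nat ((n - m) choose (i - m)) * (a * B) ^ (i - m) * b ^ (n - m - (i - m)))
      = of_nat ((n choose m) * ((n - m) choose (i - m))) * (a ^ m * a ^ (i - m)) * A ^ m * B ^ (i - m) * b ^ (n - i)"
      using i by (simp add: power_mult_distrib mult_ac)
    also have "\<dots> = (of_nat (n choose i) * a ^ i * b ^ (n - i)) * (of_nat (i choose m) * A ^ m * B ^ (i - m))"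
      using i by (simp flip: c power_add add: mult_ac)
    finally show "of_nat (n choose m) * (a * A) ^ m *
      (of_nat ((n - m) choose (i - m)) * (a * B) ^ (i - m) * b ^ (n - m - (i - m)))
      = (of_nat (n choose i) * a ^ i * b ^ (n - i)) * (of_nat (i choose m) * A ^ m * B ^ (i - m))" .
  qed (use True in auto)
  also have "\<dots> = of_nat (n choose m) * (a * A) ^ m * (a * B + b) ^ (n - m)"
    by (simp add: binomial_ring sum_distrib_left)
  finally show ?thesis .
qed (auto simp: binomial_eq_0 intro!: sum.neutral)

text \<open>The matrices of coefficients represent the composition of affine maps, one in each
  variable.\<close>

lemma affine_coeff_comp:
  assumes "n \<in> multi_indices d"
  shows "(\<Sum>m' | m' \<le> n. affine_coeff d a b m' n * affine_coeff d A B m m')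
    = affine_coeff d (\<lambda>j. a j * A j) (\<lambda>j. a j * B j + b j) m n"
  unfolding affine_coeff_def prod.distrib[symmetric] binomial_comp[symmetric]
  by (rule sum_prod_multi[OF assms])

text \<open>The same composition applied to a vector \<open>y\<close>. The inner ranges depend on
  \<open>m'\<close> and are padded up to \<open>n\<close> with vanishing coefficients.\<close>

lemma affine_coeff_comp_le:
  assumes "n \<in> multi_indices d"
  shows "(\<Sum>m' | m' \<le> n. affine_coeff d a b m' n * (\<Sum>m | m \<le> m'. affine_coeff d A B m m' * y m))
    = (\<Sum>m | m \<le> n. affine_coeff d (\<lambda>j. a j * A j) (\<lambda>j. a j * B j + b j) m n * y m)"
proof -
  have "(\<Sum>m | m \<le> m'. affine_coeff d A B m m' * y m) = (\<Sum>m | m \<le> n. affine_coeff d A B m m' * y m)"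
    if m': "m' \<le> n" for m'
  proof (rule sum.mono_neutral_left)
    show "finite {m. m \<le> n}" using assms by (rule finite_multi_le)
    show "{m. m \<le> m'} \<subseteq> {m. m \<le> n}" using m' by (auto intro: order_trans)
    show "\<forall>i\<in>{m. m \<le> n} - {m. m \<le> m'}. affine_coeff d A B i m' * y i = 0"
      using multi_indices_le[OF assms] m' affine_coeff_eq_0[of m' d _ A B] by simp
  qed
  then have "(\<Sum>m' | m' \<le> n. affine_coeff d a b m' n * (\<Sum>m | m \<le> m'. affine_coeff d A B m m' * y m))
    = (\<Sum>m' | m' \<le> n. \<Sum>m | m \<le> n. affine_coeff d a b m' n * affine_coeff d A B m m' * y m)"
    by (simp add: sum_distrib_left mult.assoc)
  also have "\<dots> = (\<Sum>m | m \<le> n. (\<Sum>m' | m' \<le> n. affine_coeff d a b m' n * affine_coeff d A B m m') * y m)"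
    by (subst sum.swap) (simp add: sum_distrib_right)
  finally show ?thesis by (simp only: affine_coeff_comp[OF assms])
qed

section \<open>Partial sums of the Fourier series\<close>

text \<open>The recursive formula taken as a hypothesis on a family \<open>Xh\<close>, for arbitrary
  coefficients in the field. The formula for the single transforms is derived from it in
  \<open>Xh_unit\<close>.\<close>

locale transform_system = unity_roots p \<zeta> for p :: nat and \<zeta> :: "nat \<Rightarrow> 'l::field" +
  fixes d :: nat and a b :: "nat \<Rightarrow> nat \<Rightarrow> 'l" and Xh :: "(nat \<Rightarrow> nat) \<Rightarrow> rat \<Rightarrow> 'l"
  assumes Xh_0: "\<And>t. t \<in> hatZ p \<Longrightarrow> Xh (\<lambda>_. 0) t = one_zero t"
    and Xh_rec: "\<And>n t. n \<in> multi_indices d \<Longrightarrow> n \<noteq> (\<lambda>_. 0) \<Longrightarrow> t \<in> hatZ p \<Longrightarrow>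
      Xh n t = fhat p d \<zeta> a b Xh n t - ghat p d \<zeta> a b Xh n t"
begin

text \<open>The e_n of the overview. If \<alpha>_n(0) = 1, the plain recursion at
  \<open>t = 0\<close> would read h_n(0) = h_n(0) - \<beta>_n(0), so \<beta>_n(0) has to be added
  back.\<close>

definition defect :: "(nat \<Rightarrow> nat) \<Rightarrow> 'l" where
  "defect n = (if n \<noteq> (\<lambda>_. 0) \<and> alpha_mn p d \<zeta> a b n n 0 = 1 then beta_n p d \<zeta> a b Xh n 0 else 0)"

text \<open>In this form \<beta>_n(t) is minus the lower terms of the recursion at a point with
  \<open>p t = 0\<close>.\<close>

lemma beta_n_eq: "beta_n p d \<zeta> a b Xh n t = - (\<Sum>m | m < n. alpha_mn p d \<zeta> a b m n t * Xh m 0)"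
proof -
  have "beta_n p d \<zeta> a b Xh n t = - (1 / of_nat p * (\<Sum>k<p. \<Sum>m | m < n.
      rcoef d a b m n k * cexp p \<zeta> (- of_nat k * t) * Xh m 0))"
    by (simp add: beta_n_def digit_ft_def ccoef_def sum_distrib_left sum_negf mult_ac)
  also have "\<dots> = - (\<Sum>m | m < n. alpha_mn p d \<zeta> a b m n t * Xh m 0)"
    by (subst sum.swap) (simp add: alpha_mn_def digit_ft_def sum_distrib_left sum_distrib_right mult_ac)
  finally show ?thesis .
qed

text \<open>The summand \<open>i = 0\<close> is split off. The range stops one step early, so that
  \<open>Xh m\<close> is never evaluated at 0; those terms are left to \<open>ghat\<close>.\<close>

lemma fhat_rec:
  assumes t: "t \<in> hatZ p"
  shows "fhat p d \<zeta> a b Xh n t = (if hmul p t = 0 then 0 else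
    (\<Sum>m | m < n. alpha_mn p d \<zeta> a b m n t * Xh m (hmul p t))
      + alpha_mn p d \<zeta> a b n n t * fhat p d \<zeta> a b Xh n (hmul p t))"
proof (cases "hmul p t = 0")
  case True
  then have "lvl p t - 1 = 0" using lvl_hmul[OF t] by simp
  then show ?thesis using True by (simp add: fhat_def)
next
  case False
  let ?\<alpha> = "alpha_mn p d \<zeta> a b"
  have "lvl p (hmul p t) \<noteq> 0" using False lvl_eq_0_iff hmul_hatZ[OF t] by blast
  then have l: "lvl p t - 1 = Suc (lvl p (hmul p t) - 1)" using lvl_hmul[OF t] by simp
  have "(\<Sum>i<lvl p t - 1. (\<Prod>l<i. ?\<alpha> n n (hmul (p ^ l) t)) * ?\<alpha> m n (hmul (p ^ i) t)
        * Xh m (hmul (p ^ (i + 1)) t))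
    = ?\<alpha> m n t * Xh m (hmul p t) + ?\<alpha> n n t * (\<Sum>i<lvl p (hmul p t) - 1.
        (\<Prod>l<i. ?\<alpha> n n (hmul (p ^ l) (hmul p t))) * ?\<alpha> m n (hmul (p ^ i) (hmul p t))
        * Xh m (hmul (p ^ (i + 1)) (hmul p t)))" for m
    unfolding l sum.lessThan_Suc_shift prod_hmul_Suc[OF t] sum_distrib_left
    by (simp add: hmul_1[OF t] hmul_hmul mult_ac)
  then show ?thesis
    using False by (simp add: fhat_def sum.distrib sum_distrib_left)
qed

text \<open>The lower terms come from \<open>fhat\<close> when \<open>p t \<noteq> 0\<close>, and
  from \<open>ghat\<close> through \<beta>_n when \<open>p t = 0\<close>.\<close>

lemma Xh_transfer:
  assumes n: "n \<in> multi_indices d" "n \<noteq> (\<lambda>_. 0)" and t: "t \<in> hatZ p"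
  shows "Xh n t = (\<Sum>m | m \<le> n. alpha_mn p d \<zeta> a b m n t * Xh m (hmul p t))
    + defect n * hat_A p (alpha_mn p d \<zeta> a b n n) t"
  unfolding sum_multi_le[OF n(1)] Xh_rec[OF n t] Xh_rec[OF n hmul_hatZ[OF t]] fhat_rec[OF t] ghat_def
    affine_ft_rec[OF p_ge_2 t] defect_def
  using n(2) by (auto simp: beta_n_eq[of n t] algebra_simps fhat_def)

lemma psum_Xh_0:
  assumes "z \<in> Zp p"
  shows "psum p \<zeta> (Xh (\<lambda>_. 0)) N z = 1"
proof -
  have "psum p \<zeta> (Xh (\<lambda>_. 0)) N z = psum p \<zeta> one_zero N z"
    using Xh_0 by (rule psum_cong)
  also have "\<dots> = (\<Sum>k<p ^ N. if k = 0 then 1 else 0)"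
    using p_pos unfolding psum_eq[OF assms] by (intro sum.cong) (auto simp: one_zero_def)
  also have "\<dots> = 1" using p_pos by simp
  finally show ?thesis .
qed

lemma psum_Xh_Suc:
  assumes n: "n \<in> multi_indices d" "n \<noteq> (\<lambda>_. 0)" and z: "z \<in> Zp p"
  shows "psum p \<zeta> (Xh n) (Suc N) z = (\<Sum>m | m \<le> n. rcoef d a b m n (z 0) * psum p \<zeta> (Xh m) N (theta z))
    + defect n * digit_prod (rcoef d a b n n) (Suc N) z"
proof -
  have "psum p \<zeta> (Xh n) (Suc N) z = psum p \<zeta> (\<lambda>t. (\<Sum>m | m \<le> n. alpha_mn p d \<zeta> a b m n t * Xh m (hmul p t))
      + defect n * hat_A p (alpha_mn p d \<zeta> a b n n) t) (Suc N) z"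
    using Xh_transfer[OF n] by (rule psum_cong)
  also have "\<dots> = (\<Sum>m | m \<le> n. rcoef d a b m n (z 0) * psum p \<zeta> (Xh m) N (theta z))
      + defect n * psum p \<zeta> (hat_A p (alpha_mn p d \<zeta> a b n n)) (Suc N) z"
    unfolding psum_add psum_sum psum_cmult alpha_mn_def by (simp add: psum_Suc_digit_ft[OF z])
  \<comment> \<open>If \<alpha>_n(0) is not 1, the factor \<open>defect n\<close> is 0 and nothing
    has to be known about the partial sum of \<open>hat_A\<close>.\<close>
  also have "defect n * psum p \<zeta> (hat_A p (alpha_mn p d \<zeta> a b n n)) (Suc N) z
      = defect n * digit_prod (rcoef d a b n n) (Suc N) z"
    using psum_hat_A[of "rcoef d a b n n" z "Suc N"] z by (auto simp: defect_def alpha_mn_def)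
  finally show ?thesis .
qed

abbreviation dprod :: "nat \<Rightarrow> (nat \<Rightarrow> nat) \<Rightarrow> nat \<Rightarrow> 'l" where
  "dprod m z \<equiv> (\<lambda>j. digit_prod (a j) m z)"

abbreviation dseries :: "nat \<Rightarrow> (nat \<Rightarrow> nat) \<Rightarrow> nat \<Rightarrow> 'l" where
  "dseries m z \<equiv> (\<lambda>j. digit_series (a j) (b j) m z)"

lemma digit_prod_rcoef: "digit_prod (rcoef d a b n n) N z = (\<Prod>j=1..d. dprod N z j ^ n j)"
  by (induction N arbitrary: z)
    (simp_all add: digit_prod_Suc rcoef_eq affine_coeff_diag power_mult_distrib prod.distrib)

text \<open>Induction by prefixing a digit. A correction made \<open>i\<close> digits deep is e_m
  times the m-th power of A_{N-i}(theta^i z). Prefixing the first \<open>i\<close> digits multiplies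
  the slope to A_N but only brings in the intercept B_i, which explains the mixed indices.\<close>

lemma psum_Xh:
  assumes "n \<in> multi_indices d" "z \<in> Zp p"
  shows "psum p \<zeta> (Xh n) N z = (\<Sum>m | m \<le> n. affine_coeff d (dprod N z) (dseries N z) m n * Xh m 0)
    + (\<Sum>i<N. \<Sum>m | m \<le> n. affine_coeff d (dprod N z) (dseries i z) m n * defect m)"
  using assms
proof (induction N arbitrary: n z)
  case 0
  have "(\<Sum>m | m \<le> n. affine_coeff d (\<lambda>j. 1) (\<lambda>j. 0) m n * Xh m 0) = (\<Sum>m | m \<le> n. if m = n then Xh n 0 else 0)"
    using 0 by (intro sum.cong) (auto simp: affine_coeff_zero_right)
  also have "\<dots> = Xh n 0" using finite_multi_le[OF 0(1)] by simp
  finally show ?case using 0 by (simp add: psum_0)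
next
  case (Suc N)
  note n = Suc.prems(1) and z = Suc.prems(2)
  show ?case
  proof (cases "n = (\<lambda>_. 0)")
    case True
    have "{m. m \<le> n} = {\<lambda>_. 0}" using True by (auto simp: le_fun_def)
    then show ?thesis using True z by (simp add: psum_Xh_0 Xh_0 one_zero_def defect_def affine_coeff_0)
  next
    case False
    let ?a = "\<lambda>j. a j (z 0)" and ?b = "\<lambda>j. b j (z 0)"
    have A: "(\<lambda>j. ?a j * dprod N (theta z) j) = dprod (Suc N) z"
      by (simp add: digit_prod_Suc)
    have B: "(\<lambda>j. ?a j * dseries i (theta z) j + ?b j) = dseries (Suc i) z" for i
      by (simp add: digit_series_Suc)
    have "(\<Sum>m' | m' \<le> n. affine_coeff d ?a ?b m' n * psum p \<zeta> (Xh m') N (theta z))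
      = (\<Sum>m' | m' \<le> n. affine_coeff d ?a ?b m' n *
          (\<Sum>m | m \<le> m'. affine_coeff d (dprod N (theta z)) (dseries N (theta z)) m m' * Xh m 0))
        + (\<Sum>i<N. \<Sum>m' | m' \<le> n. affine_coeff d ?a ?b m' n *
          (\<Sum>m | m \<le> m'. affine_coeff d (dprod N (theta z)) (dseries i (theta z)) m m' * defect m))"
      using n z by (subst sum.swap)
        (simp add: Suc.IH theta_Zp multi_indices_le sum_distrib_left distrib_left sum.distrib)
    also have "\<dots> = (\<Sum>m | m \<le> n. affine_coeff d (dprod (Suc N) z) (dseries (Suc N) z) m n * Xh m 0)
      + (\<Sum>i<N. \<Sum>m | m \<le> n. affine_coeff d (dprod (Suc N) z) (dseries (Suc i) z) m n * defect m)"
      unfolding affine_coeff_comp_le[OF n] A B ..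
    finally have 1: "(\<Sum>m' | m' \<le> n. rcoef d a b m' n (z 0) * psum p \<zeta> (Xh m') N (theta z)) = \<dots>"
      by (simp add: rcoef_eq)
    \<comment> \<open>The new correction is the summand \<open>i = 0\<close>: there the intercept is
      0 and only the diagonal coefficient survives.\<close>
    have "(\<Sum>m | m \<le> n. affine_coeff d (dprod (Suc N) z) (dseries 0 z) m n * defect m)
      = (\<Sum>m | m \<le> n. if m = n then digit_prod (rcoef d a b n n) (Suc N) z * defect n else 0)"
      using n by (intro sum.cong) (auto simp: affine_coeff_zero_right digit_prod_rcoef)
    also have "\<dots> = defect n * digit_prod (rcoef d a b n n) (Suc N) z"
      using finite_multi_le[OF n] by simp
    finally show ?thesis
      unfolding psum_Xh_Suc[OF n False z] 1 sum.lessThan_Suc_shift[of _ N] by simp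
  qed
qed

end

section \<open>Existence of the transforms\<close>

context unity_roots
begin

lemma fhat_cong:
  assumes "\<And>m. m < n \<Longrightarrow> h m = h' m"
  shows "fhat p d \<zeta> a b h n = fhat p d \<zeta> a b h' n"
  using assms by (auto simp: fhat_def fun_eq_iff intro!: sum.cong)

lemma ghat_cong:
  assumes "\<And>m. m < n \<Longrightarrow> h m = h' m"
  shows "ghat p d \<zeta> a b h n = ghat p d \<zeta> a b h' n"
proof -
  have "ccoef d a b h n = ccoef d a b h' n"
    using assms by (auto simp: ccoef_def fun_eq_iff intro!: sum.cong)
  then show ?thesis by (simp add: ghat_def beta_n_def)
qed

end

lemma fun_lessE:
  fixes m n :: "'a \<Rightarrow> 'b::linorder"
  assumes "m < n"
  obtains j where "m j < n j"
  using assms unfolding less_le_not_le[of m n] le_fun_def by (meson not_le)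

text \<open>The total degree is the measure for all recursions over multi-indices.\<close>

lemma multi_less_weight:
  assumes "n \<in> multi_indices d" "m < n"
  shows "(\<Sum>j=1..d. m j) < (\<Sum>j=1..d. n j)"
proof -
  have le: "m j \<le> n j" for j using le_funD[OF less_imp_le[OF assms(2)]] .
  obtain j where j: "m j < n j" using assms(2) by (rule fun_lessE)
  then have "j \<in> {1..d}" using assms(1) by (auto simp: multi_indices_def)
  then show ?thesis using le j by (intro sum_strict_mono_ex1) auto
qed

text \<open>The recursion over multi-indices with a step bound \<open>s\<close> in place of a
  termination argument. The start value is the intended one at the zero index; at \<open>n\<close>
  the value is final once \<open>s\<close> reaches the weight of \<open>n\<close>.\<close>

primrec ft_approx :: "nat \<Rightarrow> nat \<Rightarrow> (nat \<Rightarrow> 'l::field) \<Rightarrow> (nat \<Rightarrow> nat \<Rightarrow> 'l) \<Rightarrow> (nat \<Rightarrow> nat \<Rightarrow> 'l) \<Rightarrow>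
    nat \<Rightarrow> (nat \<Rightarrow> nat) \<Rightarrow> rat \<Rightarrow> 'l" where
  "ft_approx p d \<zeta> a b 0 = (\<lambda>n. one_zero)"
| "ft_approx p d \<zeta> a b (Suc s) = (\<lambda>n t. if n = (\<lambda>_. 0) then one_zero t else
      fhat p d \<zeta> a b (ft_approx p d \<zeta> a b s) n t - ghat p d \<zeta> a b (ft_approx p d \<zeta> a b s) n t)"

context unity_roots
begin

lemma ft_approx_stable:
  assumes "n \<in> multi_indices d" "(\<Sum>j=1..d. n j) \<le> s"
  shows "ft_approx p d \<zeta> a b s n = ft_approx p d \<zeta> a b (\<Sum>j=1..d. n j) n"
  using assms
proof (induction s arbitrary: n rule: less_induct)
  case (less s)
  let ?w = "\<lambda>n :: nat \<Rightarrow> nat. \<Sum>j=1..d. n j"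
  show ?case
  proof (cases "?w n")
    case 0
    then have "n = (\<lambda>_. 0)" using less.prems(1) by (auto simp: multi_indices_def fun_eq_iff)
    then show ?thesis by (cases s) (simp_all add: fun_eq_iff)
  next
    case (Suc k)
    then obtain s' where s: "s = Suc s'" "k \<le> s'" using less.prems(2) by (cases s) auto
    have 1: "ft_approx p d \<zeta> a b s' m = ft_approx p d \<zeta> a b k m" if "m < n" for m
    proof -
      have "?w m \<le> k" using multi_less_weight[OF less.prems(1) that] Suc by simp
      moreover have "m \<in> multi_indices d" using multi_indices_le[OF less.prems(1)] that by simp
      ultimately show ?thesis using less.IH[of s' m] less.IH[of k m] s Suc by (cases "k = s'") auto
    qed
    have "fhat p d \<zeta> a b (ft_approx p d \<zeta> a b s') n = fhat p d \<zeta> a b (ft_approx p d \<zeta> a b k) n"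
      using 1 by (rule fhat_cong)
    moreover have "ghat p d \<zeta> a b (ft_approx p d \<zeta> a b s') n = ghat p d \<zeta> a b (ft_approx p d \<zeta> a b k) n"
      using 1 by (rule ghat_cong)
    moreover have "n \<noteq> (\<lambda>_. 0)" using Suc by auto
    ultimately show ?thesis unfolding Suc s(1) by simp
  qed
qed

lemma transform_system_exists: "\<exists>Xh. transform_system p \<zeta> d a b Xh"
proof -
  let ?w = "\<lambda>n :: nat \<Rightarrow> nat. \<Sum>j=1..d. n j"
  define Xh where "Xh = (\<lambda>n. ft_approx p d \<zeta> a b (?w n) n)"
  have "Xh n t = fhat p d \<zeta> a b Xh n t - ghat p d \<zeta> a b Xh n t"
    if n: "n \<in> multi_indices d" "n \<noteq> (\<lambda>_. 0)" for n t
  proof -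
    have "?w n \<noteq> 0"
    proof
      assume "?w n = 0"
      then have "n = (\<lambda>_. 0)" using n(1) by (auto simp: multi_indices_def fun_eq_iff)
      then show False using n(2) by simp
    qed
    then obtain k where k: "?w n = Suc k" using not0_implies_Suc by blast
    have 1: "ft_approx p d \<zeta> a b k m = Xh m" if "m < n" for m
      using ft_approx_stable[of m d k a b] multi_less_weight[OF n(1) that] multi_indices_le[OF n(1)] that k
      by (simp add: Xh_def)
    have "fhat p d \<zeta> a b (ft_approx p d \<zeta> a b k) n = fhat p d \<zeta> a b Xh n"
      using 1 by (rule fhat_cong)
    moreover have "ghat p d \<zeta> a b (ft_approx p d \<zeta> a b k) n = ghat p d \<zeta> a b Xh n"
      using 1 by (rule ghat_cong)
    moreover have "Xh n = ft_approx p d \<zeta> a b (Suc k) n" by (simp only: Xh_def k)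
    ultimately show ?thesis using n by simp
  qed
  moreover have "Xh (\<lambda>_. 0) t = one_zero t" for t by (simp add: Xh_def)
  ultimately have "transform_system p \<zeta> d a b Xh" by unfold_locales auto
  then show ?thesis by (rule exI[of _ Xh])
qed

end

section \<open>Subfields that contain the coefficients\<close>

definition subfield_set :: "'l::field set \<Rightarrow> bool" where
  "subfield_set K \<longleftrightarrow> 0 \<in> K \<and> 1 \<in> K \<and>
     (\<forall>x\<in>K. \<forall>y\<in>K. x + y \<in> K \<and> x * y \<in> K) \<and> (\<forall>x\<in>K. - x \<in> K \<and> inverse x \<in> K)"

lemma subfield_setD:
  assumes "subfield_set K"
  shows "0 \<in> K" "1 \<in> K" "x \<in> K \<Longrightarrow> y \<in> K \<Longrightarrow> x + y \<in> K" "x \<in> K \<Longrightarrow> y \<in> K \<Longrightarrow> x * y \<in> K"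
    "x \<in> K \<Longrightarrow> - x \<in> K" "x \<in> K \<Longrightarrow> inverse x \<in> K"
    "x \<in> K \<Longrightarrow> y \<in> K \<Longrightarrow> x - y \<in> K" "x \<in> K \<Longrightarrow> y \<in> K \<Longrightarrow> x / y \<in> K"
  using assms unfolding subfield_set_def diff_conv_add_uminus[of x y] divide_inverse by blast+

lemma subfield_set_sum:
  assumes "subfield_set K" "\<And>i. i \<in> I \<Longrightarrow> f i \<in> K"
  shows "sum f I \<in> K"
  using assms(2) by (induction I rule: infinite_finite_induct) (auto simp: subfield_setD[OF assms(1)])

lemma subfield_set_prod:
  assumes "subfield_set K" "\<And>i. i \<in> I \<Longrightarrow> f i \<in> K"
  shows "prod f I \<in> K"
  using assms(2) by (induction I rule: infinite_finite_induct) (auto simp: subfield_setD[OF assms(1)])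

lemma subfield_set_power: "subfield_set K \<Longrightarrow> x \<in> K \<Longrightarrow> x ^ n \<in> K"
  by (induction n) (auto simp: subfield_setD)

lemma subfield_set_of_nat: "subfield_set K \<Longrightarrow> of_nat n \<in> K"
  by (induction n) (auto simp: subfield_setD)

lemma prod_unit_index:
  fixes x :: "nat \<Rightarrow> 'a::comm_monoid_mult"
  assumes "j \<in> {1..d}"
  shows "(\<Prod>i=1..d. x i ^ unit_index j i) = x j"
proof -
  have "(\<Prod>i=1..d. x i ^ unit_index j i) = (\<Prod>i=1..d. if i = j then x j else 1)"
    by (intro prod.cong) (auto simp: unit_index_def)
  then show ?thesis using assms by simp
qed

context transform_system
begin

lemma lvl_hmul_power:
  assumes "t \<in> hatZ p"
  shows "hmul (p ^ k) t \<in> hatZ p \<and> lvl p (hmul (p ^ k) t) = lvl p t - k"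
proof (induction k)
  case 0
  then show ?case using assms by (simp add: hmul_1)
next
  case (Suc k)
  then show ?case using lvl_hmul[of "hmul (p ^ k) t" p] hmul_hatZ[of "hmul (p ^ k) t" p]
    by (simp add: hmul_hmul)
qed

text \<open>Only the zero index lies below \<open>unit_index j\<close>, and its transform is
  supported at 0, where \<open>fhat\<close> never evaluates it. So only \<open>ghat\<close>
  remains.\<close>

lemma Xh_unit:
  assumes j: "j \<in> {1..d}" and t: "t \<in> hatZ p"
  shows "Xh (unit_index j) t = affine_ft p (digit_ft p \<zeta> (a j)) (digit_ft p \<zeta> (b j)) t"
proof -
  let ?u = "unit_index j"
  have "m = (\<lambda>_. 0)" if m: "m < ?u" for m
  proof (rule ext)
    fix i
    have le: "m i \<le> ?u i" for i using le_funD[OF less_imp_le[OF that]] .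
    obtain k where "m k < ?u k" using m by (rule fun_lessE)
    then have "m j = 0" by (auto simp: unit_index_def split: if_splits)
    then show "m i = 0" using le[of i] by (cases "i = j") (auto simp: unit_index_def)
  qed
  moreover have "(\<lambda>_. 0) < ?u"
    unfolding less_le_not_le[of "\<lambda>_. 0" ?u] le_fun_def by (auto simp: unit_index_def)
  ultimately have less: "{m. m < ?u} = {\<lambda>_. 0}" by blast
  note prod = prod_unit_index[OF j, unfolded One_nat_def]
  have nz: "?u \<noteq> (\<lambda>_. 0)" by (auto simp: unit_index_def fun_eq_iff)
  have \<alpha>: "alpha_mn p d \<zeta> a b ?u ?u = digit_ft p \<zeta> (a j)"
    by (simp add: alpha_mn_def rcoef_eq[abs_def] affine_coeff_diag prod)
  have \<beta>: "beta_n p d \<zeta> a b Xh ?u = (\<lambda>t. - digit_ft p \<zeta> (b j) t)"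
    by (simp add: beta_n_def digit_ft_def ccoef_def[abs_def] less rcoef_eq affine_coeff_0 prod Xh_0
        one_zero_def sum_negf fun_eq_iff)
  have "Xh (\<lambda>_. 0) (hmul (p ^ (i + 1)) t) = 0" if "i < lvl p t - 1" for i
  proof -
    have "hmul (p ^ (i + 1)) t \<in> hatZ p" "lvl p (hmul (p ^ (i + 1)) t) \<noteq> 0"
      using lvl_hmul_power[OF t, of "i + 1"] that by auto
    then show ?thesis by (simp add: Xh_0 one_zero_def lvl_eq_0_iff)
  qed
  then have "fhat p d \<zeta> a b Xh ?u t = 0" by (simp add: fhat_def less)
  then show ?thesis
    using Xh_rec[OF unit_index_multi[OF j] nz t] by (simp add: ghat_def \<alpha> \<beta> affine_ft_uminus)
qed

text \<open>The transforms themselves involve roots of unity, but the closed formula for the partial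
  sums uses only their values at 0 and the coefficients.\<close>

lemma psum_Xh_in_subfield:
  assumes K: "subfield_set K"
    and a: "\<And>j k. j \<in> {1..d} \<Longrightarrow> k < p \<Longrightarrow> a j k \<in> K"
    and b: "\<And>j k. j \<in> {1..d} \<Longrightarrow> k < p \<Longrightarrow> b j k \<in> K"
    and n: "n \<in> multi_indices d" and z: "z \<in> Zp p"
  shows "psum p \<zeta> (Xh n) N z \<in> K"
proof -
  note K' = subfield_setD[OF K] subfield_set_sum[OF K] subfield_set_prod[OF K] subfield_set_power[OF K]
    subfield_set_of_nat[OF K]
  \<comment> \<open>At \<open>t = 0\<close> every exponential is \<open>\<zeta> 0 ^ 0\<close>, so
    these are plain averages of coefficients.\<close>
  have \<alpha>: "alpha_mn p d \<zeta> a b m n 0 \<in> K" for m n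
    unfolding alpha_mn_def digit_ft_def rcoef_def cexp_def
    by (auto intro!: K' a b)
  have *: "Xh n 0 \<in> K" if "n \<in> multi_indices d" for n
    using that
  proof (induction "\<Sum>j=1..d. n j" arbitrary: n rule: less_induct)
    case less
    have "beta_n p d \<zeta> a b Xh n 0 \<in> K"
      unfolding beta_n_eq
    proof (intro K'(5) K'(4) K'(9) \<alpha>)
      fix m assume "m \<in> {m. m < n}"
      then show "Xh m 0 \<in> K"
        using less.hyps[of m] multi_less_weight[OF less.prems] multi_indices_le[OF less.prems, of m]
        by (simp add: less_imp_le)
    qed
    then have g: "ghat p d \<zeta> a b Xh n 0 \<in> K"
      using \<alpha>[of n n] by (simp add: ghat_def affine_ft_def K')
    show ?case
    proof (cases "n = (\<lambda>_. 0)")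
      case True
      then show ?thesis by (simp add: Xh_0 one_zero_def K')
    next
      case False
      then show ?thesis using g Xh_rec[OF less.prems False, of 0] by (simp add: fhat_def K')
    qed
  qed
  have \<delta>: "defect m \<in> K" if "m \<in> multi_indices d" for m
  proof -
    have "beta_n p d \<zeta> a b Xh m 0 \<in> K"
      unfolding beta_n_eq
      by (intro K'(5) K'(4) K'(9) \<alpha> *) (use multi_indices_le[OF that] in \<open>auto simp: less_imp_le\<close>)
    then show ?thesis by (simp add: defect_def K')
  qed
  have zp: "z i < p" for i using z by (simp add: Zp_def)
  have A: "dprod i z j \<in> K" "dseries i z j \<in> K" if "j \<in> {1..d}" for i j
    using that zp by (auto simp: digit_prod_def digit_series_def intro!: K' a b)
  show ?thesis
    unfolding psum_Xh[OF n z] affine_coeff_def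
    using multi_indices_le[OF n] by (intro K'(3,4,9-) * \<delta> A) auto
qed

end

section \<open>Convergence of the Fourier series\<close>

locale field_abs =
  fixes w :: "'l::field \<Rightarrow> real"
  assumes absolute_value: "absolute_value ring_of_type_algebra w"
begin

lemma nonneg: "0 \<le> w x" and eq_0_iff: "w x = 0 \<longleftrightarrow> x = 0" and one: "w 1 = 1"
  and mult: "w (x * y) = w x * w y" and triangle: "w (x + y) \<le> w x + w y"
  using absolute_value by (auto simp: absolute_value_def ring_of_type_algebra_def)

lemma zero: "w 0 = 0"
  by (simp add: eq_0_iff)

lemma minus: "w (- x) = w x"
proof -
  have "w (- 1) * w (- 1) = 1" by (simp flip: mult add: one)
  then have "w (- 1) = 1" using nonneg[of "- 1"] by (simp add: square_eq_1_iff)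
  then show ?thesis using mult[of "- 1" x] by simp
qed

lemma diff_commute: "w (x - y) = w (y - x)"
  using minus[of "x - y"] by simp

lemma triangle_diff: "w (x - z) \<le> w (x - y) + w (y - z)"
  using triangle[of "x - y" "y - z"] by simp

lemma abs_diff_le: "\<bar>w x - w y\<bar> \<le> w (x - y)"
  using triangle[of "x - y" y] triangle[of "y - x" x] diff_commute[of x y] by simp

lemma power: "w (x ^ n) = w x ^ n"
  by (induction n) (simp_all add: one mult)

lemma sum_le: "w (sum f I) \<le> (\<Sum>i\<in>I. w (f i))"
  by (induction I rule: infinite_finite_induct) (auto simp: zero intro: order_trans[OF triangle] add_left_mono)

lemma prod: "w (prod f I) = (\<Prod>i\<in>I. w (f i))"
  by (induction I rule: infinite_finite_induct) (auto simp: one mult)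

end

context transform_system
begin

text \<open>The main terms are O(r^N). The corrections are N sums of that size, and N r^N still
  tends to 0.\<close>

lemma psum_Xh_tendsto:
  assumes w: "absolute_value ring_of_type_algebra w"
    and n: "n \<in> multi_indices d" and z: "z \<in> Zp p" and r: "0 \<le> r" "r < 1" and C: "1 \<le> C"
    and A: "\<And>j N. j \<in> {1..d} \<Longrightarrow> w (dprod N z j) \<le> C * r ^ N"
    and B: "\<And>j N. j \<in> {1..d} \<Longrightarrow> w (dseries N z j) \<le> C"
  shows "(\<lambda>N. w (psum p \<zeta> (Xh n) N z - (\<Prod>j=1..d. dseries N z j ^ n j))) \<longlonglongrightarrow> 0"
proof -
  interpret w: field_abs w by unfold_locales (rule w)
  define M where "M = {m. m \<le> n \<and> m \<noteq> (\<lambda>_. 0)}"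
  have "{m. m \<le> n} = insert (\<lambda>_. 0) M" by (auto simp: M_def le_fun_def)
  moreover have fin: "finite M" using finite_multi_le[OF n] by (simp add: M_def)
  ultimately have split: "(\<Sum>m | m \<le> n. f m) = f (\<lambda>_. 0) + (\<Sum>m\<in>M. f m)" for f :: "_ \<Rightarrow> 'l"
    by (simp add: M_def)
  \<comment> \<open>Hence the corrections contribute no term free of the slope A_N.\<close>
  have d0: "defect (\<lambda>_. 0) = 0" by (simp add: defect_def)
  define c where "c m = (\<Prod>j=1..d. w (of_nat (n j choose m j)) * C ^ m j * C ^ (n j - m j))" for m
  have c0: "0 \<le> c m" for m using C w.nonneg by (auto simp: c_def intro!: prod_nonneg mult_nonneg_nonneg)
  have bound: "w (affine_coeff d (dprod N z) (dseries i z) m n) \<le> c m * r ^ N" if m: "m \<in> M" for m N i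
  proof -
    have rN: "0 \<le> r ^ N" "r ^ N \<le> 1" using r by (auto simp: power_le_one)
    have "m \<in> multi_indices d" using m multi_indices_le[OF n] by (simp add: M_def)
    moreover obtain j where "m j \<noteq> 0" using m by (auto simp: M_def fun_eq_iff)
    ultimately have "j \<in> {1..d}" "m j \<noteq> 0" by (auto simp: multi_indices_def)
    then have "0 < (\<Sum>j=1..d. m j)"
      using member_le_sum[of j "{1..d}" m] by simp
    \<comment> \<open>As \<open>r ^ N \<le> 1\<close>, higher powers only help; one factor suffices
      for a bound uniform in \<open>m\<close>.\<close>
    then have "(r ^ N) ^ (\<Sum>j=1..d. m j) \<le> r ^ N"
      using rN power_decreasing[of 1 "\<Sum>j=1..d. m j" "r ^ N"] by simp
    then have e: "(\<Prod>j=1..d. (r ^ N) ^ m j) \<le> r ^ N" by (simp only: power_sum)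
    have "w (affine_coeff d (dprod N z) (dseries i z) m n)
      = (\<Prod>j=1..d. w (of_nat (n j choose m j)) * w (dprod N z j) ^ m j * w (dseries i z j) ^ (n j - m j))"
      unfolding affine_coeff_def w.prod w.mult w.power ..
    also have "\<dots> \<le> (\<Prod>j=1..d. w (of_nat (n j choose m j)) * (C * r ^ N) ^ m j * C ^ (n j - m j))"
      using A B C rN by (intro prod_mono conjI mult_mono power_mono mult_nonneg_nonneg) (auto simp: w.nonneg)
    also have "\<dots> = c m * (\<Prod>j=1..d. (r ^ N) ^ m j)"
      unfolding c_def prod.distrib[symmetric] power_mult_distrib by (intro prod.cong) (auto simp: mult_ac)
    also have "\<dots> \<le> c m * r ^ N" using e c0 by (intro mult_left_mono) auto
    finally show ?thesis .
  qed
  define c1 where "c1 = (\<Sum>m\<in>M. c m * w (Xh m 0))"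
  define c2 where "c2 = (\<Sum>m\<in>M. c m * w (defect m))"
  have le: "w (psum p \<zeta> (Xh n) N z - (\<Prod>j=1..d. dseries N z j ^ n j)) \<le> c1 * r ^ N + c2 * (of_nat N * r ^ N)" for N
  proof -
    have s: "w (\<Sum>m\<in>M. affine_coeff d (dprod N z) (dseries i z) m n * y m) \<le> (\<Sum>m\<in>M. c m * w (y m)) * r ^ N" for y i
    proof -
      have "w (\<Sum>m\<in>M. affine_coeff d (dprod N z) (dseries i z) m n * y m)
        \<le> (\<Sum>m\<in>M. w (affine_coeff d (dprod N z) (dseries i z) m n) * w (y m))"
        using w.sum_le by (simp flip: w.mult)
      also have "\<dots> \<le> (\<Sum>m\<in>M. c m * r ^ N * w (y m))"
        using bound by (intro sum_mono mult_right_mono) (auto simp: w.nonneg)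
      finally show ?thesis by (simp add: sum_distrib_left mult_ac)
    qed
    have e: "psum p \<zeta> (Xh n) N z - (\<Prod>j=1..d. dseries N z j ^ n j)
      = (\<Sum>m\<in>M. affine_coeff d (dprod N z) (dseries N z) m n * Xh m 0)
        + (\<Sum>i<N. \<Sum>m\<in>M. affine_coeff d (dprod N z) (dseries i z) m n * defect m)"
      unfolding psum_Xh[OF n z] split d0 by (simp add: affine_coeff_0 Xh_0 one_zero_def)
    have "w (psum p \<zeta> (Xh n) N z - (\<Prod>j=1..d. dseries N z j ^ n j)) \<le> c1 * r ^ N + (\<Sum>i<N. c2 * r ^ N)"
      unfolding c1_def c2_def e
      by (rule order_trans[OF w.triangle add_mono[OF s order_trans[OF w.sum_le sum_mono[OF s]]]])
    moreover have "(\<Sum>i<N. c2 * r ^ N) = c2 * (of_nat N * r ^ N)" by simp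
    ultimately show ?thesis by (simp only:)
  qed
  have "(\<lambda>N. c1 * r ^ N + c2 * (of_nat N * r ^ N)) \<longlonglongrightarrow> c1 * 0 + c2 * 0"
    using r by (intro tendsto_intros LIMSEQ_power_zero powser_times_n_limit_0) auto
  then have lim: "(\<lambda>N. c1 * r ^ N + c2 * (of_nat N * r ^ N)) \<longlonglongrightarrow> 0" by simp
  show ?thesis
    by (rule tendsto_sandwich[OF always_eventually always_eventually tendsto_const lim]) (use le w.nonneg in auto)
qed

end

section \<open>Distributions\<close>

text \<open>The uniform form of \<open>loc_const\<close>, and the predicate whose least solution
  \<open>integral_dist\<close> takes.\<close>

definition const_mod :: "nat \<Rightarrow> nat \<Rightarrow> ((nat \<Rightarrow> nat) \<Rightarrow> 'l) \<Rightarrow> bool" where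
  "const_mod p N \<phi> \<longleftrightarrow> (\<forall>z\<in>Zp p. \<forall>w\<in>Zp p. trunc p N w = trunc p N z \<longrightarrow> \<phi> w = \<phi> z)"

definition residue_ind :: "nat \<Rightarrow> nat \<Rightarrow> nat \<Rightarrow> (nat \<Rightarrow> nat) \<Rightarrow> 'l::field" where
  "residue_ind p N k = (\<lambda>z\<in>Zp p. if trunc p N z = k then 1 else 0)"

lemma const_mod_mono: "const_mod p N \<phi> \<Longrightarrow> N \<le> M \<Longrightarrow> const_mod p M \<phi>"
  unfolding const_mod_def by (metis trunc_mod)

lemma const_mod_residue_ind: "const_mod p N (residue_ind p N k)"
  by (simp add: const_mod_def residue_ind_def)

lemma const_mod_restrict:
  assumes "const_mod p N \<phi>" "const_mod p N \<psi>"
  shows "const_mod p N (\<lambda>z\<in>Zp p. f (\<phi> z) (\<psi> z))"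
  unfolding const_mod_def
proof (intro ballI impI)
  fix z w assume zw: "z \<in> Zp p" "w \<in> Zp p" "trunc p N w = trunc p N z"
  then have "\<phi> w = \<phi> z" "\<psi> w = \<psi> z" using assms unfolding const_mod_def by blast+
  then show "(\<lambda>z\<in>Zp p. f (\<phi> z) (\<psi> z)) w = (\<lambda>z\<in>Zp p. f (\<phi> z) (\<psi> z)) z" using zw by simp
qed

lemma const_mod_loc_const: "const_mod p N \<phi> \<Longrightarrow> loc_const p \<phi>"
  unfolding const_mod_def loc_const_def by blast

text \<open>Compactness of \<open>\<int>\<^sub>p\<close>, by Koenig's argument.\<close>

lemma loc_const_uniform:
  assumes p: "0 < p" and \<phi>: "loc_const p \<phi>"
  shows "\<exists>N. const_mod p N \<phi>"
proof (rule ccontr)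
  assume no: "\<nexists>N. const_mod p N \<phi>"
  \<comment> \<open>\<open>bad n u\<close>: on the ball of points that share the first
    \<open>n\<close> digits of \<open>u\<close>, no single level \<open>N\<close> works for
    \<phi>.\<close>
  define bad where "bad n u \<longleftrightarrow> u \<in> Zp p \<and> (\<forall>N. \<exists>v\<in>Zp p. \<exists>w\<in>Zp p. (\<forall>i<n. v i = u i) \<and> (\<forall>i<n. w i = u i) \<and>
      (\<forall>i<N. v i = w i) \<and> \<phi> v \<noteq> \<phi> w)" for n u
  have "\<exists>f. \<forall>n. bad n (f n) \<and> (\<forall>i<n. f (Suc n) i = f n i)"
  proof (rule dependent_nat_choice)
    have "bad 0 (\<lambda>_. 0)"
      unfolding bad_def
    proof (intro conjI allI)
      fix N
      obtain v w where "v \<in> Zp p" "w \<in> Zp p" "trunc p N w = trunc p N v" "\<phi> w \<noteq> \<phi> v"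
        using no unfolding const_mod_def by blast
      then show "\<exists>v\<in>Zp p. \<exists>w\<in>Zp p. (\<forall>i<0. v i = 0) \<and> (\<forall>i<0. w i = 0) \<and> (\<forall>i<N. v i = w i) \<and> \<phi> v \<noteq> \<phi> w"
        using trunc_eq_iff[of w p v N] by auto
    qed (use p in \<open>simp add: Zp_def\<close>)
    then show "\<exists>u. bad 0 u" by (rule exI[of _ "\<lambda>_. 0"])
  next
    fix u n assume u: "bad n u"
    show "\<exists>u'. bad (Suc n) u' \<and> (\<forall>i<n. u' i = u i)"
    proof (rule ccontr)
      assume no': "\<not> ?thesis"
      have ex: "\<exists>N. \<forall>v\<in>Zp p. \<forall>w\<in>Zp p. (\<forall>i<n. v i = u i) \<and> v n = k \<and> (\<forall>i<n. w i = u i) \<and> w n = k \<and>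
        (\<forall>i<N. v i = w i) \<longrightarrow> \<phi> v = \<phi> w" if k: "k < p" for k
      proof -
        have "u \<in> Zp p" using u unfolding bad_def by blast
        then have "u(n := k) \<in> Zp p" using k by (simp add: Zp_def)
        moreover have "\<forall>i<n. (u(n := k)) i = u i" by simp
        then have "\<not> bad (Suc n) (u(n := k))" using no' by blast
        ultimately obtain N where N: "\<And>v w. v \<in> Zp p \<Longrightarrow> w \<in> Zp p \<Longrightarrow> \<forall>i<Suc n. v i = (u(n := k)) i \<Longrightarrow>
            \<forall>i<Suc n. w i = (u(n := k)) i \<Longrightarrow> \<forall>i<N. v i = w i \<Longrightarrow> \<phi> v = \<phi> w"
          unfolding bad_def by blast
        show ?thesis
        proof (intro exI ballI impI)
          fix v w assume "v \<in> Zp p" "w \<in> Zp p"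
            "(\<forall>i<n. v i = u i) \<and> v n = k \<and> (\<forall>i<n. w i = u i) \<and> w n = k \<and> (\<forall>i<N. v i = w i)"
          then show "\<phi> v = \<phi> w" using N[of v w] by (simp add: less_Suc_eq)
        qed
      qed
      define N where "N k = (SOME N. \<forall>v\<in>Zp p. \<forall>w\<in>Zp p. (\<forall>i<n. v i = u i) \<and> v n = k \<and> (\<forall>i<n. w i = u i) \<and> w n = k \<and>
        (\<forall>i<N. v i = w i) \<longrightarrow> \<phi> v = \<phi> w)" for k
      have N: "\<forall>v\<in>Zp p. \<forall>w\<in>Zp p. (\<forall>i<n. v i = u i) \<and> v n = k \<and> (\<forall>i<n. w i = u i) \<and> w n = k \<and>
        (\<forall>i<N k. v i = w i) \<longrightarrow> \<phi> v = \<phi> w" if "k < p" for k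
        unfolding N_def by (rule someI_ex[OF ex[OF that]])
      \<comment> \<open>Large enough for each of the \<open>p\<close> subballs, while
        \<open>Suc n\<close> forces \<open>v\<close> and \<open>w\<close> into the same one.\<close>
      define M where "M = Suc n + (\<Sum>k<p. N k)"
      obtain v w where vw: "v \<in> Zp p" "w \<in> Zp p" "\<forall>i<n. v i = u i" "\<forall>i<n. w i = u i" "\<forall>i<M. v i = w i" "\<phi> v \<noteq> \<phi> w"
        using u unfolding bad_def by blast
      have vn: "v n < p" "w n = v n" using vw by (auto simp: Zp_def M_def)
      have "N (v n) \<le> (\<Sum>k<p. N k)" using vn by (intro member_le_sum) auto
      then have "\<forall>i<N (v n). v i = w i" using vw(5) by (auto simp: M_def)
      then show False using N[OF vn(1)] vw vn(2) by blast
    qed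
  qed
  then obtain f where f: "\<And>n. bad n (f n)" "\<And>n i. i < n \<Longrightarrow> f (Suc n) i = f n i" by blast
  \<comment> \<open>The diagonal point; it shares the first \<open>n\<close> digits with
    \<open>f n\<close> for every \<open>n\<close>.\<close>
  define z where "z = (\<lambda>i. f (Suc i) i)"
  have fz: "f n i = z i" if "i < n" for n i
    using that by (induction n) (auto simp: less_Suc_eq f(2) z_def)
  have "f n \<in> Zp p" for n using f(1)[of n] unfolding bad_def by blast
  then have "z \<in> Zp p" by (simp add: z_def Zp_def)
  then obtain N where N: "\<And>w. w \<in> Zp p \<Longrightarrow> trunc p N w = trunc p N z \<Longrightarrow> \<phi> w = \<phi> z"
    using \<phi> unfolding loc_const_def by blast
  \<comment> \<open>Around \<open>z\<close> the function is constant on some ball, but badness of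
    \<open>f N\<close> gives two points of that ball with different values.\<close>
  have "\<phi> w = \<phi> z" if "w \<in> Zp p" "\<forall>i<N. w i = f N i" for w
    using that N[of w] \<open>z \<in> Zp p\<close> by (simp add: trunc_eq_iff fz)
  moreover obtain v w where "v \<in> Zp p" "w \<in> Zp p" "\<forall>i<N. v i = f N i" "\<forall>i<N. w i = f N i" "\<phi> v \<noteq> \<phi> w"
    using f(1)[of N] unfolding bad_def by blast
  ultimately show False by simp
qed

lemma schwartz_iff:
  assumes "0 < p"
  shows "\<phi> \<in> schwartz p K \<longleftrightarrow> \<phi> \<in> Zp p \<rightarrow>\<^sub>E K \<and> (\<exists>N. const_mod p N \<phi>)"
  using loc_const_uniform[OF assms] const_mod_loc_const unfolding schwartz_def by blast

lemma schwartz_range: "\<phi> \<in> schwartz p K \<Longrightarrow> z \<in> Zp p \<Longrightarrow> \<phi> z \<in> K"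
  by (auto simp: schwartz_def)

text \<open>\<open>m\<close> is a consistent system of masses of residue classes. It is applied to
  the masses of a given distribution and to those from which one is constructed.\<close>

lemma sum_const_mod:
  fixes m :: "nat \<Rightarrow> nat \<Rightarrow> 'l::comm_ring_1"
  assumes p: "0 < p" and m: "\<And>N k. k < p ^ N \<Longrightarrow> m N k = (\<Sum>j<p. m (Suc N) (k + p ^ N * j))"
    and \<phi>: "const_mod p N \<phi>" and "N \<le> M"
  shows "(\<Sum>k<p ^ N. \<phi> (digits p k) * m N k) = (\<Sum>k<p ^ M. \<phi> (digits p k) * m M k)"
  using \<open>N \<le> M\<close>
proof (induction M rule: dec_induct)
  case (step M)
  have "(\<Sum>k<p ^ Suc M. \<phi> (digits p k) * m (Suc M) k)
    = (\<Sum>k<p ^ M. \<Sum>j<p. \<phi> (digits p (k + p ^ M * j)) * m (Suc M) (k + p ^ M * j))"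
    by (simp only: power_Suc2 sum_lessThan_mult)
  also have "\<dots> = (\<Sum>k<p ^ M. \<Sum>j<p. \<phi> (digits p k) * m (Suc M) (k + p ^ M * j))"
  proof (intro sum.cong refl arg_cong2[where f = "(*)"])
    fix k j assume "k \<in> {..<p ^ M}"
    have "const_mod p M \<phi>" using const_mod_mono[OF \<phi>] step by simp
    then show "\<phi> (digits p (k + p ^ M * j)) = \<phi> (digits p k)"
      unfolding const_mod_def using digits_Zp[OF p] by (auto simp: trunc_digits)
  qed
  also have "\<dots> = (\<Sum>k<p ^ M. \<phi> (digits p k) * m M k)"
    unfolding sum_distrib_left[symmetric] by (intro sum.cong refl) (simp only: m lessThan_iff)
  finally show ?case using step by simp
qed simp

text \<open>\<open>K\<close> holds the values of test functions and distributions, whereas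
  characters and transforms take values in the surrounding field \<open>'l\<close>.\<close>

locale distribution_setting = unity_roots p \<zeta> for p :: nat and \<zeta> :: "nat \<Rightarrow> 'l::field" +
  fixes K :: "'l set"
  assumes subfield_K: "subfield_set K"
begin

lemmas K_closed = subfield_setD[OF subfield_K] subfield_set_sum[OF subfield_K]
  subfield_set_power[OF subfield_K] subfield_set_of_nat[OF subfield_K]

lemma residue_ind_schwartz: "residue_ind p N k \<in> schwartz p K"
  using const_mod_residue_ind unfolding schwartz_iff[OF p_pos]
  by (auto simp: residue_ind_def K_closed)

lemma schwartz_add:
  assumes "\<phi> \<in> schwartz p K" "\<psi> \<in> schwartz p K"
  shows "(\<lambda>z\<in>Zp p. \<phi> z + \<psi> z) \<in> schwartz p K"
proof -
  obtain N M where "const_mod p N \<phi>" "const_mod p M \<psi>" using assms by (auto simp: schwartz_iff[OF p_pos])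
  then have "const_mod p (max N M) \<phi>" "const_mod p (max N M) \<psi>" by (auto elim: const_mod_mono)
  then have "const_mod p (max N M) (\<lambda>z\<in>Zp p. \<phi> z + \<psi> z)" by (rule const_mod_restrict)
  moreover have "\<forall>z\<in>Zp p. \<phi> z + \<psi> z \<in> K"
    using assms schwartz_range by (blast intro: K_closed)
  ultimately show ?thesis unfolding schwartz_iff[OF p_pos] by (auto simp: PiE_iff)
qed

lemma schwartz_scale:
  assumes "\<phi> \<in> schwartz p K" "c \<in> K"
  shows "(\<lambda>z\<in>Zp p. c * \<phi> z) \<in> schwartz p K"
proof -
  obtain N where "const_mod p N \<phi>" using assms by (auto simp: schwartz_iff[OF p_pos])
  then have "const_mod p N (\<lambda>z\<in>Zp p. c * \<phi> z)"
    using const_mod_restrict[of p N \<phi> \<phi> "\<lambda>x _. c * x"] by simp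
  moreover have "\<forall>z\<in>Zp p. c * \<phi> z \<in> K"
    using assms schwartz_range by (blast intro: K_closed)
  ultimately show ?thesis unfolding schwartz_iff[OF p_pos] by (auto simp: PiE_iff)
qed

lemma distribution_sum:
  assumes \<mu>: "\<mu> \<in> distributions p K" and "finite I"
    and "\<And>i. i \<in> I \<Longrightarrow> f i \<in> schwartz p K" "\<And>i. i \<in> I \<Longrightarrow> c i \<in> K"
  shows "(\<lambda>z\<in>Zp p. \<Sum>i\<in>I. c i * f i z) \<in> schwartz p K \<and>
    \<mu> (\<lambda>z\<in>Zp p. \<Sum>i\<in>I. c i * f i z) = (\<Sum>i\<in>I. c i * \<mu> (f i))"
  using assms(2-4)
proof (induction I rule: finite_induct)
  case empty
  \<comment> \<open>The zero function is written as 0 times an indicator, so that homogeneity gives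
    its integral.\<close>
  have "(\<lambda>z\<in>Zp p. 0 * residue_ind p 0 0 z) \<in> schwartz p K"
    by (intro schwartz_scale residue_ind_schwartz K_closed)
  moreover have "\<mu> (\<lambda>z\<in>Zp p. 0 * residue_ind p 0 0 z) = 0 * \<mu> (residue_ind p 0 0)"
    using \<mu> residue_ind_schwartz K_closed(1) unfolding distributions_def by blast
  ultimately show ?case by (simp only: sum.empty mult_zero_left)
next
  case (insert i I)
  let ?F = "\<lambda>z\<in>Zp p. \<Sum>i\<in>I. c i * f i z" and ?G = "\<lambda>z\<in>Zp p. c i * f i z"
  have F: "?F \<in> schwartz p K" "\<mu> ?F = (\<Sum>i\<in>I. c i * \<mu> (f i))"
    using insert.IH insert.prems by blast+
  have G: "?G \<in> schwartz p K" using insert.prems by (intro schwartz_scale) auto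
  have G': "\<mu> ?G = c i * \<mu> (f i)" using \<mu> insert.prems unfolding distributions_def by blast
  have e: "(\<lambda>z\<in>Zp p. \<Sum>i\<in>insert i I. c i * f i z) = (\<lambda>z\<in>Zp p. ?G z + ?F z)"
    using insert.hyps by (auto simp: fun_eq_iff)
  have "\<mu> (\<lambda>z\<in>Zp p. \<Sum>i\<in>insert i I. c i * f i z) = \<mu> ?G + \<mu> ?F"
    unfolding e using \<mu> F(1) G unfolding distributions_def by blast
  also have "\<dots> = (\<Sum>i\<in>insert i I. c i * \<mu> (f i))"
    unfolding F(2) G' sum.insert[OF insert.hyps] ..
  finally have "\<mu> (\<lambda>z\<in>Zp p. \<Sum>i\<in>insert i I. c i * f i z) = \<dots>" .
  moreover have "(\<lambda>z\<in>Zp p. \<Sum>i\<in>insert i I. c i * f i z) \<in> schwartz p K"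
    unfolding e by (rule schwartz_add[OF G F(1)])
  ultimately show ?case by (rule conjI[rotated])
qed

lemma distribution_eq_sum:
  assumes \<mu>: "\<mu> \<in> distributions p K" and \<phi>: "\<phi> \<in> schwartz p K" "const_mod p N \<phi>"
  shows "\<mu> \<phi> = (\<Sum>k<p ^ N. \<phi> (digits p k) * \<mu> (residue_ind p N k))"
proof -
  have "\<phi> = (\<lambda>z\<in>Zp p. \<Sum>k<p ^ N. \<phi> (digits p k) * residue_ind p N k z)"
  proof (rule ext)
    fix z
    show "\<phi> z = (\<lambda>z\<in>Zp p. \<Sum>k<p ^ N. \<phi> (digits p k) * residue_ind p N k z) z"
    proof (cases "z \<in> Zp p")
      case True
      have less: "trunc p N z < p ^ N" using True by (rule trunc_less)
      then have "trunc p N (digits p (trunc p N z)) = trunc p N z" by (simp add: trunc_digits)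
      then have e: "\<phi> (digits p (trunc p N z)) = \<phi> z"
        using \<phi>(2) True Zp_digits unfolding const_mod_def by blast
      have "(\<Sum>k<p ^ N. \<phi> (digits p k) * residue_ind p N k z)
        = (\<Sum>k<p ^ N. if k = trunc p N z then \<phi> z else 0)"
        using True e by (intro sum.cong) (auto simp: residue_ind_def)
      then show ?thesis using True less by simp
    next
      case False
      then show ?thesis using \<phi>(1) by (auto simp: schwartz_def PiE_iff extensional_def)
    qed
  qed
  moreover have "\<mu> (\<lambda>z\<in>Zp p. \<Sum>k<p ^ N. \<phi> (digits p k) * residue_ind p N k z)
      = (\<Sum>k<p ^ N. \<phi> (digits p k) * \<mu> (residue_ind p N k))"
    using distribution_sum[OF \<mu>, of "{..<p ^ N}" "residue_ind p N" "\<lambda>k. \<phi> (digits p k)"]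
      residue_ind_schwartz schwartz_range[OF \<phi>(1) Zp_digits] by simp
  ultimately show ?thesis by simp
qed

text \<open>An indicator of a class mod \<open>p ^ N\<close> is also constant mod
  \<open>p ^ Suc N\<close>, hence a sum of finer indicators.\<close>

lemma distribution_refine:
  assumes \<mu>: "\<mu> \<in> distributions p K" and k: "k < p ^ N"
  shows "\<mu> (residue_ind p N k) = (\<Sum>j<p. \<mu> (residue_ind p (Suc N) (k + p ^ N * j)))"
proof -
  have "\<mu> (residue_ind p N k)
    = (\<Sum>i<p ^ N * p. residue_ind p N k (digits p i) * \<mu> (residue_ind p (Suc N) i))"
    using distribution_eq_sum[OF \<mu> residue_ind_schwartz const_mod_mono[OF const_mod_residue_ind], of N "Suc N" k]
    by (simp add: mult.commute)
  also have "\<dots> = (\<Sum>i<p ^ N. if i = k then \<Sum>j<p. \<mu> (residue_ind p (Suc N) (k + p ^ N * j)) else 0)"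
    unfolding sum_lessThan_mult
    by (intro sum.cong) (auto simp: residue_ind_def Zp_digits trunc_digits)
  finally show ?thesis using k by simp
qed

text \<open>Refinement of masses frees the integral from the least level chosen in its definition.
  The function \<phi> may have values outside \<open>K\<close>, as characters do.\<close>

lemma integral_dist_eq:
  assumes \<mu>: "\<mu> \<in> distributions p K" and \<phi>: "const_mod p N \<phi>"
  shows "integral_dist p \<mu> \<phi> = (\<Sum>k<p ^ N. \<phi> (digits p k) * \<mu> (residue_ind p N k))"
proof -
  define N0 where "N0 = (LEAST N. const_mod p N \<phi>)"
  have "integral_dist p \<mu> \<phi> = (\<Sum>k<p ^ N0. \<phi> (digits p k) * \<mu> (residue_ind p N0 k))"
    by (simp add: integral_dist_def N0_def const_mod_def Let_def residue_ind_def)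
  also have "\<dots> = (\<Sum>k<p ^ N. \<phi> (digits p k) * \<mu> (residue_ind p N k))"
    unfolding N0_def
    by (intro sum_const_mod[where m = "\<lambda>N k. \<mu> (residue_ind p N k)"] p_pos distribution_refine[OF \<mu>]
        LeastI[of "\<lambda>N. const_mod p N \<phi>", OF \<phi>] Least_le[of "\<lambda>N. const_mod p N \<phi>", OF \<phi>])
  finally show ?thesis .
qed

lemma fourier_stieltjes_eq:
  assumes \<mu>: "\<mu> \<in> distributions p K" and t: "t \<in> ball_hatZ p N"
  shows "fourier_stieltjes p \<zeta> \<mu> t
    = (\<Sum>k<p ^ N. inverse (pairing p \<zeta> t (digits p k)) * \<mu> (residue_ind p N k))"
proof -
  obtain i where i: "t = of_nat i / of_nat p ^ N" using t unfolding ball_hatZ_eq[OF p_ge_2] by auto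
  have "const_mod p N (\<lambda>z. inverse (pairing p \<zeta> t z))"
    using i p_pos by (auto simp: const_mod_def pairing_eq[of _ _ N i])
  moreover have "t \<in> hatZ p" using t by (simp add: ball_hatZ_def)
  ultimately show ?thesis using integral_dist_eq[OF \<mu>] by (simp add: fourier_stieltjes_def)
qed

text \<open>Inversion recovers the masses from the transform. This gives injectivity and shows which
  masses \<open>distribution_exists\<close> has to take.\<close>

lemma distribution_residue_ind:
  assumes \<mu>: "\<mu> \<in> distributions p K" and h: "\<And>t. t \<in> hatZ p \<Longrightarrow> fourier_stieltjes p \<zeta> \<mu> t = h t"
    and k: "k < p ^ N"
  shows "\<mu> (residue_ind p N k) = psum p \<zeta> h N (digits p k) / of_nat p ^ N"
proof -
  have "psum p \<zeta> h N (digits p k) = of_nat p ^ N * \<mu> (residue_ind p N k)"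
    using k by (rule psum_inversion') (use h fourier_stieltjes_eq[OF \<mu>] in \<open>auto simp: ball_hatZ_def\<close>)
  then show ?thesis using p_nonzero by simp
qed

lemma fourier_stieltjes_inject:
  assumes \<mu>: "\<mu> \<in> distributions p K" and \<nu>: "\<nu> \<in> distributions p K"
    and eq: "\<And>t. t \<in> hatZ p \<Longrightarrow> fourier_stieltjes p \<zeta> \<mu> t = fourier_stieltjes p \<zeta> \<nu> t"
  shows "\<mu> = \<nu>"
proof (rule ext)
  fix \<phi>
  show "\<mu> \<phi> = \<nu> \<phi>"
  proof (cases "\<phi> \<in> schwartz p K")
    case True
    then obtain N where N: "const_mod p N \<phi>" by (auto simp: schwartz_iff[OF p_pos])
    show ?thesis
      unfolding distribution_eq_sum[OF \<mu> True N] distribution_eq_sum[OF \<nu> True N]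
      by (intro sum.cong refl arg_cong2[where f = "(*)"])
        (simp add: distribution_residue_ind[OF \<mu> eq] distribution_residue_ind[OF \<nu> refl])
  next
    case False
    then show ?thesis using \<mu> \<nu> by (auto simp: distributions_def PiE_iff extensional_def)
  qed
qed

text \<open>The masses are forced by inversion. They are consistent by \<open>psum_refine\<close>,
  and the hypothesis places them in \<open>K\<close>.\<close>

lemma distribution_exists:
  assumes h: "\<And>N k. k < p ^ N \<Longrightarrow> psum p \<zeta> h N (digits p k) \<in> K"
  shows "\<exists>\<mu>\<in>distributions p K. \<forall>t\<in>hatZ p. fourier_stieltjes p \<zeta> \<mu> t = h t"
proof -
  define m where "m N k = psum p \<zeta> h N (digits p k) / of_nat p ^ N" for N k
  have mK: "m N k \<in> K" if "k < p ^ N" for N k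
    using h[OF that] by (auto simp: m_def intro!: K_closed)
  have ref: "m N k = (\<Sum>j<p. m (Suc N) (k + p ^ N * j))" if "k < p ^ N" for N k
    using psum_refine[OF that, of h] p_nonzero by (simp add: m_def flip: sum_divide_distrib)
  define \<mu> where "\<mu> = (\<lambda>\<phi>\<in>schwartz p K. let N = (LEAST N. const_mod p N \<phi>) in \<Sum>k<p ^ N. \<phi> (digits p k) * m N k)"
  have \<mu>_eq: "\<mu> \<phi> = (\<Sum>k<p ^ N. \<phi> (digits p k) * m N k)" if "\<phi> \<in> schwartz p K" "const_mod p N \<phi>" for \<phi> N
  proof -
    have "\<mu> \<phi> = (\<Sum>k<p ^ (LEAST N. const_mod p N \<phi>). \<phi> (digits p k) * m (LEAST N. const_mod p N \<phi>) k)"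
      using that(1) by (simp only: \<mu>_def Let_def restrict_apply if_True)
    also have "\<dots> = (\<Sum>k<p ^ N. \<phi> (digits p k) * m N k)"
      by (intro sum_const_mod[where m = m] p_pos ref
          LeastI[of "\<lambda>N. const_mod p N \<phi>", OF that(2)] Least_le[of "\<lambda>N. const_mod p N \<phi>", OF that(2)])
    finally show ?thesis .
  qed
  have mu: "\<mu> \<in> distributions p K"
    unfolding distributions_def
  proof (intro CollectI conjI ballI PiE_I)
    fix \<phi> assume \<phi>: "\<phi> \<in> schwartz p K"
    then obtain N where N: "const_mod p N \<phi>" by (auto simp: schwartz_iff[OF p_pos])
    show "\<mu> \<phi> \<in> K"
      unfolding \<mu>_eq[OF \<phi> N] using schwartz_range[OF \<phi> Zp_digits] mK by (intro K_closed) auto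
    fix c assume c: "c \<in> K"
    have "const_mod p N (\<lambda>z\<in>Zp p. c * \<phi> z)"
      using N const_mod_restrict[of p N \<phi> \<phi> "\<lambda>x _. c * x"] by simp
    then show "\<mu> (\<lambda>z\<in>Zp p. c * \<phi> z) = c * \<mu> \<phi>"
      using \<mu>_eq[OF \<phi> N] schwartz_scale[OF \<phi> c] by (simp add: \<mu>_eq Zp_digits sum_distrib_left mult.assoc)
  next
    fix \<phi> \<psi> assume \<phi>: "\<phi> \<in> schwartz p K" and \<psi>: "\<psi> \<in> schwartz p K"
    then obtain N M where "const_mod p N \<phi>" "const_mod p M \<psi>" by (auto simp: schwartz_iff[OF p_pos])
    then have NM: "const_mod p (max N M) \<phi>" "const_mod p (max N M) \<psi>" by (auto elim: const_mod_mono)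
    then have "const_mod p (max N M) (\<lambda>z\<in>Zp p. \<phi> z + \<psi> z)" by (rule const_mod_restrict)
    then show "\<mu> (\<lambda>z\<in>Zp p. \<phi> z + \<psi> z) = \<mu> \<phi> + \<mu> \<psi>"
      using \<mu>_eq[OF \<phi> NM(1)] \<mu>_eq[OF \<psi> NM(2)] schwartz_add[OF \<phi> \<psi>]
      by (simp add: \<mu>_eq Zp_digits sum.distrib algebra_simps)
  qed (simp add: \<mu>_def)
  have ind: "\<mu> (residue_ind p N k) = m N k" if k: "k < p ^ N" for N k
  proof -
    have "\<mu> (residue_ind p N k) = (\<Sum>i<p ^ N. if i = k then m N k else 0)"
      unfolding \<mu>_eq[OF residue_ind_schwartz const_mod_residue_ind]
      by (intro sum.cong) (auto simp: residue_ind_def Zp_digits trunc_digits)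
    then show ?thesis using k by simp
  qed
  have "fourier_stieltjes p \<zeta> \<mu> t = h t" if t: "t \<in> hatZ p" for t
  proof -
    define N where "N = lvl p t"
    have b: "t \<in> ball_hatZ p N" using hatZ_in_ball[OF p_ge_2 t] by (simp add: N_def)
    have "fourier_stieltjes p \<zeta> \<mu> t
      = (\<Sum>k<p ^ N. inverse (pairing p \<zeta> t (digits p k)) * psum p \<zeta> h N (digits p k)) / of_nat p ^ N"
      unfolding fourier_stieltjes_eq[OF mu b] by (simp add: ind m_def sum_divide_distrib)
    then show ?thesis using psum_inversion[OF b] p_nonzero by simp
  qed
  then show ?thesis using mu by blast
qed

lemma distribution_ex1:
  assumes "\<And>N k. k < p ^ N \<Longrightarrow> psum p \<zeta> h N (digits p k) \<in> K"
  shows "\<exists>!\<mu>. \<mu> \<in> distributions p K \<and> (\<forall>t\<in>hatZ p. fourier_stieltjes p \<zeta> \<mu> t = h t)"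
  using distribution_exists[OF assms] fourier_stieltjes_inject by metis

lemma fourier_stieltjes_sum:
  assumes I: "finite I" and \<mu>: "\<And>i. i \<in> I \<Longrightarrow> \<mu> i \<in> distributions p K" and c: "\<And>i. i \<in> I \<Longrightarrow> c i \<in> K"
  shows "(\<lambda>\<phi>\<in>schwartz p K. \<Sum>i\<in>I. c i * \<mu> i \<phi>) \<in> distributions p K"
    and "t \<in> hatZ p \<Longrightarrow> fourier_stieltjes p \<zeta> (\<lambda>\<phi>\<in>schwartz p K. \<Sum>i\<in>I. c i * \<mu> i \<phi>) t
      = (\<Sum>i\<in>I. c i * fourier_stieltjes p \<zeta> (\<mu> i) t)"
proof -
  show 1: "(\<lambda>\<phi>\<in>schwartz p K. \<Sum>i\<in>I. c i * \<mu> i \<phi>) \<in> distributions p K"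
    unfolding distributions_def
  proof (intro CollectI conjI ballI PiE_I)
    fix \<phi> assume \<phi>: "\<phi> \<in> schwartz p K"
    have "\<mu> i \<phi> \<in> K" if "i \<in> I" for i
      using \<mu>[OF that] \<phi> unfolding distributions_def by blast
    then show "(\<lambda>\<phi>\<in>schwartz p K. \<Sum>i\<in>I. c i * \<mu> i \<phi>) \<phi> \<in> K"
      using \<phi> c by (simp add: K_closed)
    fix e assume e: "e \<in> K"
    have "\<mu> i (\<lambda>z\<in>Zp p. e * \<phi> z) = e * \<mu> i \<phi>" if "i \<in> I" for i
      using \<mu>[OF that] \<phi> e unfolding distributions_def by blast
    then show "(\<lambda>\<phi>\<in>schwartz p K. \<Sum>i\<in>I. c i * \<mu> i \<phi>) (\<lambda>z\<in>Zp p. e * \<phi> z)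
      = e * (\<lambda>\<phi>\<in>schwartz p K. \<Sum>i\<in>I. c i * \<mu> i \<phi>) \<phi>"
      using \<phi> schwartz_scale[OF \<phi> e] by (simp add: sum_distrib_left mult_ac)
  next
    fix \<phi> \<psi> assume \<phi>: "\<phi> \<in> schwartz p K" "\<psi> \<in> schwartz p K"
    have "\<mu> i (\<lambda>z\<in>Zp p. \<phi> z + \<psi> z) = \<mu> i \<phi> + \<mu> i \<psi>" if "i \<in> I" for i
      using \<mu>[OF that] \<phi> unfolding distributions_def by blast
    then show "(\<lambda>\<phi>\<in>schwartz p K. \<Sum>i\<in>I. c i * \<mu> i \<phi>) (\<lambda>z\<in>Zp p. \<phi> z + \<psi> z)
      = (\<lambda>\<phi>\<in>schwartz p K. \<Sum>i\<in>I. c i * \<mu> i \<phi>) \<phi> + (\<lambda>\<phi>\<in>schwartz p K. \<Sum>i\<in>I. c i * \<mu> i \<phi>) \<psi>"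
      using \<phi> schwartz_add[OF \<phi>] by (simp add: sum.distrib algebra_simps)
  qed simp
  assume t: "t \<in> hatZ p"
  define N where "N = lvl p t"
  have b: "t \<in> ball_hatZ p N" using hatZ_in_ball[OF p_ge_2 t] by (simp add: N_def)
  have "fourier_stieltjes p \<zeta> (\<lambda>\<phi>\<in>schwartz p K. \<Sum>i\<in>I. c i * \<mu> i \<phi>) t
    = (\<Sum>k<p ^ N. \<Sum>i\<in>I. c i * (inverse (pairing p \<zeta> t (digits p k)) * \<mu> i (residue_ind p N k)))"
    unfolding fourier_stieltjes_eq[OF 1 b] using residue_ind_schwartz
    by (simp add: sum_distrib_left mult_ac)
  also have "\<dots> = (\<Sum>i\<in>I. c i * fourier_stieltjes p \<zeta> (\<mu> i) t)"
    by (subst sum.swap) (simp add: fourier_stieltjes_eq[OF \<mu> b] sum_distrib_left)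
  finally show "fourier_stieltjes p \<zeta> (\<lambda>\<phi>\<in>schwartz p K. \<Sum>i\<in>I. c i * \<mu> i \<phi>) t
      = (\<Sum>i\<in>I. c i * fourier_stieltjes p \<zeta> (\<mu> i) t)" .
qed

end

section \<open>Completions\<close>

lemma carrier_Quot: "carrier (R Quot J) = (\<lambda>x. J +>\<^bsub>R\<^esub> x) ` carrier R"
  by (auto simp: FactRing_def A_RCOSETS_def')

lemma (in ideal) coset_eq_iff:
  assumes "x \<in> carrier R" "y \<in> carrier R"
  shows "I +> x = I +> y \<longleftrightarrow> x \<ominus> y \<in> I"
  using a_rcos_module_minus[OF ring_axioms assms(2,1)] a_repr_independence'[OF _ assms(2), of x]
    a_rcos_self[OF assms(1)] by metis

lemma (in ideal) coset_mem_iff: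
  assumes "x \<in> carrier R"
  shows "y \<in> I +> x \<longleftrightarrow> y \<in> carrier R \<and> y \<ominus> x \<in> I"
  using a_rcos_module_minus[OF ring_axioms assms] a_elemrcos_carrier[OF assms] by blast

text \<open>Each sequence \<open>D n\<close> is Cauchy at a rate independent of \<open>n\<close>, so
  the inner limit may be replaced by the diagonal term. In the uses, \<open>D n m\<close> is the
  distance of the n-th approximant from the m-th term of a Cauchy sequence.\<close>

lemma lim_diagonal:
  fixes D :: "nat \<Rightarrow> nat \<Rightarrow> real"
  assumes D: "\<And>n m m'. \<bar>D n m - D n m'\<bar> \<le> c m m'"
    and c: "\<forall>e>0. \<exists>N. \<forall>m\<ge>N. \<forall>m'\<ge>N. c m m' < e"
  shows "(\<lambda>n. lim (D n)) \<longlonglongrightarrow> 0 \<longleftrightarrow> (\<lambda>n. D n n) \<longlonglongrightarrow> 0"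
proof -
  have lim: "D n \<longlonglongrightarrow> lim (D n)" for n
  proof -
    have "Cauchy (D n)"
      unfolding Cauchy_def dist_real_def using c D[of n] by (meson le_less_trans)
    then show ?thesis by (simp add: Cauchy_convergent_iff convergent_LIMSEQ_iff)
  qed
  have diff: "(\<lambda>n. lim (D n) - D n n) \<longlonglongrightarrow> 0"
  proof (rule LIMSEQ_I)
    fix e :: real assume "0 < e"
    then have "0 < e / 2" by simp
    then obtain N where N: "\<And>m m'. N \<le> m \<Longrightarrow> N \<le> m' \<Longrightarrow> c m m' < e / 2" using c by meson
    have "\<bar>lim (D n) - D n n\<bar> \<le> e / 2" if "N \<le> n" for n
    proof (rule LIMSEQ_le_const2)
      show "(\<lambda>m. \<bar>D n m - D n n\<bar>) \<longlonglongrightarrow> \<bar>lim (D n) - D n n\<bar>" by (intro tendsto_intros lim)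
      show "\<exists>M. \<forall>m\<ge>M. \<bar>D n m - D n n\<bar> \<le> e / 2"
        using N D that by (meson le_less_trans less_imp_le)
    qed
    then show "\<exists>no. \<forall>n\<ge>no. norm (lim (D n) - D n n - 0) < e"
      using \<open>0 < e\<close> by (intro exI[of _ N]) fastforce
  qed
  show ?thesis
    using tendsto_add[OF diff, of "\<lambda>n. D n n" 0] tendsto_diff[OF _ diff, of "\<lambda>n. lim (D n)" 0] by auto
qed

locale valued_ring = cring A for A (structure) +
  fixes \<nu> :: "'a \<Rightarrow> real"
  assumes abs: "absolute_value A \<nu>"
begin

lemma abs_nonneg: "x \<in> carrier A \<Longrightarrow> 0 \<le> \<nu> x"
  and abs_eq_0_iff: "x \<in> carrier A \<Longrightarrow> \<nu> x = 0 \<longleftrightarrow> x = \<zero>"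
  and abs_one: "\<nu> \<one> = 1"
  and abs_mult: "x \<in> carrier A \<Longrightarrow> y \<in> carrier A \<Longrightarrow> \<nu> (x \<otimes> y) = \<nu> x * \<nu> y"
  and abs_triangle: "x \<in> carrier A \<Longrightarrow> y \<in> carrier A \<Longrightarrow> \<nu> (x \<oplus> y) \<le> \<nu> x + \<nu> y"
  using abs by (auto simp: absolute_value_def)

lemma abs_zero: "\<nu> \<zero> = 0"
  using abs_eq_0_iff by simp

lemma abs_minus:
  assumes "x \<in> carrier A"
  shows "\<nu> (\<ominus> x) = \<nu> x"
proof -
  have "\<nu> (\<ominus> \<one>) * \<nu> (\<ominus> \<one>) = 1" by (simp flip: abs_mult add: l_minus abs_one)
  then have "\<nu> (\<ominus> \<one>) = 1" using abs_nonneg[of "\<ominus> \<one>"] by (simp add: square_eq_1_iff)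
  then show ?thesis using abs_mult[of "\<ominus> \<one>" x] assms by (simp add: l_minus)
qed

lemma abs_diff_commute:
  assumes "x \<in> carrier A" "y \<in> carrier A"
  shows "\<nu> (x \<ominus> y) = \<nu> (y \<ominus> x)"
proof -
  have "x \<ominus> y = \<ominus> (y \<ominus> x)" using assms by algebra
  then show ?thesis using assms by (simp add: abs_minus)
qed

lemma abs_diff_triangle:
  assumes "x \<in> carrier A" "y \<in> carrier A" "z \<in> carrier A"
  shows "\<nu> (x \<ominus> z) \<le> \<nu> (x \<ominus> y) + \<nu> (y \<ominus> z)"
proof -
  have "x \<ominus> z = (x \<ominus> y) \<oplus> (y \<ominus> z)" using assms by algebra
  then show ?thesis using assms by (simp add: abs_triangle)
qed

lemma abs_diff_abs:
  assumes "x \<in> carrier A" "y \<in> carrier A"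
  shows "\<bar>\<nu> x - \<nu> y\<bar> \<le> \<nu> (x \<ominus> y)"
proof -
  have "x = (x \<ominus> y) \<oplus> y" "y = (y \<ominus> x) \<oplus> x" using assms by algebra+
  then have "\<nu> x \<le> \<nu> (x \<ominus> y) + \<nu> y" "\<nu> y \<le> \<nu> (y \<ominus> x) + \<nu> x"
    using assms abs_triangle by (metis minus_closed)+
  then show ?thesis using abs_diff_commute[OF assms] by simp
qed

lemma tendsto_diff_trans:
  assumes "\<And>n. x n \<in> carrier A" "\<And>n. y n \<in> carrier A" "\<And>n. z n \<in> carrier A"
    and "(\<lambda>n. \<nu> (x n \<ominus> y n)) \<longlonglongrightarrow> 0" "(\<lambda>n. \<nu> (y n \<ominus> z n)) \<longlonglongrightarrow> 0"
  shows "(\<lambda>n. \<nu> (x n \<ominus> z n)) \<longlonglongrightarrow> 0"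
proof (rule tendsto_sandwich[OF always_eventually always_eventually tendsto_const])
  show "(\<lambda>n. \<nu> (x n \<ominus> y n) + \<nu> (y n \<ominus> z n)) \<longlonglongrightarrow> 0"
    using tendsto_add[OF assms(4,5)] by simp
qed (use assms(1-3) in \<open>auto simp: abs_nonneg abs_diff_triangle\<close>)

abbreviation "CR \<equiv> cauchy_ring A \<nu>"

lemma CR_iff: "s \<in> carrier CR \<longleftrightarrow> (\<forall>n. s n \<in> carrier A) \<and>
    (\<forall>e>0. \<exists>N. \<forall>m\<ge>N. \<forall>n\<ge>N. \<nu> (s m \<ominus> s n) < e)"
  by (simp add: cauchy_ring_def)

lemma CR_simps: "s \<otimes>\<^bsub>CR\<^esub> t = (\<lambda>n. s n \<otimes> t n)" "s \<oplus>\<^bsub>CR\<^esub> t = (\<lambda>n. s n \<oplus> t n)"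
    "\<one>\<^bsub>CR\<^esub> = (\<lambda>n. \<one>)" "\<zero>\<^bsub>CR\<^esub> = (\<lambda>n. \<zero>)"
  by (simp_all add: cauchy_ring_def)

lemma CR_closed: "s \<in> carrier CR \<Longrightarrow> s n \<in> carrier A"
  by (simp add: CR_iff)

lemma CR_const: "x \<in> carrier A \<Longrightarrow> (\<lambda>n. x) \<in> carrier CR"
  by (simp add: CR_iff a_minus_def r_neg abs_zero)

lemma CR_add:
  assumes "s \<in> carrier CR" "t \<in> carrier CR"
  shows "(\<lambda>n. s n \<oplus> t n) \<in> carrier CR"
  unfolding CR_iff
proof (intro conjI allI impI)
  note [simp] = CR_closed[OF assms(1)] CR_closed[OF assms(2)]
  show "s n \<oplus> t n \<in> carrier A" for n by simp
  fix e :: real assume "0 < e"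
  then have "0 < e / 2" by simp
  then obtain N M where N: "\<And>m n. N \<le> m \<Longrightarrow> N \<le> n \<Longrightarrow> \<nu> (s m \<ominus> s n) < e / 2"
    and M: "\<And>m n. M \<le> m \<Longrightarrow> M \<le> n \<Longrightarrow> \<nu> (t m \<ominus> t n) < e / 2"
    using assms unfolding CR_iff by meson
  have "\<nu> ((s m \<oplus> t m) \<ominus> (s n \<oplus> t n)) < e" if "max N M \<le> m" "max N M \<le> n" for m n
  proof -
    have "s m \<oplus> t m \<ominus> (s n \<oplus> t n) = (s m \<ominus> s n) \<oplus> (t m \<ominus> t n)"
      using CR_closed[OF assms(1)] CR_closed[OF assms(2)] by algebra
    then show ?thesis using abs_triangle[of "s m \<ominus> s n" "t m \<ominus> t n"] N[of m n] M[of m n] that by simp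
  qed
  then show "\<exists>N. \<forall>m\<ge>N. \<forall>n\<ge>N. \<nu> (s m \<oplus> t m \<ominus> (s n \<oplus> t n)) < e" by blast
qed

lemma CR_bounded:
  assumes "s \<in> carrier CR"
  shows "\<exists>C>0. \<forall>n. \<nu> (s n) \<le> C"
proof -
  have "\<exists>N. \<forall>m\<ge>N. \<forall>n\<ge>N. \<nu> (s m \<ominus> s n) < 1" using assms unfolding CR_iff by simp
  then obtain N where N: "\<And>m. N \<le> m \<Longrightarrow> \<nu> (s m \<ominus> s N) < 1" by blast
  define C where "C = (\<Sum>i\<le>N. \<nu> (s i)) + 1"
  have "\<nu> (s n) \<le> C" for n
  proof (cases "n \<le> N")
    case True
    then have "\<nu> (s n) \<le> (\<Sum>i\<le>N. \<nu> (s i))" by (intro member_le_sum) (auto simp: abs_nonneg CR_closed[OF assms])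
    then show ?thesis by (simp add: C_def)
  next
    case False
    then have "\<nu> (s n) \<le> \<nu> (s N) + 1"
      using N[of n] abs_diff_abs[of "s n" "s N"] CR_closed[OF assms] by fastforce
    also have "\<nu> (s N) \<le> (\<Sum>i\<le>N. \<nu> (s i))" by (intro member_le_sum) (auto simp: abs_nonneg CR_closed[OF assms])
    finally show ?thesis by (simp add: C_def)
  qed
  moreover have "0 < C" unfolding C_def by (intro add_nonneg_pos sum_nonneg) (auto simp: abs_nonneg CR_closed[OF assms])
  ultimately show ?thesis by blast
qed

lemma CR_mult:
  assumes "s \<in> carrier CR" "t \<in> carrier CR"
  shows "(\<lambda>n. s n \<otimes> t n) \<in> carrier CR"
  unfolding CR_iff
proof (intro conjI allI impI)
  note cl = CR_closed[OF assms(1)] CR_closed[OF assms(2)]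
  show "s n \<otimes> t n \<in> carrier A" for n using cl by simp
  fix e :: real assume e: "0 < e"
  obtain C D where C: "0 < C" "\<And>n. \<nu> (s n) \<le> C" and D: "0 < D" "\<And>n. \<nu> (t n) \<le> D"
    using CR_bounded assms by meson
  have "0 < e / (2 * D)" "0 < e / (2 * C)" using C D e by auto
  then obtain N M where N: "\<And>m n. N \<le> m \<Longrightarrow> N \<le> n \<Longrightarrow> \<nu> (s m \<ominus> s n) < e / (2 * D)"
    and M: "\<And>m n. M \<le> m \<Longrightarrow> M \<le> n \<Longrightarrow> \<nu> (t m \<ominus> t n) < e / (2 * C)"
    using assms unfolding CR_iff by meson
  have "\<nu> ((s m \<otimes> t m) \<ominus> (s n \<otimes> t n)) < e" if "max N M \<le> m" "max N M \<le> n" for m n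
  proof -
    have "s m \<otimes> t m \<ominus> s n \<otimes> t n = s m \<otimes> (t m \<ominus> t n) \<oplus> (s m \<ominus> s n) \<otimes> t n"
      using cl by algebra
    then have "\<nu> (s m \<otimes> t m \<ominus> s n \<otimes> t n) \<le> \<nu> (s m) * \<nu> (t m \<ominus> t n) + \<nu> (s m \<ominus> s n) * \<nu> (t n)"
      using abs_triangle[of "s m \<otimes> (t m \<ominus> t n)" "(s m \<ominus> s n) \<otimes> t n"] cl by (simp add: abs_mult)
    also have "\<dots> \<le> C * \<nu> (t m \<ominus> t n) + \<nu> (s m \<ominus> s n) * D"
      using C D cl by (intro add_mono mult_mono) (auto simp: abs_nonneg less_imp_le)
    also have "\<dots> < C * (e / (2 * C)) + e / (2 * D) * D"
      using N[of m n] M[of m n] that C(1) D(1) by (intro add_strict_mono mult_strict_left_mono mult_strict_right_mono) auto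
    also have "\<dots> = e" using C(1) D(1) by simp
    finally show ?thesis .
  qed
  then show "\<exists>N. \<forall>m\<ge>N. \<forall>n\<ge>N. \<nu> (s m \<otimes> t m \<ominus> s n \<otimes> t n) < e" by blast
qed

lemma CR_uminus:
  assumes "s \<in> carrier CR"
  shows "(\<lambda>n. \<ominus> s n) \<in> carrier CR"
proof -
  have "(\<lambda>n. \<ominus> \<one> \<otimes> s n) \<in> carrier CR" using assms by (intro CR_mult CR_const) auto
  then show ?thesis using CR_closed[OF assms] by (simp add: l_minus)
qed

lemma cring_CR: "cring CR"
proof (rule cringI)
  show "abelian_group CR"
  proof (rule abelian_groupI)
    fix s assume s: "s \<in> carrier CR"
    then show "\<exists>t\<in>carrier CR. t \<oplus>\<^bsub>CR\<^esub> s = \<zero>\<^bsub>CR\<^esub>"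
      using CR_uminus[OF s] CR_closed[OF s] by (intro bexI[of _ "\<lambda>n. \<ominus> s n"]) (auto simp: CR_simps l_neg)
  qed (auto simp: CR_simps fun_eq_iff CR_closed a_ac intro: CR_add CR_const)
  show "comm_monoid CR"
    by (rule comm_monoidI) (auto simp: CR_simps fun_eq_iff CR_closed m_ac intro: CR_mult CR_const)
qed (auto simp: CR_simps fun_eq_iff CR_closed l_distr)

lemma CR_a_inv:
  assumes s: "s \<in> carrier CR"
  shows "\<ominus>\<^bsub>CR\<^esub> s = (\<lambda>n. \<ominus> s n)"
proof -
  interpret CR: cring CR by (rule cring_CR)
  show ?thesis
    using CR_uminus[OF s] s CR_closed[OF s] by (intro CR.minus_equality) (auto simp: CR_simps l_neg)
qed

lemma CR_minus: "s \<in> carrier CR \<Longrightarrow> t \<in> carrier CR \<Longrightarrow> s \<ominus>\<^bsub>CR\<^esub> t = (\<lambda>n. s n \<ominus> t n)"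
  by (simp add: a_minus_def CR_a_inv CR_simps)

lemma null_seqs_iff: "s \<in> null_seqs A \<nu> \<longleftrightarrow> s \<in> carrier CR \<and> (\<lambda>n. \<nu> (s n)) \<longlonglongrightarrow> 0"
  by (simp add: null_seqs_def)

lemma null_dominated:
  assumes "s \<in> carrier CR" "\<And>n. \<nu> (s n) \<le> f n" "f \<longlonglongrightarrow> 0"
  shows "s \<in> null_seqs A \<nu>"
  unfolding null_seqs_iff using assms CR_closed[OF assms(1)] abs_nonneg
  by (auto intro!: tendsto_sandwich[OF always_eventually always_eventually tendsto_const assms(3)])

lemma ideal_null_seqs: "ideal (null_seqs A \<nu>) CR"
proof -
  interpret CR: cring CR by (rule cring_CR)
  have mult: "(\<lambda>n. s n \<otimes> t n) \<in> null_seqs A \<nu>" if s: "s \<in> null_seqs A \<nu>" and t: "t \<in> carrier CR" for s t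
  proof -
    have sc: "s \<in> carrier CR" and sl: "(\<lambda>n. \<nu> (s n)) \<longlonglongrightarrow> 0" using s by (auto simp: null_seqs_iff)
    obtain C where C: "0 < C" "\<And>n. \<nu> (t n) \<le> C" using CR_bounded[OF t] by blast
    have "(\<lambda>n. \<nu> (s n) * C) \<longlonglongrightarrow> 0 * C" using sl by (intro tendsto_intros)
    then have lim: "(\<lambda>n. \<nu> (s n) * C) \<longlonglongrightarrow> 0" by simp
    have "\<nu> (s n \<otimes> t n) \<le> \<nu> (s n) * C" for n
      using C CR_closed[OF sc] CR_closed[OF t] abs_nonneg by (simp add: abs_mult mult_left_mono)
    then show ?thesis by (rule null_dominated[OF CR_mult[OF sc t] _ lim])
  qed
  have add: "(\<lambda>n. s n \<oplus> t n) \<in> null_seqs A \<nu>" if s: "s \<in> null_seqs A \<nu>" and t: "t \<in> null_seqs A \<nu>" for s t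
  proof -
    have sc: "s \<in> carrier CR" "t \<in> carrier CR"
      and sl: "(\<lambda>n. \<nu> (s n)) \<longlonglongrightarrow> 0" "(\<lambda>n. \<nu> (t n)) \<longlonglongrightarrow> 0" using s t by (auto simp: null_seqs_iff)
    have "(\<lambda>n. \<nu> (s n) + \<nu> (t n)) \<longlonglongrightarrow> 0 + 0" using sl by (intro tendsto_intros)
    then have lim: "(\<lambda>n. \<nu> (s n) + \<nu> (t n)) \<longlonglongrightarrow> 0" by simp
    have "\<nu> (s n \<oplus> t n) \<le> \<nu> (s n) + \<nu> (t n)" for n
      using CR_closed[OF sc(1)] CR_closed[OF sc(2)] by (rule abs_triangle)
    then show ?thesis by (rule null_dominated[OF CR_add[OF sc] _ lim])
  qed
  have sub: "subgroup (null_seqs A \<nu>) (add_monoid CR)"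
  proof (rule CR.add.subgroupI)
    show "null_seqs A \<nu> \<subseteq> carrier CR" by (auto simp: null_seqs_iff)
    have "(\<lambda>n. \<zero>) \<in> null_seqs A \<nu>" by (simp add: null_seqs_iff CR_const abs_zero)
    then show "null_seqs A \<nu> \<noteq> {}" by blast
    show "s \<oplus>\<^bsub>CR\<^esub> t \<in> null_seqs A \<nu>" if "s \<in> null_seqs A \<nu>" "t \<in> null_seqs A \<nu>" for s t
      using add[OF that] by (simp add: CR_simps)
    show "\<ominus>\<^bsub>CR\<^esub> s \<in> null_seqs A \<nu>" if "s \<in> null_seqs A \<nu>" for s
      using that by (simp add: null_seqs_iff CR_a_inv CR_uminus abs_minus CR_closed)
  qed
  show ?thesis
  proof (rule idealI[OF CR.ring_axioms sub])
    fix s t assume st: "s \<in> null_seqs A \<nu>" "t \<in> carrier CR"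
    show "s \<otimes>\<^bsub>CR\<^esub> t \<in> null_seqs A \<nu>" using mult[OF st] by (simp add: CR_simps)
    have "(\<lambda>n. s n \<otimes> t n) = (\<lambda>n. t n \<otimes> s n)"
      using st by (auto simp: null_seqs_iff CR_closed m_comm)
    then show "t \<otimes>\<^bsub>CR\<^esub> s \<in> null_seqs A \<nu>" using mult[OF st] by (simp add: CR_simps)
  qed
qed

lemma cring_completion: "cring (completion A \<nu>)"
  unfolding completion_def by (rule ideal.quotient_is_cring[OF ideal_null_seqs cring_CR])

definition cls :: "(nat \<Rightarrow> 'a) \<Rightarrow> (nat \<Rightarrow> 'a) set" where
  "cls s = null_seqs A \<nu> +>\<^bsub>CR\<^esub> s"

lemma compl_emb_cls: "compl_emb A \<nu> x = cls (\<lambda>n. x)"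
  by (simp add: compl_emb_def cls_def)

lemma carrier_completion: "carrier (completion A \<nu>) = cls ` carrier CR"
  by (auto simp: completion_def carrier_Quot cls_def)

lemma cls_closed: "s \<in> carrier CR \<Longrightarrow> cls s \<in> carrier (completion A \<nu>)"
  by (simp add: carrier_completion)

lemma ring_hom_cls: "cls \<in> ring_hom CR (completion A \<nu>)"
  using ideal.rcos_ring_hom[OF ideal_null_seqs] by (simp add: completion_def cls_def[abs_def])

lemma cls_add: "s \<in> carrier CR \<Longrightarrow> t \<in> carrier CR \<Longrightarrow>
    cls s \<oplus>\<^bsub>completion A \<nu>\<^esub> cls t = cls (\<lambda>n. s n \<oplus> t n)"
  and cls_mult: "s \<in> carrier CR \<Longrightarrow> t \<in> carrier CR \<Longrightarrow>
    cls s \<otimes>\<^bsub>completion A \<nu>\<^esub> cls t = cls (\<lambda>n. s n \<otimes> t n)"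
  and cls_one: "\<one>\<^bsub>completion A \<nu>\<^esub> = cls (\<lambda>n. \<one>)"
  using ring_hom_memE[OF ring_hom_cls] by (auto simp: CR_simps)

lemma cls_minus:
  assumes "s \<in> carrier CR" "t \<in> carrier CR"
  shows "cls s \<ominus>\<^bsub>completion A \<nu>\<^esub> cls t = cls (\<lambda>n. s n \<ominus> t n)"
proof -
  interpret h: ring_hom_cring CR "completion A \<nu>" cls
    using cring_CR cring_completion ring_hom_cls by (simp add: ring_hom_cring_def ring_hom_cring_axioms_def)
  have "cls (s \<ominus>\<^bsub>CR\<^esub> t) = cls s \<ominus>\<^bsub>completion A \<nu>\<^esub> cls t"
    using assms by (simp add: a_minus_def)
  then show ?thesis using assms by (simp add: CR_minus)
qed

lemma cls_eq_iff:
  assumes "s \<in> carrier CR" "t \<in> carrier CR"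
  shows "cls s = cls t \<longleftrightarrow> (\<lambda>n. \<nu> (s n \<ominus> t n)) \<longlonglongrightarrow> 0"
proof -
  interpret CR: cring CR by (rule cring_CR)
  have "s \<ominus>\<^bsub>CR\<^esub> t \<in> carrier CR" using assms by simp
  then show ?thesis
    unfolding cls_def ideal.coset_eq_iff[OF ideal_null_seqs assms] null_seqs_iff
    by (simp add: CR_minus[OF assms])
qed

lemma mem_cls_iff:
  assumes "s \<in> carrier CR"
  shows "t \<in> cls s \<longleftrightarrow> t \<in> carrier CR \<and> (\<lambda>n. \<nu> (t n \<ominus> s n)) \<longlonglongrightarrow> 0"
proof -
  interpret CR: cring CR by (rule cring_CR)
  show ?thesis
    unfolding cls_def ideal.coset_mem_iff[OF ideal_null_seqs assms] null_seqs_iff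
    using CR_minus[of t s] CR.minus_closed[of t s] assms by auto
qed

text \<open>The representative chosen inside \<open>compl_norm\<close> differs from \<open>s\<close>
  by a null sequence.\<close>

lemma compl_norm_cls:
  assumes s: "s \<in> carrier CR"
  shows "compl_norm \<nu> (cls s) = lim (\<lambda>n. \<nu> (s n))"
proof -
  define t where "t = (SOME t. t \<in> cls s)"
  have "s \<in> cls s" using s by (simp add: mem_cls_iff CR_closed a_minus_def r_neg abs_zero)
  then have "t \<in> cls s" unfolding t_def by (rule someI[of "\<lambda>t. t \<in> cls s"])
  then have t: "t \<in> carrier CR" "(\<lambda>n. \<nu> (t n \<ominus> s n)) \<longlonglongrightarrow> 0" using s by (auto simp: mem_cls_iff)
  have "Cauchy (\<lambda>n. \<nu> (s n))"
    unfolding Cauchy_def dist_real_def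
    using s abs_diff_abs[OF CR_closed[OF s] CR_closed[OF s]] unfolding CR_iff by (meson le_less_trans)
  then have l: "(\<lambda>n. \<nu> (s n)) \<longlonglongrightarrow> lim (\<lambda>n. \<nu> (s n))"
    by (simp add: Cauchy_convergent_iff convergent_LIMSEQ_iff)
  have "(\<lambda>n. \<nu> (t n) - \<nu> (s n)) \<longlonglongrightarrow> 0"
    using abs_diff_abs CR_closed[OF s] CR_closed[OF t(1)]
    by (intro tendsto_rabs_zero_cancel[OF tendsto_sandwich[OF always_eventually always_eventually tendsto_const t(2)]]) auto
  from tendsto_add[OF this l] have "(\<lambda>n. \<nu> (t n)) \<longlonglongrightarrow> lim (\<lambda>n. \<nu> (s n))" by simp
  then show ?thesis unfolding compl_norm_def t_def[symmetric] by (rule limI)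
qed

text \<open>Reduces convergence in the completion to one diagonal sequence in \<open>A\<close>, by
  \<open>lim_diagonal\<close>.\<close>

lemma compl_norm_tendsto_iff:
  assumes x: "\<And>n. x n \<in> carrier A" and s: "s \<in> carrier CR"
  shows "(\<lambda>n. compl_norm \<nu> (compl_emb A \<nu> (x n) \<ominus>\<^bsub>completion A \<nu>\<^esub> cls s)) \<longlonglongrightarrow> 0
    \<longleftrightarrow> (\<lambda>n. \<nu> (x n \<ominus> s n)) \<longlonglongrightarrow> 0"
proof -
  interpret CR: cring CR by (rule cring_CR)
  note cl = x CR_closed[OF s]
  have c: "(\<lambda>m. x n \<ominus> s m) \<in> carrier CR" for n
    using CR.minus_closed[OF CR_const[OF x] s] by (simp add: CR_minus CR_const x s)
  have "compl_norm \<nu> (compl_emb A \<nu> (x n) \<ominus>\<^bsub>completion A \<nu>\<^esub> cls s) = lim (\<lambda>m. \<nu> (x n \<ominus> s m))" for n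
    unfolding compl_emb_cls cls_minus[OF CR_const[OF x] s] compl_norm_cls[OF c] ..
  moreover have "\<bar>\<nu> (x n \<ominus> s m) - \<nu> (x n \<ominus> s m')\<bar> \<le> \<nu> (s m' \<ominus> s m)" for n m m'
  proof -
    have "(x n \<ominus> s m) \<ominus> (x n \<ominus> s m') = s m' \<ominus> s m" using cl by algebra
    then show ?thesis using abs_diff_abs[of "x n \<ominus> s m" "x n \<ominus> s m'"] cl by simp
  qed
  then have "(\<lambda>n. lim (\<lambda>m. \<nu> (x n \<ominus> s m))) \<longlonglongrightarrow> 0 \<longleftrightarrow> (\<lambda>n. \<nu> (x n \<ominus> s n)) \<longlonglongrightarrow> 0"
    by (rule lim_diagonal) (use s in \<open>unfold CR_iff, blast\<close>)
  ultimately show ?thesis by simp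
qed

text \<open>Injectivity lets an element of \<open>A\<close> be read off from one completion and
  carried to another, as \<open>same_elem\<close> requires.\<close>

lemma compl_emb_eq_iff:
  assumes "x \<in> carrier A" "y \<in> carrier A"
  shows "compl_emb A \<nu> x = compl_emb A \<nu> y \<longleftrightarrow> x = y"
proof -
  have "(\<lambda>n::nat. \<nu> (x \<ominus> y)) \<longlonglongrightarrow> 0 \<longleftrightarrow> \<nu> (x \<ominus> y) = 0" by (simp add: LIMSEQ_const_iff)
  also have "\<dots> \<longleftrightarrow> x = y" using assms abs_eq_0_iff[of "x \<ominus> y"] by (simp add: r_right_minus_eq)
  finally show ?thesis unfolding compl_emb_cls cls_eq_iff[OF CR_const[OF assms(1)] CR_const[OF assms(2)]] .
qed

end

text \<open>Frames compare absolute values on the carrier only, while completions take total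
  functions as arguments.\<close>

lemma cauchy_ring_cong:
  fixes A :: "('a, 'm) ring_scheme"
  assumes "abelian_group A" "\<And>x. x \<in> carrier A \<Longrightarrow> \<nu> x = \<nu>' x"
  shows "cauchy_ring A \<nu> = cauchy_ring A \<nu>'"
proof -
  interpret abelian_group A by fact
  have "(\<forall>n. s n \<in> carrier A) \<and> (\<forall>e>0. \<exists>N. \<forall>m\<ge>N. \<forall>n\<ge>N. \<nu> (s m \<ominus>\<^bsub>A\<^esub> s n) < e) \<longleftrightarrow>
      (\<forall>n. s n \<in> carrier A) \<and> (\<forall>e>0. \<exists>N. \<forall>m\<ge>N. \<forall>n\<ge>N. \<nu>' (s m \<ominus>\<^bsub>A\<^esub> s n) < e)" for s :: "nat \<Rightarrow> 'a"
    by (rule conj_cong[OF refl]) (simp add: assms(2))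
  then show ?thesis unfolding cauchy_ring_def by (simp only:)
qed

lemma null_seqs_cong:
  assumes "abelian_group A" "\<And>x. x \<in> carrier A \<Longrightarrow> \<nu> x = \<nu>' x"
  shows "null_seqs A \<nu> = null_seqs A \<nu>'"
proof -
  have "\<nu> (s n) = \<nu>' (s n)" if "s \<in> carrier (cauchy_ring A \<nu>')" for s n
    using that assms(2) by (simp add: cauchy_ring_def)
  then show ?thesis
    unfolding null_seqs_def using cauchy_ring_cong[OF assms] by (intro Collect_cong conj_cong) simp_all
qed

lemma completion_cong:
  assumes "abelian_group A" "\<And>x. x \<in> carrier A \<Longrightarrow> \<nu> x = \<nu>' x"
  shows "completion A \<nu> = completion A \<nu>'" "compl_emb A \<nu> = compl_emb A \<nu>'"
  by (simp_all add: completion_def compl_emb_def[abs_def] cauchy_ring_cong[OF assms] null_seqs_cong[OF assms])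

section \<open>Affine functional equations over a frame\<close>

lemma (in valued_ring) geometric_CR:
  assumes s: "\<And>n. s n \<in> carrier A" and r: "0 \<le> r" "r < 1" and D: "\<And>n. \<nu> (s (Suc n) \<ominus> s n) \<le> D * r ^ n"
  shows "s \<in> carrier CR"
  unfolding CR_iff
proof (intro conjI allI impI)
  show "s n \<in> carrier A" for n by (rule s)
  have D0: "0 \<le> D" using D[of 0] abs_nonneg[of "s (Suc 0) \<ominus> s 0"] s by simp
  have bound: "\<nu> (s (n + k) \<ominus> s n) \<le> D / (1 - r) * r ^ n" for n k
  proof -
    have "\<nu> (s (n + k) \<ominus> s n) \<le> D * r ^ n * (\<Sum>i<k. r ^ i)"
    proof (induction k)
      case 0
      then show ?case using s by (simp add: a_minus_def r_neg abs_zero)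
    next
      case (Suc k)
      have "\<nu> (s (n + Suc k) \<ominus> s n) \<le> D * r ^ (n + k) + D * r ^ n * (\<Sum>i<k. r ^ i)"
        using abs_diff_triangle[of "s (n + Suc k)" "s (n + k)" "s n"] s D[of "n + k"] Suc by simp
      then show ?case by (simp add: power_add algebra_simps)
    qed
    also have "(\<Sum>i<k. r ^ i) \<le> 1 / (1 - r)"
      using r power_le_one[of r k] by (simp add: sum_gp_strict divide_right_mono)
    finally show ?thesis using D0 r by (simp add: mult_left_mono)
  qed
  fix e :: real assume e: "0 < e"
  have "(\<lambda>n. D / (1 - r) * r ^ n) \<longlonglongrightarrow> D / (1 - r) * 0" using r by (intro tendsto_intros LIMSEQ_power_zero) auto
  then obtain N where N: "\<And>n. N \<le> n \<Longrightarrow> norm (D / (1 - r) * r ^ n - 0) < e"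
    using LIMSEQ_D[of _ _ e] e by (metis mult_zero_right)
  have *: "\<nu> (s m \<ominus> s n) < e" if "N \<le> n" "n \<le> m" for m n
  proof -
    have "D / (1 - r) * r ^ n < e" using N[OF that(1)] by (simp only: diff_zero real_norm_def abs_less_iff)
    then show ?thesis using bound[of n "m - n"] that(2) by simp
  qed
  have "\<nu> (s m \<ominus> s n) < e" if "N \<le> n" "N \<le> m" for m n
    using *[of n m] *[of m n] that abs_diff_commute[OF s s, of m n] by (cases "n \<le> m") auto
  then show "\<exists>N. \<forall>m\<ge>N. \<forall>n\<ge>N. \<nu> (s m \<ominus> s n) < e" by blast
qed

text \<open>A single functional equation over a frame. \<open>u\<close> inverts
  \<open>1 - a_0\<close>, and \<open>decay\<close> is the exponential bound that the limsup
  condition supplies.\<close>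

locale affine_frame = cring A for A (structure) +
  fixes p :: nat and F :: "'a frame" and a b :: "nat \<Rightarrow> 'a" and u :: 'a
  assumes p_ge_2: "2 \<le> p"
    and frame: "is_frame p A F"
    and a_closed: "\<And>k. k < p \<Longrightarrow> a k \<in> carrier A"
    and b_closed: "\<And>k. k < p \<Longrightarrow> b k \<in> carrier A"
    and u_closed: "u \<in> carrier A"
    and u_inverse: "(\<one> \<ominus> a 0) \<otimes> u = \<one>"
    and decay: "\<And>z. z \<in> frame_dom F \<Longrightarrow>
      \<exists>C r. 0 \<le> r \<and> r < 1 \<and> (\<forall>n. (\<Prod>i<n. frame_abs F z (a (z i))) \<le> C * r ^ n)"
begin

lemma p_pos: "0 < p"
  using p_ge_2 by simp

lemma dom_Zp: "z \<in> frame_dom F \<Longrightarrow> z \<in> Zp p"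
  and dom_theta: "z \<in> frame_dom F \<Longrightarrow> theta z \<in> frame_dom F"
  and dom_digits: "digits p m \<in> frame_dom F"
  and frame_theta: "z \<in> frame_dom F \<Longrightarrow> x \<in> carrier A \<Longrightarrow> frame_abs F z x = frame_abs F (theta z) x"
  using frame unfolding is_frame_def by blast+

lemma valued: "z \<in> frame_dom F \<Longrightarrow> valued_ring A (frame_abs F z)"
  using frame unfolding is_frame_def by unfold_locales blast

text \<open>Because of this the values at \<open>z\<close> and at \<open>theta z\<close> lie in the
  same completion and the functional equation makes sense.\<close>

lemma completion_theta:
  assumes "z \<in> frame_dom F"
  shows "completion A (frame_abs F (theta z)) = completion A (frame_abs F z)"
    and "compl_emb A (frame_abs F (theta z)) = compl_emb A (frame_abs F z)"
    and "valued_ring.cls A (frame_abs F (theta z)) = valued_ring.cls A (frame_abs F z)"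
proof -
  have eq: "frame_abs F (theta z) x = frame_abs F z x" if "x \<in> carrier A" for x
    using frame_theta[OF assms that] by simp
  show "completion A (frame_abs F (theta z)) = completion A (frame_abs F z)"
    "compl_emb A (frame_abs F (theta z)) = compl_emb A (frame_abs F z)"
    using completion_cong[OF abelian_group_axioms eq] by auto
  show "valued_ring.cls A (frame_abs F (theta z)) = valued_ring.cls A (frame_abs F z)"
    using cauchy_ring_cong[OF abelian_group_axioms eq] null_seqs_cong[OF abelian_group_axioms eq]
    by (simp add: fun_eq_iff valued_ring.cls_def[OF valued] assms dom_theta)
qed

text \<open>A_N and, below, B_N once more, now in a ring given by a record;
  \<open>hom_aprod_aseries\<close> compares them with the versions in a field.\<close>

primrec aprod :: "nat \<Rightarrow> (nat \<Rightarrow> nat) \<Rightarrow> 'a" where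
  "aprod 0 = (\<lambda>z. \<one>)"
| "aprod (Suc n) = (\<lambda>z. a (z 0) \<otimes> aprod n (theta z))"

primrec aseries :: "nat \<Rightarrow> (nat \<Rightarrow> nat) \<Rightarrow> 'a" where
  "aseries 0 = (\<lambda>z. \<zero>)"
| "aseries (Suc n) = (\<lambda>z. a (z 0) \<otimes> aseries n (theta z) \<oplus> b (z 0))"

lemma coeff_closed: "z \<in> Zp p \<Longrightarrow> a (z n) \<in> carrier A" "z \<in> Zp p \<Longrightarrow> b (z n) \<in> carrier A"
  using a_closed b_closed by (auto simp: Zp_def)

lemma aprod_closed: "z \<in> Zp p \<Longrightarrow> aprod n z \<in> carrier A"
  by (induction n arbitrary: z) (simp_all add: coeff_closed theta_Zp)

lemma aseries_closed: "z \<in> Zp p \<Longrightarrow> aseries n z \<in> carrier A"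
  by (induction n arbitrary: z) (simp_all add: coeff_closed theta_Zp)

text \<open>\<open>aseries\<close> is defined by prepending a digit, but convergence depends on the
  effect of appending one.\<close>

lemma aseries_Suc_diff:
  assumes "z \<in> Zp p"
  shows "aseries (Suc n) z \<ominus> aseries n z = aprod n z \<otimes> b (z n)"
  using assms
proof (induction n arbitrary: z)
  case 0
  then show ?case by (simp add: coeff_closed a_minus_def)
next
  case (Suc n)
  have "aseries (Suc (Suc n)) z \<ominus> aseries (Suc n) z
      = a (z 0) \<otimes> (aseries (Suc n) (theta z) \<ominus> aseries n (theta z))"
    unfolding aseries.simps(2)[of "Suc n"] aseries.simps(2)[of n]
    using coeff_closed[OF Suc.prems] coeff_closed[OF theta_Zp[OF Suc.prems]] aseries_closed[OF theta_Zp[OF theta_Zp[OF Suc.prems]]]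
      aseries_closed[OF theta_Zp[OF Suc.prems]]
    by algebra
  also have "\<dots> = aprod (Suc n) z \<otimes> b (z (Suc n))"
    using Suc.IH[OF theta_Zp[OF Suc.prems]] Suc.prems
    by (simp add: m_assoc coeff_closed aprod_closed theta_Zp coeff_closed[OF theta_Zp]) (simp add: theta_def)
  finally show ?case .
qed

lemma abs_aprod:
  assumes "valued_ring A \<nu>" "z \<in> Zp p"
  shows "\<nu> (aprod n z) = (\<Prod>i<n. \<nu> (a (z i)))"
  using assms(2)
proof (induction n arbitrary: z)
  case 0
  then show ?case by (simp add: valued_ring.abs_one[OF assms(1)])
next
  case (Suc n)
  then show ?case
    unfolding prod.lessThan_Suc_shift
    by (simp add: valued_ring.abs_mult[OF assms(1)] coeff_closed aprod_closed theta_Zp) (simp add: theta_def)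
qed

lemma aprod_decay:
  assumes z: "z \<in> frame_dom F"
  shows "\<exists>C r. 1 \<le> C \<and> 0 \<le> r \<and> r < 1 \<and> (\<forall>n. frame_abs F z (aprod n z) \<le> C * r ^ n)"
proof -
  obtain C r where r: "0 \<le> r" "r < 1" "\<And>n. (\<Prod>i<n. frame_abs F z (a (z i))) \<le> C * r ^ n"
    using decay[OF z] by blast
  have "frame_abs F z (aprod n z) \<le> max 1 C * r ^ n" for n
  proof -
    have "C * r ^ n \<le> max 1 C * r ^ n" using r by (intro mult_right_mono) auto
    then show ?thesis using abs_aprod[OF valued[OF z] dom_Zp[OF z]] r(3)[of n] by simp
  qed
  then show ?thesis using r by (intro exI[of _ "max 1 C"] exI[of _ r]) auto
qed

lemma abs_aprod_tendsto:
  assumes z: "z \<in> frame_dom F" and x: "\<And>n. x n \<in> carrier A" "\<And>n. frame_abs F z (x n) \<le> D"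
  shows "(\<lambda>n. frame_abs F z (aprod n z \<otimes> x n)) \<longlonglongrightarrow> 0"
proof -
  interpret V: valued_ring A "frame_abs F z" by (rule valued[OF z])
  obtain C r where C: "1 \<le> C" "0 \<le> r" "r < 1" "\<And>n. frame_abs F z (aprod n z) \<le> C * r ^ n"
    using aprod_decay[OF z] by blast
  have "(\<lambda>n. C * r ^ n * D) \<longlonglongrightarrow> C * 0 * D" using C by (intro tendsto_intros LIMSEQ_power_zero) auto
  then have lim: "(\<lambda>n. C * r ^ n * D) \<longlonglongrightarrow> 0" by simp
  have cl: "aprod n z \<in> carrier A" for n using z by (simp add: aprod_closed dom_Zp)
  have "frame_abs F z (aprod n z \<otimes> x n) \<le> C * r ^ n * D" for n
    using C x cl by (simp add: V.abs_mult mult_mono V.abs_nonneg)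
  then show ?thesis
    using V.abs_nonneg cl x by (intro tendsto_sandwich[OF always_eventually always_eventually tendsto_const lim]) auto
qed

lemma coeff_bounded:
  assumes z: "z \<in> frame_dom F"
  shows "\<exists>D. 0 \<le> D \<and> (\<forall>n. frame_abs F z (b (z n)) \<le> D)"
proof -
  interpret V: valued_ring A "frame_abs F z" by (rule valued[OF z])
  have "frame_abs F z (b (z n)) \<le> (\<Sum>k<p. frame_abs F z (b k))" for n
    using dom_Zp[OF z] by (intro member_le_sum) (auto simp: Zp_def V.abs_nonneg b_closed)
  moreover have "0 \<le> (\<Sum>k<p. frame_abs F z (b k))" by (intro sum_nonneg) (auto simp: V.abs_nonneg b_closed)
  ultimately show ?thesis by blast
qed

lemma aseries_Cauchy:
  assumes z: "z \<in> frame_dom F"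
  shows "(\<lambda>n. aseries n z) \<in> carrier (cauchy_ring A (frame_abs F z))"
proof -
  interpret V: valued_ring A "frame_abs F z" by (rule valued[OF z])
  obtain C r where C: "1 \<le> C" "0 \<le> r" "r < 1" "\<And>n. frame_abs F z (aprod n z) \<le> C * r ^ n"
    using aprod_decay[OF z] by blast
  obtain D where D: "0 \<le> D" "\<And>n. frame_abs F z (b (z n)) \<le> D" using coeff_bounded[OF z] by blast
  note zp = dom_Zp[OF z]
  show ?thesis
  proof (rule V.geometric_CR[where D = "C * D", OF aseries_closed[OF zp] C(2,3)])
    fix n
    have "frame_abs F z (aprod n z) * frame_abs F z (b (z n)) \<le> C * r ^ n * D"
      using C D by (intro mult_mono) (auto simp: V.abs_nonneg coeff_closed zp)
    then show "frame_abs F z (aseries (Suc n) z \<ominus> aseries n z) \<le> C * D * r ^ n"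
      unfolding aseries_Suc_diff[OF zp] by (simp add: V.abs_mult aprod_closed coeff_closed zp mult_ac)
  qed
qed

definition solves :: "((nat \<Rightarrow> nat) \<Rightarrow> (nat \<Rightarrow> 'a) set) \<Rightarrow> bool" where
  "solves f \<longleftrightarrow> (\<forall>z\<in>frame_dom F. f z =
     compl_emb A (frame_abs F z) (a (z 0)) \<otimes>\<^bsub>compl_at A F z\<^esub> f (theta z)
       \<oplus>\<^bsub>compl_at A F z\<^esub> compl_emb A (frame_abs F z) (b (z 0)))"

text \<open>The value at the natural number 0, that is, the solution of x = a_0 x + b_0.\<close>

abbreviation (input) "x0 \<equiv> u \<otimes> b 0"

text \<open>The value of a solution at the truncation of \<open>z\<close> to \<open>n\<close>
  digits: the maps of these digits applied to the value at 0.\<close>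

definition approx :: "nat \<Rightarrow> (nat \<Rightarrow> nat) \<Rightarrow> 'a" where
  "approx n z = aseries n z \<oplus> aprod n z \<otimes> x0"

lemma x0_closed: "x0 \<in> carrier A"
  using u_closed b_closed p_pos by simp

lemma approx_closed: "z \<in> Zp p \<Longrightarrow> approx n z \<in> carrier A"
  using x0_closed by (simp add: approx_def aseries_closed aprod_closed)

lemma approx_0: "approx 0 z = x0"
  using x0_closed by (simp add: approx_def)

lemma approx_Suc:
  assumes "z \<in> Zp p"
  shows "approx (Suc n) z = a (z 0) \<otimes> approx n (theta z) \<oplus> b (z 0)"
  unfolding approx_def aseries.simps aprod.simps
  using coeff_closed[OF assms] aseries_closed[OF theta_Zp[OF assms], of n] aprod_closed[OF theta_Zp[OF assms], of n] x0_closed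
  by algebra

lemma approx_cong:
  assumes "\<forall>i<n. z i = z' i"
  shows "approx n z = approx n z'"
proof -
  have "aseries n z = aseries n z' \<and> aprod n z = aprod n z'"
    using assms
  proof (induction n arbitrary: z z')
    case (Suc n)
    have "z 0 = z' 0" "\<forall>i<n. theta z i = theta z' i" using Suc.prems by (auto simp: theta_def)
    then show ?case using Suc.IH[of "theta z" "theta z'"] by simp
  qed simp
  then show ?thesis by (simp add: approx_def)
qed

text \<open>At \<open>0\<close> the equation reads \<open>(1 - a\<^sub>0) f(0) = b\<^sub>0\<close>, and \<open>u\<close> is an inverse of \<open>1 - a\<^sub>0\<close>; the
  values at the other natural numbers follow digit by digit.\<close>

lemma solves_digits:
  assumes f: "f \<in> CF A F" "solves f" and m: "m < p ^ n"
  shows "f (digits p m) = compl_emb A (frame_abs F (digits p m)) (approx n (digits p m))"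
  using m
proof (induction n arbitrary: m)
  case 0
  define z where "z = digits p 0"
  have z: "z \<in> frame_dom F" by (simp add: z_def dom_digits)
  interpret V: valued_ring A "frame_abs F z" by (rule valued[OF z])
  interpret C: cring "compl_at A F z" by (rule V.cring_completion)
  have th: "theta z = z" "z 0 = 0" by (auto simp: z_def digits_0 theta_def)
  obtain s where s: "s \<in> carrier V.CR" "f z = V.cls s"
    using PiE_mem[OF f(1)[unfolded CF_def] z] by (auto simp: V.carrier_completion)
  have eq: "V.cls s = V.cls (\<lambda>n. a 0 \<otimes> s n \<oplus> b 0)"
  proof -
    have "f z = compl_emb A (frame_abs F z) (a 0) \<otimes>\<^bsub>compl_at A F z\<^esub> f z
       \<oplus>\<^bsub>compl_at A F z\<^esub> compl_emb A (frame_abs F z) (b 0)"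
      using f(2) z th unfolding solves_def by metis
    then show ?thesis
      using s p_pos by (simp add: V.compl_emb_cls V.cls_mult V.cls_add V.CR_const V.CR_mult a_closed b_closed)
  qed
  note cl = a_closed[OF p_pos] b_closed[OF p_pos] u_closed V.CR_closed[OF s(1)]
  have c1: "(\<lambda>n. a 0 \<otimes> s n \<oplus> b 0) \<in> carrier V.CR"
    using V.CR_add[OF V.CR_mult[OF V.CR_const s(1)] V.CR_const] cl by simp
  have "(\<lambda>n. frame_abs F z (s n \<ominus> (a 0 \<otimes> s n \<oplus> b 0))) \<longlonglongrightarrow> 0"
    using eq V.cls_eq_iff[OF s(1) c1] by simp
  \<comment> \<open>Multiplication by \<open>u\<close> turns the null sequence of the equation into
    the distance of \<open>s\<close> from \<open>x0\<close>.\<close>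
  then have "(\<lambda>n. frame_abs F z u * frame_abs F z (s n \<ominus> (a 0 \<otimes> s n \<oplus> b 0))) \<longlonglongrightarrow> frame_abs F z u * 0"
    by (intro tendsto_intros)
  moreover have "frame_abs F z u * frame_abs F z (s n \<ominus> (a 0 \<otimes> s n \<oplus> b 0)) = frame_abs F z (s n \<ominus> x0)" for n
  proof -
    have "u \<otimes> (s n \<ominus> (a 0 \<otimes> s n \<oplus> b 0)) = ((\<one> \<ominus> a 0) \<otimes> u) \<otimes> s n \<ominus> x0"
      using cl by algebra
    also have "\<dots> = s n \<ominus> x0" using cl by (simp add: u_inverse)
    finally have "u \<otimes> (s n \<ominus> (a 0 \<otimes> s n \<oplus> b 0)) = s n \<ominus> x0" .
    then show ?thesis using cl by (simp flip: V.abs_mult)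
  qed
  ultimately have "V.cls s = V.cls (\<lambda>n. x0)"
    using V.cls_eq_iff[OF s(1) V.CR_const[OF x0_closed]] by simp
  then show ?case using 0 s by (simp add: z_def approx_0 valued_ring.compl_emb_cls[OF valued[OF dom_digits]])
next
  case (Suc n)
  define z where "z = digits p m"
  have z: "z \<in> frame_dom F" by (simp add: z_def dom_digits)
  have zp: "z \<in> Zp p" by (rule dom_Zp[OF z])
  have tz: "theta z = digits p (m div p)" by (simp add: z_def theta_digits)
  interpret V: valued_ring A "frame_abs F z" by (rule valued[OF z])
  have "m div p < p ^ n" using Suc.prems p_pos by (simp add: less_mult_imp_div_less mult.commute)
  then have "f (theta z) = compl_emb A (frame_abs F (theta z)) (approx n (theta z))"
    unfolding tz by (rule Suc.IH)
  then have "f (theta z) = compl_emb A (frame_abs F z) (approx n (theta z))"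
    by (simp add: completion_theta[OF z])
  then have "f z = V.cls (\<lambda>_. a (z 0) \<otimes> approx n (theta z) \<oplus> b (z 0))"
    using f(2) z zp unfolding solves_def
    by (simp add: V.compl_emb_cls V.cls_mult V.cls_add V.CR_const coeff_closed approx_closed theta_Zp)
  then show ?case unfolding z_def[symmetric] by (simp add: approx_Suc[OF zp] V.compl_emb_cls)
qed

lemma approx_tendsto:
  assumes z: "z \<in> frame_dom F"
  shows "(\<lambda>n. frame_abs F z (approx n z \<ominus> aseries n z)) \<longlonglongrightarrow> 0"
proof -
  have "approx n z \<ominus> aseries n z = aprod n z \<otimes> x0" for n
    unfolding approx_def using aseries_closed[OF dom_Zp[OF z], of n] aprod_closed[OF dom_Zp[OF z], of n] x0_closed
    by algebra
  then show ?thesis using abs_aprod_tendsto[OF z x0_closed order_refl] by simp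
qed

lemma digits_trunc_approx:
  assumes z: "z \<in> frame_dom F"
  shows "approx n (digits p (trunc p n z)) = approx n z"
  using digits_trunc[OF dom_Zp[OF z]] by (intro approx_cong) simp

text \<open>The values at truncations are embedded elements of \<open>A\<close>, so
  \<open>same_elem\<close> leaves exactly one candidate for each term of the sequence. Its terms
  differ from \<open>aseries\<close> by a null sequence, so the limit is the class of
  \<open>aseries\<close>.\<close>

lemma rising_continuous_iff:
  assumes f: "f \<in> CF A F" "solves f"
  shows "rising_continuous p A F f \<longleftrightarrow>
    (\<forall>z\<in>frame_dom F. f z = valued_ring.cls A (frame_abs F z) (\<lambda>n. aseries n z))"
proof -
  have same: "same_elem A (frame_abs F (digits p (trunc p n z))) (frame_abs F z) (f (digits p (trunc p n z))) c
      \<longleftrightarrow> c = compl_emb A (frame_abs F z) (approx n z)" if z: "z \<in> frame_dom F" for z n c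
  proof -
    define y where "y = digits p (trunc p n z)"
    have fy: "f y = compl_emb A (frame_abs F y) (approx n z)"
      unfolding y_def using solves_digits[OF f, of "trunc p n z" n] trunc_less[OF dom_Zp[OF z]]
      by (simp add: digits_trunc_approx[OF z])
    interpret Y: valued_ring A "frame_abs F y" by (rule valued) (simp add: y_def dom_digits)
    have cl: "approx n z \<in> carrier A" using approx_closed dom_Zp[OF z] by simp
    \<comment> \<open>First alternative of \<open>same_elem\<close>: absolute values that agree on
      the carrier have the same completion and embedding.\<close>
    have 1: "c = compl_emb A (frame_abs F z) (approx n z)"
      if "\<forall>x\<in>carrier A. frame_abs F y x = frame_abs F z x" "f y = c"
    proof -
      have "compl_emb A (frame_abs F y) = compl_emb A (frame_abs F z)"
        using that(1) by (intro completion_cong(2)[OF abelian_group_axioms]) blast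
      then show ?thesis using that(2) fy by simp
    qed
    have 2: "c = compl_emb A (frame_abs F z) (approx n z)"
      if "x \<in> carrier A" "f y = compl_emb A (frame_abs F y) x" "c = compl_emb A (frame_abs F z) x" for x
      using that fy Y.compl_emb_eq_iff[OF cl that(1)] by simp
    show ?thesis
      unfolding same_elem_def y_def[symmetric]
    proof
      assume "c = compl_emb A (frame_abs F z) (approx n z)"
      then show "(\<forall>x\<in>carrier A. frame_abs F y x = frame_abs F z x) \<and> f y = c \<or>
          (\<exists>x\<in>carrier A. f y = compl_emb A (frame_abs F y) x \<and> c = compl_emb A (frame_abs F z) x)"
        using fy cl by (intro disjI2 bexI[of _ "approx n z"] conjI)
    qed (elim disjE bexE conjE, erule (1) 1, erule (2) 2)
  qed
  have "(\<exists>g. (\<forall>n. same_elem A (frame_abs F (digits p (trunc p n z))) (frame_abs F z) (f (digits p (trunc p n z))) (g n)) \<and>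
      (\<lambda>n. compl_norm (frame_abs F z) (g n \<ominus>\<^bsub>compl_at A F z\<^esub> f z)) \<longlonglongrightarrow> 0)
    \<longleftrightarrow> f z = valued_ring.cls A (frame_abs F z) (\<lambda>n. aseries n z)" (is "?L \<longleftrightarrow> ?R") if z: "z \<in> frame_dom F" for z
  proof -
    interpret V: valued_ring A "frame_abs F z" by (rule valued[OF z])
    note zp = dom_Zp[OF z]
    obtain s where s: "s \<in> carrier V.CR" "f z = V.cls s"
      using PiE_mem[OF f(1)[unfolded CF_def] z] by (auto simp: V.carrier_completion)
    note cl = approx_closed[OF zp] aseries_closed[OF zp] V.CR_closed[OF s(1)]
    have "?L \<longleftrightarrow> (\<lambda>n. compl_norm (frame_abs F z)
        (compl_emb A (frame_abs F z) (approx n z) \<ominus>\<^bsub>compl_at A F z\<^esub> f z)) \<longlonglongrightarrow> 0"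
      (is "_ \<longleftrightarrow> ?lim")
    proof
      assume ?L
      then obtain g where g: "\<forall>n. g n = compl_emb A (frame_abs F z) (approx n z)"
          "(\<lambda>n. compl_norm (frame_abs F z) (g n \<ominus>\<^bsub>compl_at A F z\<^esub> f z)) \<longlonglongrightarrow> 0"
        unfolding same[OF z] by blast
      then show ?lim by simp
    next
      assume ?lim
      then show ?L unfolding same[OF z]
        by (intro exI[of _ "\<lambda>n. compl_emb A (frame_abs F z) (approx n z)"]) simp
    qed
    also have "\<dots> \<longleftrightarrow> (\<lambda>n. frame_abs F z (approx n z \<ominus> s n)) \<longlonglongrightarrow> 0"
      unfolding s(2) using cl s(1) by (intro V.compl_norm_tendsto_iff) auto
    also have "\<dots> \<longleftrightarrow> (\<lambda>n. frame_abs F z (s n \<ominus> aseries n z)) \<longlonglongrightarrow> 0"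
    proof
      assume "(\<lambda>n. frame_abs F z (approx n z \<ominus> s n)) \<longlonglongrightarrow> 0"
      then have "(\<lambda>n. frame_abs F z (s n \<ominus> approx n z)) \<longlonglongrightarrow> 0"
        using cl by (simp add: V.abs_diff_commute)
      from V.tendsto_diff_trans[OF _ _ _ this approx_tendsto[OF z]]
      show "(\<lambda>n. frame_abs F z (s n \<ominus> aseries n z)) \<longlonglongrightarrow> 0" using cl by blast
    next
      assume "(\<lambda>n. frame_abs F z (s n \<ominus> aseries n z)) \<longlonglongrightarrow> 0"
      then have "(\<lambda>n. frame_abs F z (aseries n z \<ominus> s n)) \<longlonglongrightarrow> 0"
        using cl by (simp add: V.abs_diff_commute)
      from V.tendsto_diff_trans[OF _ _ _ approx_tendsto[OF z] this]
      show "(\<lambda>n. frame_abs F z (approx n z \<ominus> s n)) \<longlonglongrightarrow> 0" using cl by blast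
    qed
    also have "\<dots> \<longleftrightarrow> ?R"
      unfolding s(2) V.cls_eq_iff[OF s(1) aseries_Cauchy[OF z]] ..
    finally show ?thesis .
  qed
  from ball_cong[OF refl this] show ?thesis
    unfolding rising_continuous_def using f(1) by (simp only: simp_thms)
qed

theorem ex1_rising_continuous: "\<exists>!f. rising_continuous p A F f \<and> solves f"
proof (rule ex_ex1I)
  define f where "f = (\<lambda>z\<in>frame_dom F. valued_ring.cls A (frame_abs F z) (\<lambda>n. aseries n z))"
  have CF: "f \<in> CF A F"
    unfolding CF_def f_def by (auto intro!: valued_ring.cls_closed valued aseries_Cauchy)
  have "solves f"
    unfolding solves_def
  proof
    fix z assume z: "z \<in> frame_dom F"
    interpret V: valued_ring A "frame_abs F z" by (rule valued[OF z])
    note zp = dom_Zp[OF z]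
    have ft: "f (theta z) = V.cls (\<lambda>n. aseries n (theta z))"
      using z by (simp add: f_def dom_theta completion_theta[OF z])
    have tC: "(\<lambda>n. aseries n (theta z)) \<in> carrier V.CR"
      using aseries_Cauchy[OF dom_theta[OF z]] cauchy_ring_cong[OF abelian_group_axioms frame_theta[OF z]] by simp
    have SC: "(\<lambda>n. aseries (Suc n) z) \<in> carrier V.CR"
      using V.CR_add[OF V.CR_mult[OF V.CR_const tC] V.CR_const] coeff_closed[OF zp] by simp
    obtain D where D: "0 \<le> D" "\<And>n. frame_abs F z (b (z n)) \<le> D" using coeff_bounded[OF z] by blast
    \<comment> \<open>Shifting the series by one index does not change its class, for the difference
      carries the decaying factor A_n.\<close>
    have "(\<lambda>n. frame_abs F z (aseries (Suc n) z \<ominus> aseries n z)) \<longlonglongrightarrow> 0"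
      unfolding aseries_Suc_diff[OF zp] using coeff_closed[OF zp] D by (intro abs_aprod_tendsto[OF z]) auto
    then have "f z = V.cls (\<lambda>n. aseries (Suc n) z)"
      using V.cls_eq_iff[OF SC aseries_Cauchy[OF z]] z by (simp add: f_def)
    then show "f z = compl_emb A (frame_abs F z) (a (z 0)) \<otimes>\<^bsub>compl_at A F z\<^esub> f (theta z)
       \<oplus>\<^bsub>compl_at A F z\<^esub> compl_emb A (frame_abs F z) (b (z 0))"
      unfolding ft using tC coeff_closed[OF zp]
      by (simp add: V.compl_emb_cls V.cls_mult V.cls_add V.CR_const V.CR_mult)
  qed
  moreover from this have "rising_continuous p A F f"
    using rising_continuous_iff[OF CF] by (simp add: f_def)
  ultimately show "\<exists>f. rising_continuous p A F f \<and> solves f" by blast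
next
  fix f g
  assume f: "rising_continuous p A F f \<and> solves f" and g: "rising_continuous p A F g \<and> solves g"
  then have CF: "f \<in> CF A F" "g \<in> CF A F" by (auto simp: rising_continuous_def)
  have "f z = g z" if "z \<in> frame_dom F" for z
    using f g rising_continuous_iff[OF CF(1)] rising_continuous_iff[OF CF(2)] that by simp
  then show "f = g" using CF unfolding CF_def by (rule PiE_ext[rotated 2])
qed

end

section \<open>Polynomial rings with coefficients in a subring\<close>

definition subring_set :: "'c::comm_ring_1 set \<Rightarrow> bool" where
  "subring_set S \<longleftrightarrow> 1 \<in> S \<and> (\<forall>x\<in>S. \<forall>y\<in>S. x + y \<in> S \<and> x * y \<in> S) \<and> (\<forall>x\<in>S. - x \<in> S)"

lemma subring_setD:
  assumes "subring_set S"
  shows "1 \<in> S" "x \<in> S \<Longrightarrow> y \<in> S \<Longrightarrow> x + y \<in> S" "x \<in> S \<Longrightarrow> y \<in> S \<Longrightarrow> x * y \<in> S"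
    "x \<in> S \<Longrightarrow> - x \<in> S"
  using assms unfolding subring_set_def by auto

lemma subring_set_zero: "subring_set S \<Longrightarrow> 0 \<in> S"
  using subring_setD(2)[of S 1 "- 1"] subring_setD by fastforce

lemma subring_set_sum:
  assumes "subring_set S" "\<And>i. i \<in> I \<Longrightarrow> f i \<in> S"
  shows "sum f I \<in> S"
  using assms(2)
  by (induction I rule: infinite_finite_induct) (auto simp: subring_setD[OF assms(1)] subring_set_zero[OF assms(1)])

lemma subring_set_diff:
  assumes "subring_set S" "x \<in> S" "y \<in> S"
  shows "x - y \<in> S"
  using subring_setD(2)[OF assms(1,2) subring_setD(4)[OF assms(1,3)]] by simp

lemma poly_mapping_sum_single: "(\<Sum>k\<in>Poly_Mapping.keys f. Poly_Mapping.single k (Poly_Mapping.lookup f k)) = f"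
proof (rule poly_mapping_eqI)
  fix k
  have "Poly_Mapping.lookup (\<Sum>k\<in>Poly_Mapping.keys f. Poly_Mapping.single k (Poly_Mapping.lookup f k)) k
    = (\<Sum>l\<in>Poly_Mapping.keys f. if l = k then Poly_Mapping.lookup f k else 0)"
    unfolding lookup_sum by (intro sum.cong) (auto simp: lookup_single when_def)
  also have "\<dots> = Poly_Mapping.lookup f k" by (simp add: in_keys_iff)
  finally show "Poly_Mapping.lookup (\<Sum>k\<in>Poly_Mapping.keys f. Poly_Mapping.single k (Poly_Mapping.lookup f k)) k
    = Poly_Mapping.lookup f k" .
qed

lemma mult_eq_sum_single:
  "f * g = (\<Sum>k\<in>Poly_Mapping.keys f. \<Sum>l\<in>Poly_Mapping.keys g.
     Poly_Mapping.single (k + l) (Poly_Mapping.lookup f k * Poly_Mapping.lookup g l))"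
  by (subst poly_mapping_sum_single[symmetric, of f], subst poly_mapping_sum_single[symmetric, of g])
    (simp add: sum_product mult_single)

lemma subring_mpolys:
  assumes S: "subring_set S"
  shows "subring_set (mpolys S V)"
  unfolding subring_set_def
proof (intro conjI ballI)
  show "1 \<in> mpolys S V"
    using subring_setD(1)[OF S] subring_set_zero[OF S]
    by (auto simp: mpolys_def lookup_one when_def)
  fix f assume f: "f \<in> mpolys S V"
  show "- f \<in> mpolys S V" using f subring_setD(4)[OF S] by (auto simp: mpolys_def in_keys_iff)
  fix g assume g: "g \<in> mpolys S V"
  have "Poly_Mapping.keys m \<subseteq> V" if "m \<in> Poly_Mapping.keys (f + g)" for m
    using subsetD[OF keys_add that] f g by (auto simp: mpolys_def)
  then show "f + g \<in> mpolys S V"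
    using f g subring_setD(2)[OF S] by (simp add: mpolys_def lookup_add)
  have "Poly_Mapping.lookup (f * g) m \<in> S" for m
    unfolding mult_eq_sum_single lookup_sum lookup_single when_def
    using f g subring_setD(3)[OF S] subring_set_zero[OF S]
    by (intro subring_set_sum[OF S]) (auto simp: mpolys_def)
  moreover have "Poly_Mapping.keys m \<subseteq> V" if m: "m \<in> Poly_Mapping.keys (f * g)" for m
  proof -
    obtain k l where "m = k + l" "k \<in> Poly_Mapping.keys f" "l \<in> Poly_Mapping.keys g" using m keys_mult[of f g] by blast
    then have "Poly_Mapping.keys m \<subseteq> Poly_Mapping.keys k \<union> Poly_Mapping.keys l" "Poly_Mapping.keys k \<subseteq> V" "Poly_Mapping.keys l \<subseteq> V"
      using f g keys_add[of k l] by (auto simp: mpolys_def)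
    then show ?thesis by blast
  qed
  ultimately show "f * g \<in> mpolys S V" by (simp add: mpolys_def)
qed

lemma ring_of_type_simps:
  "x \<otimes>\<^bsub>ring_of_type_algebra\<^esub> y = x * y" "x \<oplus>\<^bsub>ring_of_type_algebra\<^esub> y = x + y"
  "\<one>\<^bsub>ring_of_type_algebra\<^esub> = 1" "\<zero>\<^bsub>ring_of_type_algebra\<^esub> = 0" "carrier ring_of_type_algebra = UNIV"
  by (simp_all add: ring_of_type_algebra_def)

lemma mpoly_ring_simps:
  "x \<otimes>\<^bsub>mpoly_ring S V\<^esub> y = x * y" "x \<oplus>\<^bsub>mpoly_ring S V\<^esub> y = x + y"
  "\<one>\<^bsub>mpoly_ring S V\<^esub> = 1" "\<zero>\<^bsub>mpoly_ring S V\<^esub> = 0" "carrier (mpoly_ring S V) = mpolys S V"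
  by (simp_all add: mpoly_ring_def ring_of_type_algebra_def)

lemma cring_mpoly_ring:
  assumes "subring_set S"
  shows "cring (mpoly_ring S V)"
proof -
  note S = subring_setD[OF subring_mpolys[OF assms, of V]] subring_set_zero[OF subring_mpolys[OF assms, of V]]
  show ?thesis
  proof (rule cringI)
    show "abelian_group (mpoly_ring S V)"
    proof (rule abelian_groupI)
      fix f assume "f \<in> carrier (mpoly_ring S V)"
      then show "\<exists>g\<in>carrier (mpoly_ring S V). g \<oplus>\<^bsub>mpoly_ring S V\<^esub> f = \<zero>\<^bsub>mpoly_ring S V\<^esub>"
        using S(4) by (intro bexI[of _ "- f"]) (auto simp: mpoly_ring_simps)
    qed (use S in \<open>auto simp: mpoly_ring_simps algebra_simps\<close>)
    show "comm_monoid (mpoly_ring S V)"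
      by (rule comm_monoidI) (use S in \<open>auto simp: mpoly_ring_simps algebra_simps\<close>)
  qed (auto simp: mpoly_ring_simps algebra_simps)
qed

lemma mpoly_ring_minus:
  assumes S: "subring_set S" and f: "f \<in> mpolys S V" and g: "g \<in> mpolys S V"
  shows "f \<ominus>\<^bsub>mpoly_ring S V\<^esub> g = f - g"
proof -
  interpret cring "mpoly_ring S V" by (rule cring_mpoly_ring[OF S])
  have "\<ominus>\<^bsub>mpoly_ring S V\<^esub> g = - g"
    using g subring_setD(4)[OF subring_mpolys[OF S] g] by (intro minus_equality) (auto simp: mpoly_ring_simps)
  then show ?thesis by (simp add: a_minus_def mpoly_ring_simps)
qed

lemma mpolys_single_0: "0 \<in> S \<Longrightarrow> x \<in> S \<Longrightarrow> Poly_Mapping.single 0 x \<in> mpolys S V"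
  by (auto simp: mpolys_def lookup_single when_def)

text \<open>Constants embed and the coefficient at 0 extracts them again. In this way the ring
  property of \<open>OK\<close> is read off from the hypothesis that \<open>I\<close> is an ideal of
  \<open>R_ring\<close>.\<close>

lemma subring_coeffs:
  fixes S :: "'a::comm_ring_1 set" and V :: "'b set"
  assumes "ring (mpoly_ring S V)"
  shows "subring_set S"
proof -
  interpret ring "mpoly_ring S V" by fact
  have 0: "0 \<in> S" using zero_closed by (simp add: mpoly_ring_simps mpolys_def)
  have lk: "Poly_Mapping.lookup f 0 \<in> S" if "f \<in> mpolys S V" for f using that by (simp add: mpolys_def)
  have "1 \<in> S" using lk[of 1] one_closed by (simp add: mpoly_ring_simps lookup_one)
  moreover have "x + y \<in> S \<and> x * y \<in> S" if "x \<in> S" "y \<in> S" for x y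
  proof -
    let ?x = "Poly_Mapping.single 0 x :: ('b \<Rightarrow>\<^sub>0 nat) \<Rightarrow>\<^sub>0 'a" and ?y = "Poly_Mapping.single 0 y :: ('b \<Rightarrow>\<^sub>0 nat) \<Rightarrow>\<^sub>0 'a"
    have "?x \<in> mpolys S V" "?y \<in> mpolys S V" using mpolys_single_0[OF 0] that by auto
    then have "?x + ?y \<in> mpolys S V" "?x * ?y \<in> mpolys S V"
      using a_closed[of ?x ?y] m_closed[of ?x ?y] by (simp_all add: mpoly_ring_simps)
    from this[THEN lk] show ?thesis by (simp add: lookup_add mult_single)
  qed
  moreover have "- x \<in> S" if x: "x \<in> S" for x
  proof -
    have "Poly_Mapping.single 0 x \<in> carrier (mpoly_ring S V)" using mpolys_single_0[OF 0 x] by (simp add: mpoly_ring_simps)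
    from l_neg[OF this] a_inv_closed[OF this]
    have "\<ominus>\<^bsub>mpoly_ring S V\<^esub> Poly_Mapping.single 0 x = - Poly_Mapping.single 0 x"
        "\<ominus>\<^bsub>mpoly_ring S V\<^esub> Poly_Mapping.single 0 x \<in> mpolys S V"
      by (auto simp: mpoly_ring_simps eq_neg_iff_add_eq_0)
    then show ?thesis using lk[of "- Poly_Mapping.single 0 x"] by simp
  qed
  ultimately show ?thesis unfolding subring_set_def by blast
qed

definition mpoly_eval :: "'v set \<Rightarrow> ('v \<Rightarrow> 'c::comm_ring_1) \<Rightarrow> (('v \<Rightarrow>\<^sub>0 nat) \<Rightarrow>\<^sub>0 'c) \<Rightarrow> 'c" where
  "mpoly_eval V y f = (\<Sum>m\<in>Poly_Mapping.keys f. Poly_Mapping.lookup f m * (\<Prod>v\<in>V. y v ^ Poly_Mapping.lookup m v))"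

lemma mpoly_eval_add: "mpoly_eval V y (f + g) = mpoly_eval V y f + mpoly_eval V y g"
  unfolding mpoly_eval_def by (rule setsum_keys_plus_distrib) (auto simp: algebra_simps)

lemma mpoly_eval_single: "mpoly_eval V y (Poly_Mapping.single m c) = c * (\<Prod>v\<in>V. y v ^ Poly_Mapping.lookup m v)"
  by (simp add: mpoly_eval_def)

lemma mpoly_eval_sum: "mpoly_eval V y (sum f I) = (\<Sum>i\<in>I. mpoly_eval V y (f i))"
  by (induction I rule: infinite_finite_induct) (simp_all add: mpoly_eval_add, simp_all add: mpoly_eval_def)

lemma mpoly_eval_mult: "mpoly_eval V y (f * g) = mpoly_eval V y f * mpoly_eval V y g"
proof -
  have "mpoly_eval V y (f * g) = (\<Sum>k\<in>Poly_Mapping.keys f. \<Sum>l\<in>Poly_Mapping.keys g.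
    (Poly_Mapping.lookup f k * Poly_Mapping.lookup g l) * (\<Prod>v\<in>V. y v ^ Poly_Mapping.lookup (k + l) v))"
    unfolding mult_eq_sum_single mpoly_eval_sum mpoly_eval_single ..
  also have "\<dots> = mpoly_eval V y f * mpoly_eval V y g"
    unfolding mpoly_eval_def sum_product
    by (intro sum.cong refl) (simp add: lookup_add power_add prod.distrib mult_ac)
  finally show ?thesis .
qed

lemma mpoly_eval_ivar:
  assumes "finite V" "i \<in> V"
  shows "mpoly_eval V y (ivar i) = y i"
proof -
  have "(\<Prod>v\<in>V. y v ^ Poly_Mapping.lookup (Poly_Mapping.single i 1) v) = (\<Prod>v\<in>V. if v = i then y i else 1)"
    by (intro prod.cong) (auto simp: lookup_single when_def)
  then show ?thesis using assms by (simp add: ivar_def mpoly_eval_single)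
qed

lemma mpoly_eval_one: "mpoly_eval V y 1 = 1"
  using mpoly_eval_single[of V y 0 1] by simp

lemma mpoly_eval_diff: "mpoly_eval V y (f - g) = mpoly_eval V y f - mpoly_eval V y g"
  using mpoly_eval_add[of V y "f - g" g] by simp

lemma ivar_mpolys: "subring_set S \<Longrightarrow> i \<in> V \<Longrightarrow> ivar i \<in> mpolys S V"
  by (auto simp: ivar_def mpolys_def lookup_single when_def subring_setD subring_set_zero split: if_splits)

section \<open>The localized quotient ring\<close>

text \<open>Provides the evaluation point for \<open>to_calR_coeff_nonzero\<close>. The field with
  two elements has no such point, so in positive characteristic a transcendental element is taken;
  in characteristic 0 the number 2 will do.\<close>

lemma global_field_nontrivial:
  assumes "global_field TYPE('k::field)"
  shows "\<exists>c::'k. c \<noteq> 0 \<and> c \<noteq> 1"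
proof (cases "CHAR('k) = 0")
  case True
  then have "of_nat 2 \<noteq> (0::'k)" "of_nat 1 \<noteq> (0::'k)" by (auto simp: of_nat_eq_0_iff_char_dvd simp del: of_nat_1 of_nat_numeral)
  then show ?thesis by (intro exI[of _ 2]) (auto, metis add_cancel_right_right one_add_one one_neq_zero)
next
  case False
  then obtain T :: 'k where T: "ring.transcendental ring_of_type_algebra (generate_field ring_of_type_algebra {}) T"
    using assms unfolding global_field_def global_base_def by auto
  interpret R: field "ring_of_type_algebra :: 'k ring" by (rule field_from_type_algebra)
  let ?K = "generate_field ring_of_type_algebra {} :: 'k set"
  have K: "subfield ?K ring_of_type_algebra" by (rule R.generate_field_is_subfield) simp
  then have "subring ?K ring_of_type_algebra" by (rule subfieldE(1))
  from R.algebraic_self[OF this] have "x \<notin> ?K" if "x = T" for x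
    using T that by (auto simp: over_def)
  moreover have "0 \<in> ?K" "1 \<in> ?K"
    using subringE(2,3)[OF subfieldE(1)[OF K]] by (simp_all add: ring_of_type_simps)
  ultimately show ?thesis by (intro exI[of _ T]) auto
qed

locale localized_quotient =
  fixes OK :: "'k::field set" and d p :: nat and I :: "'k ipoly set"
  assumes p_ge_2: "2 \<le> p"
    and subring_OK: "subring_set OK"
    and I_subset: "I \<subseteq> carrier (R_ring OK d p)"
begin

abbreviation "V \<equiv> ab_indets d p \<union> Ind_x ` {1..d}"
abbreviation "Rx \<equiv> Rx_ring OK d p"
abbreviation "lI \<equiv> loc_ideal OK d p"

lemma finite_V: "finite V"
proof -
  have "ab_indets d p = (\<lambda>(j, k). Ind_a j k) ` ({1..d} \<times> {..<p}) \<union> (\<lambda>(j, k). Ind_b j k) ` ({1..d} \<times> {..<p})"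
    by (auto simp: ab_indets_def)
  then show ?thesis by simp
qed

lemma cring_Rx: "cring Rx"
  unfolding Rx_ring_def by (rule cring_mpoly_ring[OF subring_OK])

lemma carrier_Rx: "carrier Rx = mpolys OK V"
  by (simp add: Rx_ring_def mpoly_ring_simps)

lemmas Rx_simps = mpoly_ring_simps(1-4)[of OK V, folded Rx_ring_def]

lemma Rx_minus: "f \<in> carrier Rx \<Longrightarrow> g \<in> carrier Rx \<Longrightarrow> f \<ominus>\<^bsub>Rx\<^esub> g = f - g"
  unfolding Rx_ring_def mpoly_ring_simps by (rule mpoly_ring_minus[OF subring_OK])

lemma ivar_Rx: "i \<in> V \<Longrightarrow> ivar i \<in> carrier Rx"
  unfolding carrier_Rx by (rule ivar_mpolys[OF subring_OK])

lemma coeff_V: "j \<in> {1..d} \<Longrightarrow> k < p \<Longrightarrow> Ind_a j k \<in> V" "j \<in> {1..d} \<Longrightarrow> k < p \<Longrightarrow> Ind_b j k \<in> V"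
  "j \<in> {1..d} \<Longrightarrow> Ind_x j \<in> V"
  by (auto simp: ab_indets_def)

lemmas coeff_Rx = coeff_V[THEN ivar_Rx]

lemmas Rx_closed = subring_setD[OF subring_mpolys[OF subring_OK, of V], folded carrier_Rx]

lemma relation_closed:
  assumes "j \<in> {1..d}"
  shows "(1 - ivar (Ind_a j 0)) * ivar (Ind_x j) \<in> carrier Rx"
    "(1 - ivar (Ind_a j 0)) * ivar (Ind_x j) - 1 \<in> carrier Rx"
proof -
  note D = subring_set_diff[OF subring_mpolys[OF subring_OK, of V], folded carrier_Rx]
  have "ivar (Ind_a j 0) \<in> carrier Rx" "ivar (Ind_x j) \<in> carrier Rx"
    using coeff_Rx(1)[OF assms, of 0] coeff_Rx(3)[OF assms] p_ge_2 by auto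
  then show "(1 - ivar (Ind_a j 0)) * ivar (Ind_x j) \<in> carrier Rx"
    "(1 - ivar (Ind_a j 0)) * ivar (Ind_x j) - 1 \<in> carrier Rx"
    by (auto intro!: Rx_closed D)
qed

lemma ideal_lI: "ideal lI Rx"
proof -
  interpret Rx: cring Rx by (rule cring_Rx)
  show ?thesis unfolding loc_ideal_def using relation_closed by (intro Rx.genideal_ideal) auto
qed

lemma cring_calR: "cring (calR OK d p)"
  unfolding calR_def by (rule ideal.quotient_is_cring[OF ideal_lI cring_Rx])

lemma to_calR_hom: "to_calR OK d p \<in> ring_hom Rx (calR OK d p)"
  using ideal.rcos_ring_hom[OF ideal_lI] by (simp add: calR_def to_calR_def[abs_def])

lemma to_calR_closed: "f \<in> carrier Rx \<Longrightarrow> to_calR OK d p f \<in> carrier (calR OK d p)"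
  using ring_hom_memE(1)[OF to_calR_hom] .

lemma I_Rx: "I \<subseteq> carrier Rx"
  using I_subset unfolding carrier_Rx R_ring_def mpoly_ring_simps by (auto simp: mpolys_def)

lemma ideal_ext: "ideal (ext_ideal OK d p I) (calR OK d p)"
proof -
  interpret calR: cring "calR OK d p" by (rule cring_calR)
  show ?thesis unfolding ext_ideal_def using I_Rx to_calR_closed by (intro calR.genideal_ideal) auto
qed

lemma cring_calQ: "cring (calQ OK d p I)"
  unfolding calQ_def by (rule ideal.quotient_is_cring[OF ideal_ext cring_calR])

lemma to_calQ_hom: "to_calQ OK d p I \<in> ring_hom Rx (calQ OK d p I)"
proof -
  have "to_calQ OK d p I = (\<lambda>f. ext_ideal OK d p I +>\<^bsub>calR OK d p\<^esub> f) \<circ> to_calR OK d p"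
    by (simp add: to_calQ_def fun_eq_iff)
  then show ?thesis
    using ring_hom_trans[OF to_calR_hom ideal.rcos_ring_hom[OF ideal_ext]] by (simp add: calQ_def)
qed

lemma to_calQ_closed: "f \<in> carrier Rx \<Longrightarrow> to_calQ OK d p I f \<in> carrier (calQ OK d p I)"
  using ring_hom_memE(1)[OF to_calQ_hom] .

lemma to_calR_mem_to_calQ:
  assumes "f \<in> carrier Rx"
  shows "to_calR OK d p f \<in> to_calQ OK d p I f"
proof -
  interpret E: ideal "ext_ideal OK d p I" "calR OK d p" by (rule ideal_ext)
  show ?thesis unfolding to_calQ_def by (rule E.a_rcos_self[OF to_calR_closed[OF assms]])
qed

lemma to_calQ_subset:
  assumes "f \<in> carrier Rx"
  shows "to_calQ OK d p I f \<subseteq> carrier (calR OK d p)"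
proof -
  interpret E: ideal "ext_ideal OK d p I" "calR OK d p" by (rule ideal_ext)
  show ?thesis unfolding to_calQ_def
    using E.coset_mem_iff[OF to_calR_closed[OF assms]] by blast
qed

text \<open>This is the defining relation of the localization, pushed forward to the
  quotient.\<close>

lemma to_calQ_inverse:
  assumes j: "j \<in> {1..d}"
  shows "(\<one>\<^bsub>calQ OK d p I\<^esub> \<ominus>\<^bsub>calQ OK d p I\<^esub> to_calQ OK d p I (ivar (Ind_a j 0)))
    \<otimes>\<^bsub>calQ OK d p I\<^esub> to_calQ OK d p I (ivar (Ind_x j)) = \<one>\<^bsub>calQ OK d p I\<^esub>"
proof -
  interpret Rx: cring Rx by (rule cring_Rx)
  interpret h: ring_hom_cring Rx "calQ OK d p I" "to_calQ OK d p I"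
    using cring_Rx cring_calQ to_calQ_hom by (simp add: ring_hom_cring_def ring_hom_cring_axioms_def)
  interpret L: ideal lI Rx by (rule ideal_lI)
  have a: "ivar (Ind_a j 0) \<in> carrier Rx" and x: "ivar (Ind_x j) \<in> carrier Rx"
    using coeff_Rx(1)[OF j, of 0] coeff_Rx(3)[OF j] p_ge_2 by auto
  have one: "1 \<in> carrier Rx" by (rule Rx_closed)
  have "(1 - ivar (Ind_a j 0)) * ivar (Ind_x j) - 1 \<in> lI"
    unfolding loc_ideal_def using j relation_closed by (intro Rx.genideal_self[THEN subsetD]) auto
  then have "to_calR OK d p ((1 - ivar (Ind_a j 0)) * ivar (Ind_x j)) = to_calR OK d p 1"
    unfolding to_calR_def L.coset_eq_iff[OF relation_closed(1)[OF j] one]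
    using Rx_minus[OF relation_closed(1)[OF j] one] by simp
  then have "to_calQ OK d p I ((\<one>\<^bsub>Rx\<^esub> \<ominus>\<^bsub>Rx\<^esub> ivar (Ind_a j 0)) \<otimes>\<^bsub>Rx\<^esub> ivar (Ind_x j)) = to_calQ OK d p I \<one>\<^bsub>Rx\<^esub>"
    using Rx_minus[OF one a] by (simp add: to_calQ_def Rx_simps)
  then show ?thesis using a x by (simp add: a_minus_def)
qed

text \<open>Evaluating every \<open>a\<^bsub>j,k\<^esub>\<close> at \<open>c \<noteq> 0, 1\<close> and every \<open>x\<^sub>j\<close> at \<open>1 / (1 - c)\<close> kills the relations.\<close>

lemma to_calR_coeff_nonzero:
  assumes c: "c \<noteq> 0" "c \<noteq> (1::'k)" and j: "j \<in> {1..d}" "k < p"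
  shows "to_calR OK d p (ivar (Ind_a j k)) \<noteq> \<zero>\<^bsub>calR OK d p\<^esub>"
proof
  assume eq: "to_calR OK d p (ivar (Ind_a j k)) = \<zero>\<^bsub>calR OK d p\<^esub>"
  interpret Rx: cring Rx by (rule cring_Rx)
  interpret L: ideal lI Rx by (rule ideal_lI)
  define y :: "indet \<Rightarrow> 'k" where "y i = (case i of Ind_x _ \<Rightarrow> 1 / (1 - c) | _ \<Rightarrow> c)" for i
  \<comment> \<open>The kernel of the evaluation: an ideal that contains the relations but none of
    the \<open>Ind_a\<close> variables.\<close>
  define N where "N = {f \<in> carrier Rx. mpoly_eval V y f = 0}"
  have z: "mpoly_eval V y 0 = 0" by (simp add: mpoly_eval_def)
  have "ideal N Rx"
  proof (rule idealI[OF Rx.ring_axioms])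
    show "subgroup N (add_monoid Rx)"
    proof (rule Rx.add.subgroupI)
      show "N \<noteq> {}" using z Rx.zero_closed by (auto simp: N_def Rx_simps)
      fix f assume f: "f \<in> N"
      then have fc: "f \<in> carrier Rx" by (simp add: N_def)
      have "\<ominus>\<^bsub>Rx\<^esub> f = - f"
        using Rx_minus[OF Rx.zero_closed fc] fc by (simp add: Rx_simps a_minus_def)
      then show "\<ominus>\<^bsub>Rx\<^esub> f \<in> N"
        using f mpoly_eval_diff[of V y 0 f] z Rx_closed(4)[OF fc] by (simp add: N_def)
    qed (auto simp: N_def Rx_simps mpoly_eval_add intro: Rx_closed)
  qed (auto simp: N_def Rx_simps mpoly_eval_mult intro: Rx_closed)
  moreover have "(\<lambda>j. (1 - ivar (Ind_a j 0)) * ivar (Ind_x j) - 1) ` {1..d} \<subseteq> N"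
  proof (rule image_subsetI)
    fix i assume i: "i \<in> {1..d}"
    have "mpoly_eval V y (ivar (Ind_a i 0)) = c" "mpoly_eval V y (ivar (Ind_x i)) = 1 / (1 - c)"
      using mpoly_eval_ivar[OF finite_V coeff_V(1)[OF i, of 0], of y] mpoly_eval_ivar[OF finite_V coeff_V(3)[OF i], of y] p_ge_2
      by (simp_all add: y_def)
    then show "(1 - ivar (Ind_a i 0)) * ivar (Ind_x i) - 1 \<in> N"
      using c relation_closed(2)[OF i] by (simp add: N_def mpoly_eval_diff mpoly_eval_mult mpoly_eval_one)
  qed
  ultimately have "lI \<subseteq> N" unfolding loc_ideal_def by (rule Rx.genideal_minimal)
  moreover have "ivar (Ind_a j k) \<in> lI"
  proof -
    have a: "ivar (Ind_a j k) \<in> carrier Rx" by (rule coeff_Rx(1)[OF j])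
    have "lI +>\<^bsub>Rx\<^esub> ivar (Ind_a j k) = lI" using eq by (simp add: to_calR_def calR_def FactRing_def)
    then show ?thesis using L.a_rcos_self[OF a] by simp
  qed
  ultimately have "mpoly_eval V y (ivar (Ind_a j k)) = 0" by (auto simp: N_def)
  then show False using c mpoly_eval_ivar[OF finite_V coeff_V(1)[OF j], of y] by (simp add: y_def)
qed

end

section \<open>The decay condition\<close>

text \<open>The digit 0 is excluded since a truncation has infinitely many zero digits.\<close>

lemma digit_count_trunc:
  assumes "z \<in> Zp p" "1 \<le> k"
  shows "digit_count p k (trunc p n z) = card {i\<in>{..<n}. z i = k}"
proof -
  have "{i. digits p (trunc p n z) i = k} = {i\<in>{..<n}. z i = k}"
    using assms(2) by (auto simp: digits_trunc[OF assms(1)] split: if_splits)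
  then show ?thesis by (simp add: digit_count_def)
qed

text \<open>Group the factors by the value of the digit. Taking out \<open>v 0\<close> once per
  factor removes the count of zero digits, and dividing the counts by \<open>n\<close> amounts to an
  n-th root.\<close>

lemma prod_digits_eq:
  fixes v :: "nat \<Rightarrow> real"
  assumes z: "z \<in> Zp p" and p: "2 \<le> p" and v: "\<And>k. k < p \<Longrightarrow> 0 < v k" and n: "0 < n"
  shows "(\<Prod>i<n. v (z i))
    = (v 0 * (\<Prod>k=1..<p. (v k / v 0) powr (real (digit_count p k (trunc p n z)) / real n))) ^ n"
proof -
  have "(\<Prod>i<n. v (z i)) = v 0 ^ n * (\<Prod>i<n. v (z i) / v 0)"
    using v[of 0] p by (simp add: prod_dividef)
  also have "(\<Prod>i<n. v (z i) / v 0) = (\<Prod>k<p. \<Prod>i\<in>{i\<in>{..<n}. z i = k}. v (z i) / v 0)"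
    using z by (intro prod.group[symmetric]) (auto simp: Zp_def)
  also have "\<dots> = (\<Prod>k<p. (v k / v 0) ^ card {i\<in>{..<n}. z i = k})"
    by (intro prod.cong refl) simp
  also have "\<dots> = (\<Prod>k=1..<p. (v k / v 0) ^ card {i\<in>{..<n}. z i = k})"
    using v[of 0] p by (intro prod.mono_neutral_right) (auto simp: not_less_eq_eq)
  also have "\<dots> = (\<Prod>k=1..<p. ((v k / v 0) powr (real (digit_count p k (trunc p n z)) / real n)) ^ n)"
  proof (intro prod.cong refl)
    fix k assume k: "k \<in> {1..<p}"
    then have q: "0 < v k / v 0" using v[of k] v[of 0] p by simp
    define c where "c = card {i\<in>{..<n}. z i = k}"
    have "((v k / v 0) powr (real c / real n)) ^ n = ((v k / v 0) powr (real c / real n)) powr real n"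
      using q by (intro powr_realpow[symmetric]) auto
    also have "\<dots> = (v k / v 0) ^ c" using n q by (simp add: powr_powr powr_realpow)
    finally show "(v k / v 0) ^ card {i\<in>{..<n}. z i = k}
      = ((v k / v 0) powr (real (digit_count p k (trunc p n z)) / real n)) ^ n"
      using k digit_count_trunc[OF z, of k n] by (simp add: c_def)
  qed
  finally show ?thesis by (simp add: power_mult_distrib prod_power_distrib)
qed

text \<open>The root test: eventually the n-th root of \<open>P n\<close> stays below some
  \<open>r < 1\<close>.\<close>

lemma limsup_root_decay:
  fixes P :: "nat \<Rightarrow> real"
  assumes v: "0 < v" and lim: "ereal v * limsup (\<lambda>n. ereal (f n)) < 1"
    and f: "\<And>n. 0 \<le> f n" and P: "\<And>n. 0 < n \<Longrightarrow> P n = (v * f n) ^ n"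
  shows "\<exists>C r. 0 \<le> r \<and> r < 1 \<and> (\<forall>n. P n \<le> C * r ^ n)"
proof -
  have "limsup (\<lambda>n. ereal (f n)) < ereal (1 / v)"
  proof (rule ccontr)
    assume "\<not> ?thesis"
    then have "ereal v * ereal (1 / v) \<le> ereal v * limsup (\<lambda>n. ereal (f n))"
      using v by (intro ereal_mult_left_mono) auto
    then show False using lim v by (simp add: one_ereal_def)
  qed
  then obtain c where c: "limsup (\<lambda>n. ereal (f n)) < ereal c" "ereal c < ereal (1 / v)"
    using ereal_dense2 by blast
  \<comment> \<open>The bound \<open>1 / 2\<close> keeps \<open>r\<close> positive, so that one can
    divide by its powers.\<close>
  define r where "r = max (1 / 2) (v * c)"
  have r: "0 < r" "r < 1" using c(2) v by (auto simp: r_def field_simps)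
  have "\<forall>\<^sub>F n in sequentially. ereal (f n) < ereal c" using c(1) by (rule Limsup_lessD)
  then obtain N where N: "\<And>n. N \<le> n \<Longrightarrow> f n < c" unfolding eventually_sequentially by auto
  \<comment> \<open>The sum covers the finitely many indices up to \<open>N\<close>, the summand 1
    all later ones.\<close>
  define C where "C = 1 + (\<Sum>n\<le>N. \<bar>P n\<bar> / r ^ n)"
  have "P n \<le> C * r ^ n" for n
  proof (cases "n \<le> N")
    case True
    have "\<bar>P n\<bar> / r ^ n \<le> (\<Sum>n\<le>N. \<bar>P n\<bar> / r ^ n)" using True r by (intro member_le_sum) auto
    then have "\<bar>P n\<bar> / r ^ n \<le> C" by (simp add: C_def)
    then have "\<bar>P n\<bar> \<le> C * r ^ n" using r by (simp add: field_simps)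
    then show ?thesis by simp
  next
    case False
    then have "v * f n \<le> r" using N[of n] v by (auto simp: r_def intro!: max.coboundedI2 mult_left_mono)
    then have "P n \<le> r ^ n" using False P[of n] v f by (simp add: power_mono)
    also have "\<dots> \<le> C * r ^ n"
    proof -
      have "0 \<le> (\<Sum>n\<le>N. \<bar>P n\<bar> / r ^ n)" using r by (intro sum_nonneg) auto
      then show ?thesis using r mult_right_mono[of 1 C "r ^ n"] by (simp add: C_def)
    qed
    finally show ?thesis .
  qed
  then show ?thesis using r by (intro exI[of _ C] exI[of _ r]) auto
qed

section \<open>Quasi-integrability\<close>

lemma ring_hom_typeE:
  assumes "\<iota> \<in> ring_hom A ring_of_type_algebra"
  shows "x \<in> carrier A \<Longrightarrow> y \<in> carrier A \<Longrightarrow> \<iota> (x \<otimes>\<^bsub>A\<^esub> y) = \<iota> x * \<iota> y"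
    "x \<in> carrier A \<Longrightarrow> y \<in> carrier A \<Longrightarrow> \<iota> (x \<oplus>\<^bsub>A\<^esub> y) = \<iota> x + \<iota> y"
    "\<iota> \<one>\<^bsub>A\<^esub> = 1"
  using ring_hom_memE[OF assms] by (auto simp: ring_of_type_simps)

lemma (in cring) ring_hom_type_zero:
  fixes \<iota> :: "'a \<Rightarrow> 'l::comm_ring_1"
  assumes "\<iota> \<in> ring_hom R ring_of_type_algebra"
  shows "\<iota> \<zero> = 0"
  using ring_hom_typeE(2)[OF assms zero_closed zero_closed] by simp

lemma (in cring) ring_hom_type_minus:
  fixes \<iota> :: "'a \<Rightarrow> 'l::comm_ring_1"
  assumes "\<iota> \<in> ring_hom R ring_of_type_algebra" "x \<in> carrier R" "y \<in> carrier R"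
  shows "\<iota> (x \<ominus> y) = \<iota> x - \<iota> y"
proof -
  have "x = (x \<ominus> y) \<oplus> y" using assms(2,3) by algebra
  then have "\<iota> x = \<iota> (x \<ominus> y) + \<iota> y"
    using ring_hom_typeE(2)[OF assms(1), of "x \<ominus> y" y] assms(2,3) by simp
  then show ?thesis by simp
qed

text \<open>A representative of the product is followed only through its image under \<iota>, which
  is all that \<open>is_fourier_transform\<close> compares with.\<close>

lemma (in valued_ring) finprod_cls:
  fixes \<iota> :: "'a \<Rightarrow> 'l::field"
  assumes \<iota>: "\<iota> \<in> ring_hom A ring_of_type_algebra" and J: "finite J" and s: "\<And>j. j \<in> J \<Longrightarrow> s j \<in> carrier CR"
  shows "\<exists>t\<in>carrier CR. finprod (completion A \<nu>) (\<lambda>j. cls (s j) [^]\<^bsub>completion A \<nu>\<^esub> n j) J = cls t \<and>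
    (\<forall>m. \<iota> (t m) = (\<Prod>j\<in>J. \<iota> (s j m) ^ n j))"
  using J s
proof (induction J rule: finite_induct)
  case empty
  interpret C: cring "completion A \<nu>" by (rule cring_completion)
  show ?case
    by (intro bexI[of _ "\<lambda>n. \<one>"]) (auto simp: cls_one CR_const ring_hom_typeE(3)[OF \<iota>])
next
  case (insert j J)
  interpret C: cring "completion A \<nu>" by (rule cring_completion)
  obtain t where t: "t \<in> carrier CR" "finprod (completion A \<nu>) (\<lambda>j. cls (s j) [^]\<^bsub>completion A \<nu>\<^esub> n j) J = cls t"
    "\<And>m. \<iota> (t m) = (\<Prod>j\<in>J. \<iota> (s j m) ^ n j)"
    using insert.IH[OF insert.prems[OF insertI2]] by blast
  have sj: "s j \<in> carrier CR" using insert.prems by simp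
  have "\<exists>q\<in>carrier CR. cls (s j) [^]\<^bsub>completion A \<nu>\<^esub> (k::nat) = cls q \<and> (\<forall>m. \<iota> (q m) = \<iota> (s j m) ^ k)" for k
  proof (induction k)
    case 0
    show ?case by (intro bexI[of _ "\<lambda>n. \<one>"]) (auto simp: cls_one CR_const ring_hom_typeE(3)[OF \<iota>])
  next
    case (Suc k)
    then obtain q where q: "q \<in> carrier CR" "cls (s j) [^]\<^bsub>completion A \<nu>\<^esub> k = cls q" "\<And>m. \<iota> (q m) = \<iota> (s j m) ^ k" by blast
    show ?case
      using q sj by (intro bexI[of _ "\<lambda>m. q m \<otimes> s j m"])
        (auto simp: cls_mult CR_mult ring_hom_typeE(1)[OF \<iota>] CR_closed mult.commute)
  qed
  then obtain q where q: "q \<in> carrier CR" "cls (s j) [^]\<^bsub>completion A \<nu>\<^esub> n j = cls q" "\<And>m. \<iota> (q m) = \<iota> (s j m) ^ n j" by blast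
  have "finprod (completion A \<nu>) (\<lambda>j. cls (s j) [^]\<^bsub>completion A \<nu>\<^esub> n j) (insert j J)
    = cls q \<otimes>\<^bsub>completion A \<nu>\<^esub> cls t"
    using insert.hyps insert.prems q t by (subst C.finprod_insert) (auto intro!: C.nat_pow_closed cls_closed)
  then show ?case
    using q t insert.hyps by (intro bexI[of _ "\<lambda>m. q m \<otimes> t m"])
      (auto simp: cls_mult CR_mult ring_hom_typeE(1)[OF \<iota>] CR_closed)
qed

lemma (in affine_frame) hom_aprod_aseries:
  fixes \<iota> :: "'a \<Rightarrow> 'l::comm_ring_1"
  assumes \<iota>: "\<iota> \<in> ring_hom A ring_of_type_algebra" and z: "z \<in> Zp p"
  shows "\<iota> (aprod n z) = digit_prod (\<lambda>k. \<iota> (a k)) n z"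
    and "\<iota> (aseries n z) = digit_series (\<lambda>k. \<iota> (a k)) (\<lambda>k. \<iota> (b k)) n z"
proof -
  note h = ring_hom_typeE[OF \<iota>] ring_hom_type_zero[OF \<iota>]
  show "\<iota> (aprod n z) = digit_prod (\<lambda>k. \<iota> (a k)) n z"
    using z by (induction n arbitrary: z) (simp_all add: h digit_prod_Suc coeff_closed aprod_closed theta_Zp)
  show "\<iota> (aseries n z) = digit_series (\<lambda>k. \<iota> (a k)) (\<lambda>k. \<iota> (b k)) n z"
    using z by (induction n arbitrary: z) (simp_all add: h digit_series_Suc coeff_closed aseries_closed theta_Zp)
qed

text \<open>On the image of \<iota> the extension \<open>w\<close> is the absolute value of the
  frame, so the bounds for slopes and intercepts carry over from the ring to the field.\<close>

lemma is_fourier_transform_Xh: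
  fixes A :: "('a, 'm) ring_scheme" and \<iota> :: "'a \<Rightarrow> 'l::field"
  assumes ts: "transform_system p \<zeta> d (\<lambda>j k. \<iota> (a j k)) (\<lambda>j k. \<iota> (b j k)) Xh"
    and A: "cring A" "is_frame p A F"
    and af: "\<And>j. j \<in> {1..d} \<Longrightarrow> affine_frame A p F (a j) (b j) (u j)"
    and \<iota>: "\<iota> \<in> ring_hom A ring_of_type_algebra"
    and n: "n \<in> multi_indices d"
    and Y: "\<And>z. z \<in> frame_dom F \<Longrightarrow> \<exists>s\<in>carrier (cauchy_ring A (frame_abs F z)).
      Y z = valued_ring.cls A (frame_abs F z) s \<and>
      (\<forall>m. \<iota> (s m) = (\<Prod>j=1..d. digit_series (\<lambda>k. \<iota> (a j k)) (\<lambda>k. \<iota> (b j k)) m z ^ n j))"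
  shows "is_fourier_transform p A F \<iota> \<zeta> Y (Xh n)"
  unfolding is_fourier_transform_def
proof (intro ballI allI impI, elim conjE)
  fix z w s'
  assume z: "z \<in> frame_dom F" and w: "absolute_value ring_of_type_algebra w"
    and w\<iota>: "\<forall>x\<in>carrier A. w (\<iota> x) = frame_abs F z x" and s': "s' \<in> Y z"
  interpret T: transform_system p \<zeta> d "\<lambda>j k. \<iota> (a j k)" "\<lambda>j k. \<iota> (b j k)" Xh by (rule ts)
  interpret W: field_abs w by unfold_locales (rule w)
  interpret A: cring A by (rule A(1))
  have zp: "z \<in> Zp p" and abs: "absolute_value A (frame_abs F z)" using A(2) z unfolding is_frame_def by blast+
  interpret V: valued_ring A "frame_abs F z" by unfold_locales (rule abs)
  obtain s where s: "s \<in> carrier V.CR" "Y z = V.cls s"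
    "\<And>m. \<iota> (s m) = (\<Prod>j=1..d. T.dseries m z j ^ n j)" using Y[OF z] by blast
  have s'C: "s' \<in> carrier V.CR" and s's: "(\<lambda>m. frame_abs F z (s' m \<ominus>\<^bsub>A\<^esub> s m)) \<longlonglongrightarrow> 0"
    using s' s V.mem_cls_iff[OF s(1)] by auto
  note cl = V.CR_closed[OF s(1)] V.CR_closed[OF s'C]
  have w_diff: "w (\<iota> x - \<iota> y) = frame_abs F z (x \<ominus>\<^bsub>A\<^esub> y)" if "x \<in> carrier A" "y \<in> carrier A" for x y
    using w\<iota> that A.ring_hom_type_minus[OF \<iota> that] by (metis A.minus_closed)
  have "\<forall>j\<in>{1..d}. \<exists>C r. 1 \<le> C \<and> 0 \<le> r \<and> r < 1 \<and> (\<forall>N. w (T.dprod N z j) \<le> C * r ^ N)"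
  proof
    fix j assume "j \<in> {1..d}"
    then interpret J: affine_frame A p F "a j" "b j" "u j" by (rule af)
    have "w (T.dprod N z j) = frame_abs F z (J.aprod N z)" for N
      using w\<iota> J.aprod_closed[OF zp] J.hom_aprod_aseries(1)[OF \<iota> zp] by metis
    then show "\<exists>C r. 1 \<le> C \<and> 0 \<le> r \<and> r < 1 \<and> (\<forall>N. w (T.dprod N z j) \<le> C * r ^ N)"
      using J.aprod_decay[OF z] by simp
  qed
  then obtain C r where Cr: "\<And>j. j \<in> {1..d} \<Longrightarrow> 1 \<le> C j" "\<And>j. j \<in> {1..d} \<Longrightarrow> 0 \<le> r j"
    "\<And>j. j \<in> {1..d} \<Longrightarrow> r j < (1::real)" "\<And>j N. j \<in> {1..d} \<Longrightarrow> w (T.dprod N z j) \<le> C j * r j ^ N"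
    by metis
  have "\<forall>j\<in>{1..d}. \<exists>D. 0 < D \<and> (\<forall>N. w (T.dseries N z j) \<le> D)"
  proof
    fix j assume "j \<in> {1..d}"
    then interpret J: affine_frame A p F "a j" "b j" "u j" by (rule af)
    have "w (T.dseries N z j) = frame_abs F z (J.aseries N z)" for N
      using w\<iota> J.aseries_closed[OF zp] J.hom_aprod_aseries(2)[OF \<iota> zp] by metis
    then show "\<exists>D. 0 < D \<and> (\<forall>N. w (T.dseries N z j) \<le> D)"
      using V.CR_bounded[OF J.aseries_Cauchy[OF z]] by simp
  qed
  then obtain D where D: "\<And>j. j \<in> {1..d} \<Longrightarrow> 0 < D j" "\<And>j N. j \<in> {1..d} \<Longrightarrow> w (T.dseries N z j) \<le> D j"
    by metis
  \<comment> \<open>One constant and one rate for all \<open>j\<close>. Inserting 0 below keeps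
    \<open>Max\<close> meaningful for an empty range and the rate nonnegative.\<close>
  define C' where "C' = 1 + (\<Sum>j=1..d. C j) + (\<Sum>j=1..d. D j)"
  define r' where "r' = Max (insert 0 (r ` {1..d}))"
  have r': "0 \<le> r'" "r' < 1" "\<And>j. j \<in> {1..d} \<Longrightarrow> r j \<le> r'"
  proof -
    have fin: "finite (insert 0 (r ` {1..d}))" by simp
    show "0 \<le> r'" unfolding r'_def by (rule Max_ge[OF fin insertI1])
    show "r' < 1" unfolding r'_def using Cr(3) by (subst Max_less_iff[OF fin]) auto
    show "r j \<le> r'" if "j \<in> {1..d}" for j
      unfolding r'_def using that by (intro Max_ge[OF fin] insertI2 imageI)
  qed
  have sums: "0 \<le> (\<Sum>j=1..d. C j)" "0 \<le> (\<Sum>j=1..d. D j)"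
    using Cr(1) D(1) by (auto intro!: sum_nonneg intro: order_trans[OF zero_le_one] less_imp_le)
  have C': "1 \<le> C'" using sums by (simp add: C'_def)
  have CC: "C j \<le> C'" "D j \<le> C'" if j: "j \<in> {1..d}" for j
  proof -
    have "C j \<le> (\<Sum>j=1..d. C j)" "D j \<le> (\<Sum>j=1..d. D j)"
      using j Cr(1) D(1) by (auto intro!: member_le_sum intro: order_trans[OF zero_le_one] less_imp_le)
    then show "C j \<le> C'" "D j \<le> C'" using sums by (auto simp: C'_def)
  qed
  have lim: "(\<lambda>N. w (psum p \<zeta> (Xh n) N z - (\<Prod>j=1..d. T.dseries N z j ^ n j))) \<longlonglongrightarrow> 0"
  proof (rule T.psum_Xh_tendsto[OF w n zp r'(1,2) C'])
    fix j N assume j: "j \<in> {1..d}"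
    have "C j * r j ^ N \<le> C' * r' ^ N"
      using Cr(1,2)[OF j] CC(1)[OF j] r'(3)[OF j] C' by (intro mult_mono power_mono) auto
    then show "w (T.dprod N z j) \<le> C' * r' ^ N" using Cr(4)[OF j, of N] by simp
    show "w (T.dseries N z j) \<le> C'" using D(2)[OF j, of N] CC(2)[OF j] by simp
  qed
  have "(\<lambda>N. w (psum p \<zeta> (Xh n) N z - \<iota> (s' N))) \<longlonglongrightarrow> 0"
  proof (rule tendsto_sandwich[OF always_eventually always_eventually tendsto_const])
    show "(\<lambda>N. w (psum p \<zeta> (Xh n) N z - \<iota> (s N)) + frame_abs F z (s' N \<ominus>\<^bsub>A\<^esub> s N)) \<longlonglongrightarrow> 0"
      using tendsto_add[OF lim s's] by (simp add: s(3))
    show "\<forall>N. w (psum p \<zeta> (Xh n) N z - \<iota> (s' N))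
        \<le> w (psum p \<zeta> (Xh n) N z - \<iota> (s N)) + frame_abs F z (s' N \<ominus>\<^bsub>A\<^esub> s N)"
      using W.triangle_diff W.diff_commute w_diff cl by metis
  qed (simp add: W.nonneg)
  \<comment> \<open>The inner limit over representatives is traded for the diagonal, at a rate given
    by the Cauchy property of \<open>s'\<close>.\<close>
  moreover have "(\<lambda>N. lim (\<lambda>m. w (psum p \<zeta> (Xh n) N z - \<iota> (s' m)))) \<longlonglongrightarrow> 0
      \<longleftrightarrow> (\<lambda>N. w (psum p \<zeta> (Xh n) N z - \<iota> (s' N))) \<longlonglongrightarrow> 0"
  proof (rule lim_diagonal)
    show "\<bar>w (psum p \<zeta> (Xh n) N z - \<iota> (s' m)) - w (psum p \<zeta> (Xh n) N z - \<iota> (s' m'))\<bar>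
        \<le> frame_abs F z (s' m' \<ominus>\<^bsub>A\<^esub> s' m)" for N m m'
      using W.abs_diff_le[of "psum p \<zeta> (Xh n) N z - \<iota> (s' m)" "psum p \<zeta> (Xh n) N z - \<iota> (s' m')"]
        w_diff[OF cl(2) cl(2), of m' m] by simp
    show "\<forall>e>0. \<exists>N. \<forall>m\<ge>N. \<forall>m'\<ge>N. frame_abs F z (s' m' \<ominus>\<^bsub>A\<^esub> s' m) < e"
      using s'C unfolding V.CR_iff by blast
  qed
  ultimately show "(\<lambda>N. lim (\<lambda>m. w ((\<Sum>t | t \<in> hatZ p \<and> tabs p t \<le> p ^ N. Xh n t * pairing p \<zeta> t z) - \<iota> (s' m))))
      \<longlonglongrightarrow> 0"
    by (simp add: psum_def ball_hatZ_def)
qed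

section \<open>The algebra of the distributions\<close>

lemma subfield_subring_set:
  assumes "subfield E (ring_of_type_algebra :: 'l::field ring)"
  shows "subring_set E"
proof -
  interpret R: field "ring_of_type_algebra :: 'l ring" by (rule field_from_type_algebra)
  note S = subringE[OF subfieldE(1)[OF assms], unfolded ring_of_type_simps]
  have "\<ominus>\<^bsub>ring_of_type_algebra\<^esub> x = - x" for x :: 'l
    by (intro R.minus_equality) (simp_all add: ring_of_type_simps)
  then show ?thesis unfolding subring_set_def using S by auto
qed

context distribution_setting
begin

lemma fourier_stieltjes_ext:
  assumes "\<And>t. t \<in> hatZ p \<Longrightarrow> fourier_stieltjes p \<zeta> \<mu> t = h t"
  shows "fourier_stieltjes p \<zeta> \<mu> = (\<lambda>t\<in>hatZ p. h t)"
proof (rule ext)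
  fix t show "fourier_stieltjes p \<zeta> \<mu> t = (\<lambda>t\<in>hatZ p. h t) t"
    using assms by (cases "t \<in> hatZ p") (simp_all add: fourier_stieltjes_def)
qed

text \<open>Since \<open>FS\<close> is injective on distributions, \<open>evd\<close> and
  \<open>evc\<close> identify the same polynomials. Their vanishing ideals coincide, and the induced
  map is the identity of the common quotient.\<close>

lemma distribution_algebra_iso:
  fixes d :: nat and Xh :: "(nat \<Rightarrow> nat) \<Rightarrow> rat \<Rightarrow> 'l" and E :: "'l set"
  defines "P \<equiv> mpoly_ring E {1..d}" and "evd \<equiv> eval_dist p K (\<lambda>n. dist_of p K \<zeta> (Xh n))"
    and "evc \<equiv> eval_conv p Xh" and "FS \<equiv> fourier_stieltjes p \<zeta>"
  assumes ex1: "\<And>n. n \<in> multi_indices d \<Longrightarrow>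
      \<exists>!\<mu>. \<mu> \<in> distributions p K \<and> (\<forall>t\<in>hatZ p. fourier_stieltjes p \<zeta> \<mu> t = Xh n t)"
    and E: "subring_set E" "E \<subseteq> K"
  shows "\<forall>f\<in>carrier P. evd f \<in> distributions p K \<and> FS (evd f) = evc f"
    and "bij_betw FS (evd ` carrier P) (evc ` carrier P)"
    and "induced_map P evd evc FS \<in> ring_iso (value_algebra P evd) (value_algebra P evc)"
    and "\<forall>f\<in>carrier P. induced_map P evd evc FS (vanishing_ideal P evd +>\<^bsub>P\<^esub> f) = vanishing_ideal P evc +>\<^bsub>P\<^esub> f"
proof -
  interpret P: cring P unfolding P_def by (rule cring_mpoly_ring[OF E(1)])
  note P_simps = mpoly_ring_simps[of E "{1..d}", folded P_def]
  note sr = subring_mpolys[OF E(1), of "{1..d}"]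
  note PE = subring_setD[OF sr, folded P_simps(5)]
  have dist: "dist_of p K \<zeta> (Xh n) \<in> distributions p K"
    "\<And>t. t \<in> hatZ p \<Longrightarrow> FS (dist_of p K \<zeta> (Xh n)) t = Xh n t" if "n \<in> multi_indices d" for n
    using theI'[OF ex1[OF that]] unfolding dist_of_def FS_def by blast+
  show 1: "\<forall>f\<in>carrier P. evd f \<in> distributions p K \<and> FS (evd f) = evc f"
  proof
    fix f assume f: "f \<in> carrier P"
    have m: "Poly_Mapping.lookup m \<in> multi_indices d" if "m \<in> Poly_Mapping.keys f" for m
    proof -
      have "Poly_Mapping.keys m \<subseteq> {1..d}" using f that unfolding P_simps by (simp add: mpolys_def)
      then show ?thesis by (auto simp: multi_indices_def in_keys_iff)
    qed
    have c: "Poly_Mapping.lookup f m \<in> K" for m using f E(2) unfolding P_simps by (auto simp: mpolys_def)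
    note FSs = fourier_stieltjes_sum[OF finite_keys dist(1)[OF m] c]
    have "FS (evd f) t = (\<Sum>m\<in>Poly_Mapping.keys f. Poly_Mapping.lookup f m * Xh (Poly_Mapping.lookup m) t)"
      if t: "t \<in> hatZ p" for t
    proof -
      have "FS (evd f) t = (\<Sum>m\<in>Poly_Mapping.keys f. Poly_Mapping.lookup f m * FS (dist_of p K \<zeta> (Xh (Poly_Mapping.lookup m))) t)"
        unfolding FS_def evd_def eval_dist_def by (rule FSs(2)) (assumption | rule t)+
      then show ?thesis using dist(2)[OF m t] by simp
    qed
    then have "FS (evd f) = evc f"
      unfolding evc_def eval_conv_def FS_def by (rule fourier_stieltjes_ext)
    moreover have "evd f \<in> distributions p K"
      unfolding evd_def eval_dist_def by (rule FSs(1))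
    ultimately show "evd f \<in> distributions p K \<and> FS (evd f) = evc f" by simp
  qed
  have inj: "evd f = evd g \<longleftrightarrow> evc f = evc g" if "f \<in> carrier P" "g \<in> carrier P" for f g
  proof
    assume "evc f = evc g"
    then have "FS (evd f) = FS (evd g)" using 1 that by simp
    then show "evd f = evd g"
      using 1 that unfolding FS_def by (intro fourier_stieltjes_inject) auto
  next
    assume "evd f = evd g"
    then show "evc f = evc g" using 1 that by metis
  qed
  show "bij_betw FS (evd ` carrier P) (evc ` carrier P)"
    unfolding bij_betw_def
  proof
    show "inj_on FS (evd ` carrier P)"
      using 1 unfolding FS_def by (intro inj_onI fourier_stieltjes_inject) auto
    show "FS ` evd ` carrier P = evc ` carrier P"
      unfolding image_image using 1 by (intro image_cong) auto
  qed
  have add: "evc (f + g) = (\<lambda>t\<in>hatZ p. evc f t + evc g t)" for f g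
    unfolding evc_def eval_conv_def
    by (rule restrict_ext, simp, rule setsum_keys_plus_distrib) (auto simp: algebra_simps)
  have zero: "evc 0 = (\<lambda>t\<in>hatZ p. 0)" by (simp add: evc_def eval_conv_def)
  have evc_eq: "evc f = evc g \<longleftrightarrow> evc (f - g) = evc 0" for f g
  proof -
    have e: "evc f = (\<lambda>t\<in>hatZ p. evc (f - g) t + evc g t)" using add[of "f - g" g] by simp
    have x: "evc h \<in> extensional (hatZ p)" for h by (simp add: evc_def eval_conv_def)
    show ?thesis
    proof
      assume "evc f = evc g"
      show "evc (f - g) = evc 0"
      proof (rule extensionalityI[OF x x])
        fix t assume t: "t \<in> hatZ p"
        have "evc f t = evc (f - g) t + evc g t" using fun_cong[OF e, of t] t by simp
        then show "evc (f - g) t = evc 0 t" using \<open>evc f = evc g\<close> t by (simp add: zero)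
      qed
    next
      assume "evc (f - g) = evc 0"
      show "evc f = evc g"
      proof (rule extensionalityI[OF x x])
        fix t assume t: "t \<in> hatZ p"
        have "evc f t = evc (f - g) t + evc g t" using fun_cong[OF e, of t] t by simp
        then show "evc f t = evc g t" using \<open>evc (f - g) = evc 0\<close> t by (simp add: zero)
      qed
    qed
  qed
  define J where "J = vanishing_ideal P evc"
  have J_iff: "f \<in> J \<longleftrightarrow> f \<in> carrier P \<and> (\<forall>h\<in>carrier P. evc (h * f) = evc 0)" for f
    unfolding J_def vanishing_ideal_def by (simp add: P_simps)
  have J_evd: "vanishing_ideal P evd = J"
    unfolding J_def vanishing_ideal_def using inj by (auto simp: P.zero_closed)
  have diffP: "f - g \<in> carrier P" if "f \<in> carrier P" "g \<in> carrier P" for f g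
    using PE(2)[OF that(1) PE(4)[OF that(2)]] by simp
  have minus: "f \<ominus>\<^bsub>P\<^esub> g = f - g" if "f \<in> carrier P" "g \<in> carrier P" for f g
    using that unfolding P_simps(5) by (rule mpoly_ring_minus[of E f "{1..d}" g, OF E(1), folded P_def])
  \<comment> \<open>Congruence modulo \<open>J\<close> means that all multiples have equal values,
    which is the condition in \<open>induced_map\<close>.\<close>
  have same: "g - f \<in> J \<longleftrightarrow> (\<forall>h\<in>carrier P. evc (h * g) = evc (h * f))" if "f \<in> carrier P" "g \<in> carrier P" for f g
    unfolding J_iff using diffP[OF that(2,1)] evc_eq by (simp add: right_diff_distrib)
  have idJ: "ideal J P"
  proof (rule idealI[OF P.ring_axioms])
    show "subgroup J (add_monoid P)"
    proof (rule P.add.subgroupI)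
      show "J \<subseteq> carrier P" by (auto simp: J_iff)
      have "0 \<in> J" using P.zero_closed by (simp add: J_iff P_simps)
      then show "J \<noteq> {}" by blast
      fix f assume f: "f \<in> J"
      then have fP: "f \<in> carrier P" by (simp add: J_iff)
      have "\<ominus>\<^bsub>P\<^esub> f = - f" using minus[OF P.zero_closed fP] fP by (simp add: a_minus_def P_simps(2,4))
      moreover have "evc (h * - f) = evc 0" if h: "h \<in> carrier P" for h
        using f PE(4)[OF h] unfolding J_iff by (metis minus_mult_commute)
      ultimately show "\<ominus>\<^bsub>P\<^esub> f \<in> J" using PE(4)[OF fP] by (simp add: J_iff)
      fix g assume g: "g \<in> J"
      have "(\<lambda>t\<in>hatZ p. evc 0 t + evc 0 t) = evc 0" by (auto simp: zero fun_eq_iff)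
      then have "evc (h * (f + g)) = evc 0" if "h \<in> carrier P" for h
        using f g that unfolding J_iff distrib_left add by simp
      then show "f \<oplus>\<^bsub>P\<^esub> g \<in> J"
        using f g PE(2) unfolding J_iff P_simps(2) by simp
    qed
    fix f x assume f: "f \<in> J" and x: "x \<in> carrier P"
    have "evc (h * (x * f)) = evc 0" if h: "h \<in> carrier P" for h
      using f PE(3)[OF h x] unfolding J_iff by (metis mult.assoc)
    then show "x \<otimes>\<^bsub>P\<^esub> f \<in> J" using f x PE(3) by (auto simp: J_iff P_simps)
    then show "f \<otimes>\<^bsub>P\<^esub> x \<in> J" by (simp add: P_simps mult.commute)
  qed
  interpret J: ideal J P by (rule idJ)
  have ind: "induced_map P evd evc FS (J +>\<^bsub>P\<^esub> f) = J +>\<^bsub>P\<^esub> f" if f: "f \<in> carrier P" for f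
  proof -
    have "g \<in> induced_map P evd evc FS (J +>\<^bsub>P\<^esub> f) \<longleftrightarrow> g \<in> J +>\<^bsub>P\<^esub> f" for g
    proof
      assume "g \<in> induced_map P evd evc FS (J +>\<^bsub>P\<^esub> f)"
      then obtain f' where g: "g \<in> carrier P" and f': "f' \<in> J +>\<^bsub>P\<^esub> f"
        and "\<forall>h\<in>carrier P. evc (h * g) = FS (evd (h * f'))"
        unfolding induced_map_def P_simps(1) by blast
      moreover have f'P: "f' \<in> carrier P" "f' - f \<in> J" using f' f J.coset_mem_iff[OF f] minus by auto
      ultimately have "\<forall>h\<in>carrier P. evc (h * g) = evc (h * f')" using 1 PE(3) by simp
      then have "g - f' \<in> J" using same[OF f'P(1) g] by simp
      then have "(g - f') \<oplus>\<^bsub>P\<^esub> (f' - f) \<in> J" using f'P(2) by (rule J.a_closed)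
      then show "g \<in> J +>\<^bsub>P\<^esub> f" using g f J.coset_mem_iff[OF f] minus by (simp add: P_simps)
    next
      assume g: "g \<in> J +>\<^bsub>P\<^esub> f"
      then have "g \<in> carrier P" using J.coset_mem_iff[OF f] by simp
      then show "g \<in> induced_map P evd evc FS (J +>\<^bsub>P\<^esub> f)"
        unfolding induced_map_def P_simps(1) using g 1 PE(3) by (auto intro!: bexI[of _ g])
    qed
    then show ?thesis by blast
  qed
  show "\<forall>f\<in>carrier P. induced_map P evd evc FS (vanishing_ideal P evd +>\<^bsub>P\<^esub> f) = vanishing_ideal P evc +>\<^bsub>P\<^esub> f"
    using ind by (simp add: J_evd flip: J_def)
  have alg: "value_algebra P evd = P Quot J" "value_algebra P evc = P Quot J"
    by (simp_all add: value_algebra_def J_evd flip: J_def)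
  interpret Q: ring "P Quot J" by (rule J.quotient_is_ring)
  have id: "induced_map P evd evc FS c = c" if "c \<in> carrier (P Quot J)" for c
    using that ind by (auto simp: carrier_Quot)
  show "induced_map P evd evc FS \<in> ring_iso (value_algebra P evd) (value_algebra P evc)"
    unfolding alg ring_iso_def
  proof (intro CollectI conjI)
    show "induced_map P evd evc FS \<in> ring_hom (P Quot J) (P Quot J)"
      by (rule ring_hom_memI) (simp_all add: id)
    show "bij_betw (induced_map P evd evc FS) (carrier (P Quot J)) (carrier (P Quot J))"
      using id by (intro bij_betwI[where g = "\<lambda>c. c"]) auto
  qed
qed

end

section \<open>The affine equations over the localized quotient\<close>

lemma cyclotomic_frac_unity_roots:
  fixes \<zeta> :: "nat \<Rightarrow> 'l::field"
  assumes "2 \<le> p" "cyclotomic_frac p A \<iota> \<zeta>"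
  shows "unity_roots p \<zeta>"
proof
  have c: "CHAR('l) = 0 \<or> coprime CHAR('l) p" using assms(2) by (simp add: cyclotomic_frac_def)
  have "\<not> CHAR('l) dvd p"
  proof
    assume dvd: "CHAR('l) dvd p"
    then have "CHAR('l) \<noteq> 0" using assms(1) by (metis dvd_0_left_iff not_numeral_le_zero)
    then have "CHAR('l) = 1" using c dvd by (metis coprime_absorb_left nat_dvd_1_iff_1)
    then show False using of_nat_CHAR[where 'a = 'l] by simp
  qed
  then show "of_nat p \<noteq> (0::'l)" by (simp add: of_nat_eq_0_iff_char_dvd)
qed (use assms in \<open>auto simp: cyclotomic_frac_def\<close>)

lemma subfield_frac_field:
  fixes \<iota> :: "'a \<Rightarrow> 'l::field"
  assumes A: "cring A" and \<iota>: "\<iota> \<in> ring_hom A ring_of_type_algebra"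
  shows "subfield_set (frac_field A \<iota>)" "x \<in> carrier A \<Longrightarrow> \<iota> x \<in> frac_field A \<iota>"
proof -
  interpret A: cring A by (rule A)
  note h = ring_hom_typeE[OF \<iota>] A.ring_hom_type_zero[OF \<iota>]
  have I: "\<iota> x / \<iota> y \<in> frac_field A \<iota>" if "x \<in> carrier A" "y \<in> carrier A" "\<iota> y \<noteq> 0" for x y
    using that unfolding frac_field_def by blast
  show "\<iota> x \<in> frac_field A \<iota>" if "x \<in> carrier A" for x
    using I[of x "\<one>\<^bsub>A\<^esub>"] that h by simp
  show "subfield_set (frac_field A \<iota>)"
    unfolding subfield_set_def
  proof (intro conjI ballI)
    show "0 \<in> frac_field A \<iota>" "1 \<in> frac_field A \<iota>"
      using I[of "\<zero>\<^bsub>A\<^esub>" "\<one>\<^bsub>A\<^esub>"] I[of "\<one>\<^bsub>A\<^esub>" "\<one>\<^bsub>A\<^esub>"] h by auto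
    fix q assume "q \<in> frac_field A \<iota>"
    then obtain x y where q: "q = \<iota> x / \<iota> y" "x \<in> carrier A" "y \<in> carrier A" "\<iota> y \<noteq> 0"
      unfolding frac_field_def by blast
    have "\<iota> (\<ominus>\<^bsub>A\<^esub> x) = - \<iota> x"
      using A.ring_hom_type_minus[OF \<iota> A.zero_closed q(2)] q(2) h by (simp add: a_minus_def)
    then show "- q \<in> frac_field A \<iota>" using I[of "\<ominus>\<^bsub>A\<^esub> x" y] q by simp
    show "inverse q \<in> frac_field A \<iota>"
    proof (cases "\<iota> x = 0")
      case True
      then show ?thesis using I[of "\<zero>\<^bsub>A\<^esub>" "\<one>\<^bsub>A\<^esub>"] h q by simp
    next
      case False
      then show ?thesis using I[of y x] q by simp
    qed
    fix q' assume "q' \<in> frac_field A \<iota>"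
    then obtain x' y' where q': "q' = \<iota> x' / \<iota> y'" "x' \<in> carrier A" "y' \<in> carrier A" "\<iota> y' \<noteq> 0"
      unfolding frac_field_def by blast
    have "q * q' = \<iota> (x \<otimes>\<^bsub>A\<^esub> x') / \<iota> (y \<otimes>\<^bsub>A\<^esub> y')" using q q' h by simp
    then show "q * q' \<in> frac_field A \<iota>" using I[of "x \<otimes>\<^bsub>A\<^esub> x'" "y \<otimes>\<^bsub>A\<^esub> y'"] q q' h by simp
    have "q + q' = \<iota> (x \<otimes>\<^bsub>A\<^esub> y' \<oplus>\<^bsub>A\<^esub> x' \<otimes>\<^bsub>A\<^esub> y) / \<iota> (y \<otimes>\<^bsub>A\<^esub> y')"
      using q q' h by (simp add: add_frac_eq)
    then show "q + q' \<in> frac_field A \<iota>"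
      using I[of "x \<otimes>\<^bsub>A\<^esub> y' \<oplus>\<^bsub>A\<^esub> x' \<otimes>\<^bsub>A\<^esub> y" "y \<otimes>\<^bsub>A\<^esub> y'"] q q' h by simp
  qed
qed

text \<open>The root test is carried out upstairs in \<open>calR\<close>, where the coefficients
  have positive absolute values. The resulting bound on digit products then passes to the smaller
  quotient absolute values.\<close>

lemma (in localized_quotient) affine_frame_calQ:
  assumes c: "c \<noteq> 0" "c \<noteq> (1::'k)"
    and F: "is_frame p (calR OK d p) F" "decay_condition OK d p F"
    and Q: "is_frame p (calQ OK d p I) (quot_frame F)" and j: "j \<in> {1..d}"
  shows "affine_frame (calQ OK d p I) p (quot_frame F) (\<lambda>k. to_calQ OK d p I (ivar (Ind_a j k)))
    (\<lambda>k. to_calQ OK d p I (ivar (Ind_b j k))) (to_calQ OK d p I (ivar (Ind_x j)))"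
proof (intro affine_frame.intro affine_frame_axioms.intro cring_calQ p_ge_2 Q)
  show "to_calQ OK d p I (ivar (Ind_x j)) \<in> carrier (calQ OK d p I)"
    using coeff_Rx(3)[OF j] by (rule to_calQ_closed)
  show "(\<one>\<^bsub>calQ OK d p I\<^esub> \<ominus>\<^bsub>calQ OK d p I\<^esub> to_calQ OK d p I (ivar (Ind_a j 0)))
    \<otimes>\<^bsub>calQ OK d p I\<^esub> to_calQ OK d p I (ivar (Ind_x j)) = \<one>\<^bsub>calQ OK d p I\<^esub>"
    using j by (rule to_calQ_inverse)
next
  fix k assume k: "k < p"
  show "to_calQ OK d p I (ivar (Ind_a j k)) \<in> carrier (calQ OK d p I)"
    using coeff_Rx(1)[OF j k] by (rule to_calQ_closed)
  show "to_calQ OK d p I (ivar (Ind_b j k)) \<in> carrier (calQ OK d p I)"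
    using coeff_Rx(2)[OF j k] by (rule to_calQ_closed)
next
  fix z assume "z \<in> frame_dom (quot_frame F)"
  then have z: "z \<in> frame_dom F" by (simp add: quot_frame_def)
  have zp: "z \<in> Zp p" and absF: "absolute_value (calR OK d p) (frame_abs F z)"
    using F(1) z unfolding is_frame_def by blast+
  have absQ: "absolute_value (calQ OK d p I) (frame_abs (quot_frame F) z)"
    using Q z unfolding is_frame_def by (simp add: quot_frame_def)
  define v where "v k = frame_abs F z (to_calR OK d p (ivar (Ind_a j k)))" for k
  have v: "0 < v k" if k: "k < p" for k
  proof -
    have "to_calR OK d p (ivar (Ind_a j k)) \<in> carrier (calR OK d p)"
      using coeff_Rx(1)[OF j k] by (rule to_calR_closed)
    then show ?thesis
      using to_calR_coeff_nonzero[OF c j k] absF unfolding absolute_value_def v_def by (metis less_le)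
  qed
  have p_pos: "0 < p" using p_ge_2 by simp
  define f where "f n = (\<Prod>k=1..<p. (v k / v 0) powr (real (digit_count p k (trunc p n z)) / real n))" for n
  have lim: "ereal (v 0) * limsup (\<lambda>n. ereal (f n)) < 1"
    using F(2) z j unfolding decay_condition_def Let_def v_def f_def by blast
  have "0 \<le> f n" for n unfolding f_def by (intro prod_nonneg) auto
  moreover have "0 < n \<Longrightarrow> (\<Prod>i<n. v (z i)) = (v 0 * f n) ^ n" for n
    unfolding f_def by (rule prod_digits_eq[OF zp p_ge_2 v])
  ultimately obtain C r where Cr: "0 \<le> r" "r < 1" "\<And>n. (\<Prod>i<n. v (z i)) \<le> C * r ^ n"
    using limsup_root_decay[of "v 0" f "\<lambda>n. \<Prod>i<n. v (z i)", OF v[OF p_pos] lim] by blast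
  have le: "0 \<le> frame_abs (quot_frame F) z (to_calQ OK d p I (ivar (Ind_a j k))) \<and>
      frame_abs (quot_frame F) z (to_calQ OK d p I (ivar (Ind_a j k))) \<le> v k" if k: "k < p" for k
  proof
    note a = coeff_Rx(1)[OF j k]
    show "0 \<le> frame_abs (quot_frame F) z (to_calQ OK d p I (ivar (Ind_a j k)))"
      using absQ to_calQ_closed[OF a] unfolding absolute_value_def by blast
    \<comment> \<open>On the reals \<open>INF\<close> is a lower bound only of a set that is bounded
      below.\<close>
    have "bdd_below (frame_abs F z ` to_calQ OK d p I (ivar (Ind_a j k)))"
      using absF to_calQ_subset[OF a] unfolding absolute_value_def by (intro bdd_belowI[of _ 0]) blast
    then show "frame_abs (quot_frame F) z (to_calQ OK d p I (ivar (Ind_a j k))) \<le> v k"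
      unfolding quot_frame_def v_def using to_calR_mem_to_calQ[OF a] by (simp add: cINF_lower)
  qed
  have "(\<Prod>i<n. frame_abs (quot_frame F) z (to_calQ OK d p I (ivar (Ind_a j (z i))))) \<le> C * r ^ n" for n
    using prod_mono[of "{..<n}" "\<lambda>i. frame_abs (quot_frame F) z (to_calQ OK d p I (ivar (Ind_a j (z i))))" "\<lambda>i. v (z i)"]
      le zp Cr(3)[of n] by (force simp: Zp_def)
  then show "\<exists>C r. 0 \<le> r \<and> r < 1 \<and> (\<forall>n. (\<Prod>i<n. frame_abs (quot_frame F) z
      (to_calQ OK d p I (ivar (Ind_a j (z i))))) \<le> C * r ^ n)"
    using Cr by blast
qed

theorem corollary1:
  fixes d p :: nat
    and OK :: "'k::field set"
    and F :: "'k ipoly set frame"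
    and I :: "'k ipoly set"
    and \<iota> :: "'k ipoly set set \<Rightarrow> 'l::field"
    and \<zeta> :: "nat \<Rightarrow> 'l"
  assumes "1 \<le> d" and "2 \<le> p"
    and "global_field TYPE('k)"
    and "CHAR('k) = 0 \<or> coprime CHAR('k) p"
    and "ring_of_integers OK"
    and "is_frame p (calR OK d p) F"
    and "digital p (calR OK d p) F"
    and "decay_condition OK d p F"
    and "ideal I (R_ring OK d p)"
    and "\<forall>j\<in>{1..d}. \<not> PIdl\<^bsub>R_ring OK d p\<^esub> (1 - ivar (Ind_a j 0)) \<subseteq> I"
    and "is_frame p (calQ OK d p I) (quot_frame F)"
  shows
    "(\<forall>j\<in>{1..d}. \<exists>!Xf. rising_continuous p (calQ OK d p I) (quot_frame F) Xf \<and>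
        solves_equation OK d p I (quot_frame F) j Xf) \<and>
     (cyclotomic_frac p (calQ OK d p I) \<iota> \<zeta> \<longrightarrow>
       (\<forall>Xf. (\<forall>j\<in>{1..d}. rising_continuous p (calQ OK d p I) (quot_frame F) (Xf j) \<and>
              solves_equation OK d p I (quot_frame F) j (Xf j)) \<longrightarrow>
         (let A = calQ OK d p I;
              KK = frac_field A \<iota>;
              a = (\<lambda>j k. \<iota> (to_calQ OK d p I (ivar (Ind_a j k))));
              b = (\<lambda>j k. \<iota> (to_calQ OK d p I (ivar (Ind_b j k))))
          in \<exists>Xh.
            (\<forall>t\<in>hatZ p. Xh (\<lambda>_. 0) t = one_zero t) \<and>
            (\<forall>j\<in>{1..d}. \<forall>t\<in>hatZ p.
               Xh (unit_index j) t = affine_ft p (digit_ft p \<zeta> (a j)) (digit_ft p \<zeta> (b j)) t) \<and>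
            (\<forall>n\<in>multi_indices d. n \<noteq> (\<lambda>_. 0) \<longrightarrow>
               (\<forall>t\<in>hatZ p. Xh n t = fhat p d \<zeta> a b Xh n t - ghat p d \<zeta> a b Xh n t)) \<and>
            (\<forall>n\<in>multi_indices d.
               quasi_integrable p A (quot_frame F) \<iota> \<zeta> (prod_fun_CF A (quot_frame F) d Xf n) \<and>
               is_fourier_transform p A (quot_frame F) \<iota> \<zeta>
                 (prod_fun_CF A (quot_frame F) d Xf n) (Xh n)) \<and>
            (\<forall>j\<in>{1..d}. is_fourier_transform p A (quot_frame F) \<iota> \<zeta> (Xf j) (Xh (unit_index j)) \<and>
               (\<exists>\<mu>\<in>distributions p KK.
                  \<forall>t\<in>hatZ p. fourier_stieltjes p \<zeta> \<mu> t = Xh (unit_index j) t)) \<and>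
            (\<forall>n\<in>multi_indices d. \<exists>!\<mu>. \<mu> \<in> distributions p KK \<and>
               (\<forall>t\<in>hatZ p. fourier_stieltjes p \<zeta> \<mu> t = Xh n t)) \<and>
            (\<forall>E. subfield E ring_of_type_algebra \<and> E \<subseteq> KK \<longrightarrow>
               (let P = mpoly_ring E {1..d};
                    evd = eval_dist p KK (\<lambda>n. dist_of p KK \<zeta> (Xh n));
                    evc = eval_conv p Xh;
                    FS = fourier_stieltjes p \<zeta>
                in (\<forall>f\<in>carrier P. evd f \<in> distributions p KK \<and> FS (evd f) = evc f) \<and>
                   bij_betw FS (evd ` carrier P) (evc ` carrier P) \<and>
                   induced_map P evd evc FS \<in> ring_iso (value_algebra P evd) (value_algebra P evc) \<and>
                   (\<forall>f\<in>carrier P. induced_map P evd evc FS (vanishing_ideal P evd +>\<^bsub>P\<^esub> f) =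
                      vanishing_ideal P evc +>\<^bsub>P\<^esub> f))))))"
proof -
  define A where "A = calQ OK d p I"
  define G where "G = quot_frame F"
  define a where "a = (\<lambda>j k. to_calQ OK d p I (ivar (Ind_a j k)))"
  define b where "b = (\<lambda>j k. to_calQ OK d p I (ivar (Ind_b j k)))"
  define u where "u = (\<lambda>j. to_calQ OK d p I (ivar (Ind_x j)))"
  interpret I: ideal I "R_ring OK d p" by fact
  have OK: "subring_set OK"
    using I.ring_axioms unfolding R_ring_def by (rule subring_coeffs)
  interpret LQ: localized_quotient OK d p I
    by unfold_locales (use \<open>2 \<le> p\<close> OK I.a_subset in auto)
  obtain c :: 'k where c: "c \<noteq> 0" "c \<noteq> 1"
    using global_field_nontrivial[OF \<open>global_field TYPE('k)\<close>] by blast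
  have A: "cring A" "is_frame p A G"
    using LQ.cring_calQ assms(11) by (simp_all add: A_def G_def)
  have af: "affine_frame A p G (a j) (b j) (u j)" if "j \<in> {1..d}" for j
    unfolding A_def G_def a_def b_def u_def
    using assms(6,8,11) that by (intro LQ.affine_frame_calQ[OF c])
  have solves: "solves_equation OK d p I G j f \<longleftrightarrow> affine_frame.solves A G (a j) (b j) f" if "j \<in> {1..d}" for j f
    by (simp only: affine_frame.solves_def[OF af[OF that]] solves_equation_def Let_def)
      (simp only: A_def a_def b_def)
  have part1: "\<forall>j\<in>{1..d}. \<exists>!Xf. rising_continuous p A G Xf \<and> solves_equation OK d p I G j Xf"
    using solves affine_frame.ex1_rising_continuous[OF af] by simp
  show ?thesis
    unfolding Let_def A_def[symmetric] G_def[symmetric]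
  proof (intro conjI impI allI, goal_cases)
    case 1
    show ?case by (rule part1)
  next
    case (2 Xf)
    note cyc = 2(1) and Xf = 2(2)
    interpret unity_roots p \<zeta> by (rule cyclotomic_frac_unity_roots[OF \<open>2 \<le> p\<close> cyc])
    have \<iota>: "\<iota> \<in> ring_hom A ring_of_type_algebra" using cyc by (simp add: cyclotomic_frac_def)
    let ?K = "frac_field A \<iota>"
    let ?a = "\<lambda>j k. \<iota> (a j k)" and ?b = "\<lambda>j k. \<iota> (b j k)"
    interpret distribution_setting p \<zeta> ?K
      by unfold_locales (rule subfield_frac_field(1)[OF A(1) \<iota>])
    \<comment> \<open>The transforms are built from the coefficients and the roots of unity alone;
      the frame enters when convergence is shown.\<close>
    obtain Xh where ts: "transform_system p \<zeta> d ?a ?b Xh" using transform_system_exists by blast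
    interpret T: transform_system p \<zeta> d ?a ?b Xh by (rule ts)
    have aK: "?a j k \<in> ?K" "?b j k \<in> ?K" if "j \<in> {1..d}" "k < p" for j k
      using affine_frame.a_closed[OF af[OF that(1)] that(2)] affine_frame.b_closed[OF af[OF that(1)] that(2)]
      by (auto intro: subfield_frac_field(2)[OF A(1) \<iota>])
    \<comment> \<open>Whatever solutions are given, their values are classes of digit series, whose
      images under \<iota> are the intercepts B_N in the field.\<close>
    have cls: "Xf j z = valued_ring.cls A (frame_abs G z) (\<lambda>n. affine_frame.aseries A (a j) (b j) n z)"
      if j: "j \<in> {1..d}" and z: "z \<in> frame_dom G" for j z
    proof -
      interpret J: affine_frame A p G "a j" "b j" "u j" by (rule af[OF j])
      have "rising_continuous p A G (Xf j)" "solves_equation OK d p I G j (Xf j)" using Xf j by blast+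
      then have "rising_continuous p A G (Xf j)" "J.solves (Xf j)" by (simp_all only: solves[OF j])
      moreover from this have "Xf j \<in> CF A G" by (simp add: rising_continuous_def)
      ultimately show ?thesis using J.rising_continuous_iff z by blast
    qed
    have ser: "(\<lambda>n. affine_frame.aseries A (a j) (b j) n z) \<in> carrier (cauchy_ring A (frame_abs G z))"
        "\<iota> (affine_frame.aseries A (a j) (b j) m z) = digit_series (?a j) (?b j) m z"
      if j: "j \<in> {1..d}" and z: "z \<in> frame_dom G" for j z m
      using affine_frame.aseries_Cauchy[OF af[OF j] z]
        affine_frame.hom_aprod_aseries(2)[OF af[OF j] \<iota> affine_frame.dom_Zp[OF af[OF j] z]] by auto
    have valued: "valued_ring A (frame_abs G z)" if "z \<in> frame_dom G" for z
      using A that unfolding is_frame_def valued_ring_def valued_ring_axioms_def by blast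
    have prodCF: "prod_fun_CF A G d Xf n \<in> CF A G" for n
      unfolding CF_def prod_fun_CF_def
    proof (rule restrict_PiE_iff[THEN iffD2], intro ballI)
      fix z assume z: "z \<in> frame_dom G"
      interpret C: cring "compl_at A G z" by (rule valued_ring.cring_completion[OF valued[OF z]])
      have "Xf j z \<in> carrier (compl_at A G z)" if "j \<in> {1..d}" for j
        unfolding cls[OF that z] by (rule valued_ring.cls_closed[OF valued[OF z] ser(1)[OF that z]])
      then show "finprod (compl_at A G z) (\<lambda>j. Xf j z [^]\<^bsub>compl_at A G z\<^esub> n j) {1..d} \<in> carrier (compl_at A G z)"
        by (intro C.finprod_closed) auto
    qed
    have prod_ft: "is_fourier_transform p A G \<iota> \<zeta> (prod_fun_CF A G d Xf n) (Xh n)" if n: "n \<in> multi_indices d" for n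
    proof (rule is_fourier_transform_Xh[OF ts A af \<iota> n])
      fix z assume z: "z \<in> frame_dom G"
      interpret V: valued_ring A "frame_abs G z" by (rule valued[OF z])
      interpret C: cring "compl_at A G z" by (rule V.cring_completion)
      have "prod_fun_CF A G d Xf n z
        = finprod (compl_at A G z) (\<lambda>j. V.cls (\<lambda>m. affine_frame.aseries A (a j) (b j) m z) [^]\<^bsub>compl_at A G z\<^esub> n j) {1..d}"
        unfolding prod_fun_CF_def restrict_apply if_P[OF z]
      proof (rule C.finprod_cong'[OF refl])
        show "(\<lambda>j. V.cls (\<lambda>m. affine_frame.aseries A (a j) (b j) m z) [^]\<^bsub>compl_at A G z\<^esub> n j)
            \<in> {1..d} \<rightarrow> carrier (compl_at A G z)"
          using V.cls_closed[OF ser(1)[OF _ z]] by (intro Pi_I C.nat_pow_closed)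
      qed (simp only: cls[OF _ z])
      then show "\<exists>s\<in>carrier V.CR. prod_fun_CF A G d Xf n z = V.cls s \<and>
          (\<forall>m. \<iota> (s m) = (\<Prod>j=1..d. digit_series (?a j) (?b j) m z ^ n j))"
        using V.finprod_cls[OF \<iota>, of "{1..d}" "\<lambda>j m. affine_frame.aseries A (a j) (b j) m z" n,
            OF finite_atLeastAtMost ser(1)[OF _ z]]
          prod.cong[OF refl arg_cong[OF ser(2)[OF _ z], of _ "\<lambda>x. x ^ n _"], of "{1..d}"]
        by (simp only:)
    qed
    have unit_ft: "is_fourier_transform p A G \<iota> \<zeta> (Xf j) (Xh (unit_index j))" if j: "j \<in> {1..d}" for j
    proof (rule is_fourier_transform_Xh[OF ts A af \<iota> unit_index_multi[OF j]])
      fix z assume z: "z \<in> frame_dom G"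
      show "\<exists>s\<in>carrier (cauchy_ring A (frame_abs G z)). Xf j z = valued_ring.cls A (frame_abs G z) s \<and>
          (\<forall>m. \<iota> (s m) = (\<Prod>i=1..d. digit_series (?a i) (?b i) m z ^ unit_index j i))"
        unfolding prod_unit_index[OF j] using cls[OF j z] ser[OF j z] by auto
    qed
    have dist: "\<exists>!\<mu>. \<mu> \<in> distributions p ?K \<and> (\<forall>t\<in>hatZ p. fourier_stieltjes p \<zeta> \<mu> t = Xh n t)"
      if n: "n \<in> multi_indices d" for n
      by (rule distribution_ex1, rule T.psum_Xh_in_subfield[OF subfield_K aK n Zp_digits])
    have "(\<forall>t\<in>hatZ p. Xh (\<lambda>_. 0) t = one_zero t)" using T.Xh_0 by blast
    moreover have "\<forall>j\<in>{1..d}. \<forall>t\<in>hatZ p. Xh (unit_index j) t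
        = affine_ft p (digit_ft p \<zeta> (?a j)) (digit_ft p \<zeta> (?b j)) t"
      using T.Xh_unit by blast
    moreover have "\<forall>n\<in>multi_indices d. n \<noteq> (\<lambda>_. 0) \<longrightarrow> (\<forall>t\<in>hatZ p.
        Xh n t = fhat p d \<zeta> ?a ?b Xh n t - ghat p d \<zeta> ?a ?b Xh n t)"
      using T.Xh_rec by blast
    moreover have "\<forall>n\<in>multi_indices d. quasi_integrable p A G \<iota> \<zeta> (prod_fun_CF A G d Xf n) \<and>
        is_fourier_transform p A G \<iota> \<zeta> (prod_fun_CF A G d Xf n) (Xh n)"
      using prod_ft prodCF unfolding quasi_integrable_def by blast
    moreover have "\<forall>j\<in>{1..d}. is_fourier_transform p A G \<iota> \<zeta> (Xf j) (Xh (unit_index j)) \<and>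
        (\<exists>\<mu>\<in>distributions p ?K. \<forall>t\<in>hatZ p. fourier_stieltjes p \<zeta> \<mu> t = Xh (unit_index j) t)"
      using unit_ft dist[OF unit_index_multi] by blast
    moreover have "\<forall>n\<in>multi_indices d. \<exists>!\<mu>. \<mu> \<in> distributions p ?K \<and>
        (\<forall>t\<in>hatZ p. fourier_stieltjes p \<zeta> \<mu> t = Xh n t)"
      using dist by blast
    moreover note distribution_algebra_iso[OF dist subfield_subring_set]
    ultimately show ?case
      unfolding Let_def a_def b_def by (intro exI[of _ Xh] conjI allI impI) (elim conjE; assumption | blast)+
  qed
qed

end
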